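(* Let $r\ge 1$, let $w_1,\ldots,w_r$ be positive integers and let $d\in\mathbb{N}$. Let $f\in\mathbb{C}[x_1,\ldots,x_r]$ be a weighted homogeneous polynomial of type $(w_1,\ldots,w_r;d)$ defining an isolated singularity at the origin. Then the Milnor number of $f$ is $$\mu(f)=\prod_{i=1}^{r}\frac{d-w_i}{w_i}.$$
   Context: $\mathbb{N}$ denotes the nonnegative integers. A polynomial $f\in\mathbb{C}[x_1,\ldots,x_r]$ is weighted homogeneous of type $(w_1,\ldots,w_r;d)$ if every monomial $x^{\alpha}=x_1^{\alpha_1}\cdots x_r^{\alpha_r}$ appearing in $f$ with nonzero coefficient satisfies $\sum_{i=1}^{r}\alpha_i w_i=d$. Write $f_i:=\partial f/\partial x_i$ for $i=1,\ldots,r$. The polynomial $f$ is regarded as a holomorphic germ $f:(\mathbb{C}^r,0)\to(\mathbb{C},0)$ (so $f(0)=0$). It defines an isolated singularity at the origin if the origin is an isolated critical point of $f$, i.e. $f_1(0)=\cdots=f_r(0)=0$ and there is a neighbourhood of $0$ in $\mathbb{C}^r$ in which $0$ is the only common zero of $f_1,\ldots,f_r$. Let $\mathbb{C}\{x_1,\ldots,x_r\}$ be the ring of convergent power series. The Milnor algebra of $f$ is $$M_f=\frac{\mathbb{C}\{x_1,\ldots,x_r\}}{\langle f_1,\ldots,f_r\rangle},$$ and the Milnor number of $f$ is $\mu(f)=\dim_{\mathbb{C}}M_f$. *)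

theory Defs
  imports
    "HOL-Analysis.Analysis"
    "HOL-Library.Poly_Mapping"
    "HOL-Algebra.Embedded_Algebras"
    "HOL-Algebra.QuotRing"
begin

text \<open>
  The variables are indexed by a finite type \<open>'n\<close>, so \<open>r = CARD('n)\<close>; this is at least \<open>1\<close>
  because types are nonempty. Elements of \<open>'n \<Rightarrow>\<^sub>0 nat\<close> are the exponent vectors.
\<close>

type_synonym 'n expo = "'n \<Rightarrow>\<^sub>0 nat"

type_synonym 'n cmpoly = "'n expo \<Rightarrow>\<^sub>0 complex"

type_synonym 'n cseries = "'n expo \<Rightarrow> complex"

definition eval_monom :: "'n::finite expo \<Rightarrow> complex ^ 'n \<Rightarrow> complex" where
  "eval_monom \<alpha> x = (\<Prod>i\<in>UNIV. (x $ i) ^ Poly_Mapping.lookup \<alpha> i)"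

definition eval_poly :: "'n::finite cmpoly \<Rightarrow> complex ^ 'n \<Rightarrow> complex" where
  "eval_poly f x = (\<Sum>\<alpha>\<in>Poly_Mapping.keys f. Poly_Mapping.lookup f \<alpha> * eval_monom \<alpha> x)"

text \<open>Formal partial derivative: \<open>\<partial>\<^sub>i (c x\<^sup>\<alpha>) = c \<alpha>\<^sub>i x\<^sup>\<alpha>\<^sup>-\<^sup>e\<close> with \<open>e\<close> the unit vector at \<open>i\<close>; the
  truncated subtraction is harmless because the coefficient is \<open>0\<close> when \<open>\<alpha>\<^sub>i = 0\<close>.\<close>

definition partial_deriv :: "'n::finite \<Rightarrow> 'n cmpoly \<Rightarrow> 'n cmpoly" where
  "partial_deriv i f =
     (\<Sum>\<alpha>\<in>Poly_Mapping.keys f. Poly_Mapping.single (\<alpha> - Poly_Mapping.single i 1)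
                    (of_nat (Poly_Mapping.lookup \<alpha> i) * Poly_Mapping.lookup f \<alpha>))"

definition weighted_homogeneous :: "('n::finite \<Rightarrow> nat) \<Rightarrow> nat \<Rightarrow> 'n cmpoly \<Rightarrow> bool" where
  "weighted_homogeneous w d f \<longleftrightarrow> (\<forall>\<alpha>\<in>Poly_Mapping.keys f. (\<Sum>i\<in>UNIV. Poly_Mapping.lookup \<alpha> i * w i) = d)"

definition isolated_singularity :: "'n::finite cmpoly \<Rightarrow> bool" where
  "isolated_singularity f \<longleftrightarrow>
     eval_poly f 0 = 0 \<and>
     (\<forall>i. eval_poly (partial_deriv i f) 0 = 0) \<and>
     (\<exists>U. open U \<and> 0 \<in> U \<and>
        (\<forall>x\<in>U. (\<forall>i. eval_poly (partial_deriv i f) x = 0) \<longrightarrow> x = 0))"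

text \<open>A multivariate power series is convergent if it converges at every point of some
  neighbourhood of the origin. \<open>summable_on\<close> is unconditional (equivalently, absolute)
  convergence.\<close>

definition convergent_series :: "'n::finite cseries \<Rightarrow> bool" where
  "convergent_series a \<longleftrightarrow>
     (\<exists>U. open U \<and> 0 \<in> U \<and> (\<forall>x\<in>U. (\<lambda>\<alpha>. a \<alpha> * eval_monom \<alpha> x) summable_on UNIV))"

definition series_mult :: "'n::finite cseries \<Rightarrow> 'n cseries \<Rightarrow> 'n cseries" where
  "series_mult a b = (\<lambda>\<gamma>. \<Sum>(\<alpha>, \<beta>) | \<alpha> + \<beta> = \<gamma>. a \<alpha> * b \<beta>)"

definition const_series :: "complex \<Rightarrow> 'n::finite cseries" where
  "const_series c = (\<lambda>\<alpha>. if \<alpha> = 0 then c else 0)"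

definition convergent_series_ring :: "'n::finite cseries ring" where
  "convergent_series_ring =
     \<lparr>carrier = {a. convergent_series a}, mult = series_mult, one = const_series 1,
      zero = const_series 0, add = (\<lambda>a b \<alpha>. a \<alpha> + b \<alpha>)\<rparr>"

definition jacobian_ideal :: "'n::finite cmpoly \<Rightarrow> 'n cseries set" where
  "jacobian_ideal f =
     Idl\<^bsub>convergent_series_ring\<^esub> {Poly_Mapping.lookup (partial_deriv i f) | i. True}"

definition milnor_algebra :: "'n::finite cmpoly \<Rightarrow> 'n cseries set ring" where
  "milnor_algebra f = convergent_series_ring Quot jacobian_ideal f"

text \<open>The copy of the complex numbers in the Milnor algebra, as the field over which
  dimensions are taken.\<close>

definition milnor_scalars :: "'n::finite cmpoly \<Rightarrow> 'n cseries set set" where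
  "milnor_scalars f =
     {jacobian_ideal f +>\<^bsub>convergent_series_ring\<^esub> const_series c | c. True}"

definition milnor_finite :: "'n::finite cmpoly \<Rightarrow> bool" where
  "milnor_finite f \<longleftrightarrow>
     ring.finite_dimension (milnor_algebra f) (milnor_scalars f) (carrier (milnor_algebra f))"

text \<open>Only meaningful for \<open>f\<close> with \<open>milnor_finite f\<close>.\<close>

definition milnor_number :: "'n::finite cmpoly \<Rightarrow> nat" where
  "milnor_number f =
     ring.dim (milnor_algebra f) (milnor_scalars f) (carrier (milnor_algebra f))"


lemma eval_poly_superset:
  assumes "finite A" "Poly_Mapping.keys f \<subseteq> A"
  shows "eval_poly f x = (\<Sum>\<alpha>\<in>A. Poly_Mapping.lookup f \<alpha> * eval_monom \<alpha> x)"
  unfolding eval_poly_def using assms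
  by (intro sum.mono_neutral_left) (auto simp: in_keys_iff)

lemma eval_poly_add: "eval_poly (f + g) x = eval_poly f x + eval_poly g x"
proof -
  let ?A = "Poly_Mapping.keys f \<union> Poly_Mapping.keys g"
  have "Poly_Mapping.keys (f + g) \<subseteq> ?A" by (rule keys_add)
  then show ?thesis
    by (simp add: eval_poly_superset[of ?A] lookup_add algebra_simps sum.distrib)
qed

lemma eval_poly_zero [simp]: "eval_poly 0 x = 0"
  by (simp add: eval_poly_def)

lemma eval_poly_sum: "eval_poly (\<Sum>i\<in>A. f i) x = (\<Sum>i\<in>A. eval_poly (f i) x)"
  by (induction A rule: infinite_finite_induct) (simp_all add: eval_poly_add)

lemma eval_poly_single: "eval_poly (Poly_Mapping.single \<alpha> c) x = c * eval_monom \<alpha> x"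
  by (simp add: eval_poly_def)

lemma eval_monom_split:
  "eval_monom \<alpha> x = (x $ i) ^ Poly_Mapping.lookup \<alpha> i * (\<Prod>j\<in>UNIV - {i}. (x $ j) ^ Poly_Mapping.lookup \<alpha> j)"
  unfolding eval_monom_def by (subst prod.remove[of _ i]) auto

lemma eval_monom_add: "eval_monom (\<alpha> + \<beta>) x = eval_monom \<alpha> x * eval_monom \<beta> x"
  by (simp add: eval_monom_def lookup_add power_add prod.distrib)

lemma partial_deriv_has_field_derivative:
  fixes f :: "'n::finite cmpoly" and x :: "complex ^ 'n"
  shows "((\<lambda>t. eval_poly f (x + axis i t)) has_field_derivative
            eval_poly (partial_deriv i f) x) (at 0)"
proof -
  have mono: "((\<lambda>t. eval_monom \<alpha> (x + axis i t)) has_field_derivative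
          of_nat (Poly_Mapping.lookup \<alpha> i) * eval_monom (\<alpha> - Poly_Mapping.single i 1) x) (at 0)" for \<alpha>
  proof -
    let ?P = "\<Prod>j\<in>UNIV - {i}. (x $ j) ^ Poly_Mapping.lookup \<alpha> j"
    have "(\<lambda>t. eval_monom \<alpha> (x + axis i t)) = (\<lambda>t. (x $ i + t) ^ Poly_Mapping.lookup \<alpha> i * ?P)"
      by (auto simp: eval_monom_split[of _ _ i] axis_def intro!: ext prod.cong)
    moreover have "eval_monom (\<alpha> - Poly_Mapping.single i 1) x = (x $ i) ^ (Poly_Mapping.lookup \<alpha> i - 1) * ?P"
      by (auto simp: eval_monom_split[of _ _ i] lookup_minus lookup_single when_def intro!: prod.cong)
    moreover have "((\<lambda>t. (x $ i + t) ^ Poly_Mapping.lookup \<alpha> i * ?P) has_field_derivative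
        of_nat (Poly_Mapping.lookup \<alpha> i) * ((x $ i) ^ (Poly_Mapping.lookup \<alpha> i - 1) * ?P)) (at 0)"
      by (auto intro!: derivative_eq_intros)
    ultimately show ?thesis by simp
  qed
  show ?thesis
    unfolding eval_poly_def[of f] partial_deriv_def eval_poly_sum eval_poly_single
    by (rule derivative_eq_intros DERIV_sum DERIV_cmult mono)+ (simp add: mult_ac)
qed

lemma finite_expo_splits: "finite {(\<alpha>, \<beta>). \<alpha> + \<beta> = (\<gamma> :: 'n::finite expo)}"
proof -
  let ?F = "PiE UNIV (\<lambda>i. {..Poly_Mapping.lookup \<gamma> i})"
  have "finite ?F" by (rule finite_PiE) simp_all
  moreover have "Poly_Mapping.lookup ` {\<alpha>. \<exists>\<beta>. \<alpha> + \<beta> = \<gamma>} \<subseteq> ?F" by (auto simp: lookup_add)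
  ultimately have "finite {\<alpha>. \<exists>\<beta>. \<alpha> + \<beta> = \<gamma>}"
    by (meson finite_subset finite_imageD inj_on_subset subset_UNIV inj_onI lookup_inject)
  moreover have "{(\<alpha>, \<beta>). \<alpha> + \<beta> = \<gamma>} \<subseteq> (\<lambda>\<alpha>. (\<alpha>, \<gamma> - \<alpha>)) ` {\<alpha>. \<exists>\<beta>. \<alpha> + \<beta> = \<gamma>}"
    by (auto simp: image_iff)
  ultimately show ?thesis by (meson finite_imageI finite_subset)
qed

lemma series_mult_commute: "series_mult a b = series_mult b a"
  unfolding series_mult_def
  by (intro ext sum.reindex_bij_witness[of _ prod.swap prod.swap]) (auto simp: add.commute mult.commute)

lemma series_mult_assoc:
  "series_mult (series_mult a b) c = series_mult a (series_mult b c)"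
proof
  fix \<gamma> :: "'a expo"
  let ?S = "\<lambda>\<gamma>. {(\<alpha>, \<beta>). \<alpha> + \<beta> = (\<gamma> :: 'a expo)}"
  note [simp] = finite_expo_splits
  have "series_mult (series_mult a b) c \<gamma> =
      (\<Sum>p\<in>?S \<gamma>. \<Sum>q\<in>?S (fst p). a (fst q) * b (snd q) * c (snd p))"
    by (simp add: series_mult_def sum_distrib_right case_prod_beta)
  also have "\<dots> = (\<Sum>(p, q)\<in>Sigma (?S \<gamma>) (\<lambda>p. ?S (fst p)). a (fst q) * b (snd q) * c (snd p))"
    by (rule sum.Sigma) auto
  also have "\<dots> = (\<Sum>(p, q)\<in>Sigma (?S \<gamma>) (\<lambda>p. ?S (snd p)). a (fst p) * (b (fst q) * c (snd q)))"
    by (rule sum.reindex_bij_witness[of _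
          "\<lambda>(p, q). ((fst p + fst q, snd q), (fst p, fst q))"
          "\<lambda>(p, q). ((fst q, snd q + snd p), (snd q, snd p))"])
       (auto simp: add.assoc mult.assoc)
  also have "\<dots> = (\<Sum>p\<in>?S \<gamma>. \<Sum>q\<in>?S (snd p). a (fst p) * (b (fst q) * c (snd q)))"
    by (rule sum.Sigma[symmetric]) auto
  also have "\<dots> = series_mult a (series_mult b c) \<gamma>"
    by (simp add: series_mult_def sum_distrib_left case_prod_beta)
  finally show "series_mult (series_mult a b) c \<gamma> = series_mult a (series_mult b c) \<gamma>" .
qed

lemma series_mult_const: "series_mult (const_series c) a = (\<lambda>\<alpha>. c * a \<alpha>)"
proof
  fix \<gamma> :: "'a expo"
  have "series_mult (const_series c) a \<gamma> = (\<Sum>p\<in>{(0 :: 'a expo, \<gamma>)}. c * a (snd p))"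
    unfolding series_mult_def case_prod_beta
    by (rule sum.mono_neutral_cong_right)
       (auto simp: finite_expo_splits[unfolded case_prod_beta] const_series_def split: if_splits)
  then show "series_mult (const_series c) a \<gamma> = c * a \<gamma>" by simp
qed

lemma series_mult_add:
  "series_mult (\<lambda>\<alpha>. a \<alpha> + b \<alpha>) c = (\<lambda>\<alpha>. series_mult a c \<alpha> + series_mult b c \<alpha>)"
  by (simp add: series_mult_def case_prod_beta algebra_simps sum.distrib)

lemma convergent_series_add:
  assumes "convergent_series a" "convergent_series b"
  shows "convergent_series (\<lambda>\<alpha>. a \<alpha> + b \<alpha>)"
proof -
  obtain U V where U: "open U" "0 \<in> U" "\<And>x. x \<in> U \<Longrightarrow> (\<lambda>\<alpha>. a \<alpha> * eval_monom \<alpha> x) summable_on UNIV"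
    and V: "open V" "0 \<in> V" "\<And>x. x \<in> V \<Longrightarrow> (\<lambda>\<alpha>. b \<alpha> * eval_monom \<alpha> x) summable_on UNIV"
    using assms unfolding convergent_series_def by blast
  show ?thesis
    unfolding convergent_series_def
    by (rule exI[of _ "U \<inter> V"]) (auto simp: U V algebra_simps open_Int intro!: summable_on_add)
qed

lemma convergent_series_finite_support:
  assumes "finite {\<alpha>. a \<alpha> \<noteq> 0}"
  shows "convergent_series a"
proof -
  have "(\<lambda>\<alpha>. a \<alpha> * eval_monom \<alpha> x) summable_on UNIV" for x
  proof (subst summable_on_cong_neutral[of "{\<alpha>. a \<alpha> \<noteq> 0}" UNIV])
    show "(\<lambda>\<alpha>. a \<alpha> * eval_monom \<alpha> x) summable_on {\<alpha>. a \<alpha> \<noteq> 0}"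
      using assms by (rule summable_on_finite)
  qed auto
  then show ?thesis unfolding convergent_series_def by (intro exI[of _ UNIV]) auto
qed

lemma convergent_series_lookup: "convergent_series (Poly_Mapping.lookup f)"
  by (rule convergent_series_finite_support) simp

lemma convergent_series_const: "convergent_series (const_series c)"
  by (rule convergent_series_finite_support, rule finite_subset[of _ "{0}"])
     (auto simp: const_series_def)

lemma summable_series_mult:
  fixes a b :: "'n::finite cseries"
  assumes "(\<lambda>\<alpha>. a \<alpha> * eval_monom \<alpha> x) summable_on UNIV"
    and "(\<lambda>\<alpha>. b \<alpha> * eval_monom \<alpha> x) summable_on UNIV"
  shows "(\<lambda>\<alpha>. series_mult a b \<alpha> * eval_monom \<alpha> x) summable_on UNIV"
proof -
  let ?g = "\<lambda>(\<alpha>, \<beta>). (a \<alpha> * eval_monom \<alpha> x) * (b \<beta> * eval_monom \<beta> x)"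
  let ?S = "\<lambda>\<gamma>. {(\<alpha>, \<beta>). \<alpha> + \<beta> = (\<gamma> :: 'n expo)}"
  have "(\<lambda>p. norm (?g p)) summable_on UNIV \<times> UNIV"
  proof (rule Infinite_Sum.abs_summable_on_Sigma_iff[THEN iffD2], intro conjI ballI)
    have a: "(\<lambda>\<alpha>. norm (a \<alpha> * eval_monom \<alpha> x)) summable_on UNIV"
      and b: "(\<lambda>\<alpha>. norm (b \<alpha> * eval_monom \<alpha> x)) summable_on UNIV"
      using assms by (simp_all only: summable_on_iff_abs_summable_on_complex)
    show "(\<lambda>\<beta>. norm (?g (\<alpha>, \<beta>))) summable_on UNIV" for \<alpha>
      using summable_on_cmult_right[OF b, of "norm (a \<alpha> * eval_monom \<alpha> x)"]
      by (simp add: norm_mult mult_ac)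
    show "(\<lambda>\<alpha>. norm (infsum (\<lambda>\<beta>. norm (?g (\<alpha>, \<beta>))) UNIV)) summable_on UNIV"
      using summable_on_cmult_left[OF a, of "infsum (\<lambda>\<beta>. norm (b \<beta> * eval_monom \<beta> x)) UNIV"]
      by (simp add: norm_mult[of "_ * eval_monom _ x"] infsum_cmult_right' infsum_nonneg abs_mult)
  qed
  then have g: "?g summable_on UNIV"
    using abs_summable_summable by auto
  have "(\<lambda>(\<gamma>, p). ?g p) summable_on Sigma UNIV ?S"
  proof (rule summable_on_reindex_bij_witness[where S = UNIV and g = ?g
          and i = snd and j = "\<lambda>p. (fst p + snd p, p)", THEN iffD1])
  qed (use g in auto)
  then have "(\<lambda>\<gamma>. infsum ?g (?S \<gamma>)) summable_on UNIV"
    by (auto dest: summable_on_Sigma_banach)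
  moreover have "infsum ?g (?S \<gamma>) = series_mult a b \<gamma> * eval_monom \<gamma> x" for \<gamma>
  proof -
    have "infsum ?g (?S \<gamma>) = sum ?g (?S \<gamma>)" by (rule infsum_finite) (rule finite_expo_splits)
    also have "\<dots> = series_mult a b \<gamma> * eval_monom \<gamma> x"
      unfolding series_mult_def sum_distrib_right
      by (rule sum.cong) (auto simp: eval_monom_add)
    finally show ?thesis .
  qed
  ultimately show ?thesis by simp
qed

lemma convergent_series_mult:
  assumes "convergent_series a" "convergent_series b"
  shows "convergent_series (series_mult a b)"
proof -
  obtain U V where U: "open U" "0 \<in> U" "\<And>x. x \<in> U \<Longrightarrow> (\<lambda>\<alpha>. a \<alpha> * eval_monom \<alpha> x) summable_on UNIV"
    and V: "open V" "0 \<in> V" "\<And>x. x \<in> V \<Longrightarrow> (\<lambda>\<alpha>. b \<alpha> * eval_monom \<alpha> x) summable_on UNIV"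
    using assms unfolding convergent_series_def by blast
  show ?thesis
    unfolding convergent_series_def
    by (rule exI[of _ "U \<inter> V"]) (auto simp: U V open_Int intro!: summable_series_mult)
qed

lemma convergent_series_ring_is_cring: "cring (convergent_series_ring :: 'n::finite cseries ring)"
proof (rule cringI)
  note defs = convergent_series_ring_def
  show "abelian_group (convergent_series_ring :: 'n cseries ring)"
  proof (rule abelian_groupI, goal_cases)
    case (6 a)
    have "convergent_series (series_mult (const_series (-1)) a)"
      using 6 by (intro convergent_series_mult convergent_series_const) (simp add: defs)
    then show ?case
      by (intro bexI[of _ "\<lambda>\<alpha>. - a \<alpha>"]) (auto simp: defs series_mult_const const_series_def[of 0])
  next
    case 2
    show ?case by (simp add: defs convergent_series_const)
  qed (auto simp: defs convergent_series_add const_series_def algebra_simps)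
  show "comm_monoid (convergent_series_ring :: 'n cseries ring)"
    by (rule comm_monoidI)
       (auto simp: defs convergent_series_mult convergent_series_const series_mult_assoc
          series_mult_const intro: series_mult_commute)
qed (auto simp: convergent_series_ring_def series_mult_add)

lemma milnor_algebra_is_cring: "cring (milnor_algebra f)"
proof -
  interpret cring "convergent_series_ring :: 'a cseries ring"
    by (rule convergent_series_ring_is_cring)
  have "ideal (jacobian_ideal f) convergent_series_ring"
    unfolding jacobian_ideal_def
    by (rule genideal_ideal) (auto simp: convergent_series_ring_def convergent_series_lookup)
  then show ?thesis
    unfolding milnor_algebra_def by (rule ideal.quotient_is_cring) (rule cring_axioms)
qed

end

theory Submission
  imports Defs
    "HOL-Computational_Algebra.Fundamental_Theorem_Algebra"
    "HOL-Computational_Algebra.Polynomial_FPS"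
begin

text \<open>
  The partial derivatives \<open>f\<^sub>i\<close> are weighted homogeneous of degree \<open>d - w\<^sub>i\<close>, and by the scaling action
  the origin is their only common zero. The Nullstellensatz therefore puts a power of every variable
  into \<open>(f\<^sub>1, \<dots>, f\<^sub>r)\<close>. The variables form a regular sequence of the same length \<open>r\<close> acting nilpotently
  on the Koszul homology of the \<open>f\<^sub>i\<close>, so this homology vanishes in positive degrees and the \<open>f\<^sub>i\<close>
  form a regular sequence. Hence the quotient of the polynomial ring has Hilbert series
  \<open>\<Prod>\<^sub>i (1 - t\<^sup>d\<^sup>-\<^sup>w\<^sup>i) / (1 - t\<^sup>w\<^sup>i)\<close>, whose value at \<open>t = 1\<close> is the product in the theorem. Passing to
  convergent power series changes nothing: a series whose terms have large exponents lies in the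
  Jacobian ideal, and a polynomial in the Jacobian ideal is a polynomial combination of the \<open>f\<^sub>i\<close>, by
  comparing weighted homogeneous components.
\<close>

section \<open>Koszul complexes\<close>

text \<open>Two obstacles shape the argument. Exactness of the whole Koszul complex does not depend
  on the order of the generators, which is what allows the partial derivatives to be traded for the
  variables. The step from there to initial segments of the sequence is a Nakayama argument, and
  over the polynomial ring it works only for homogeneous chains and generators of positive degree.
  Hence a homogeneous variant of exactness, which gives regularity for homogeneous test elements; a
  dimension count in each weight asks for no more. Secondly, \<open>d > w_i\<close> is not assumed.
  It follows because exactness excludes a vanishing partial derivative, and one without constant
  term has only monomials of positive weight. The Nullstellensatz rests on a cardinality argument:
  the complex numbers are uncountable, and they are algebraically closed. Koszul indices are natural
  numbers because the signs need an order, which the type of the variables lacks.\<close>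

definition gideal :: "('i \<Rightarrow> 'a::comm_ring_1) \<Rightarrow> 'i set \<Rightarrow> 'a set" where
  "gideal g I = {p. \<exists>u. p = (\<Sum>k\<in>I. u k * g k)}"

lemma gideal_zero [simp]: "0 \<in> gideal g I"
  unfolding gideal_def by (auto intro!: exI[of _ "\<lambda>_. 0"])

lemma gideal_add: "p \<in> gideal g I \<Longrightarrow> q \<in> gideal g I \<Longrightarrow> p + q \<in> gideal g I"
  unfolding gideal_def
proof clarify
  fix u v show "\<exists>ua. (\<Sum>k\<in>I. u k * g k) + (\<Sum>k\<in>I. v k * g k) = (\<Sum>k\<in>I. ua k * g k)"
    by (rule exI[of _ "\<lambda>k. u k + v k"]) (simp add: algebra_simps sum.distrib)
qed

lemma gideal_mult: "p \<in> gideal g I \<Longrightarrow> q * p \<in> gideal g I"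
  unfolding gideal_def
proof clarify
  fix u show "\<exists>ua. q * (\<Sum>k\<in>I. u k * g k) = (\<Sum>k\<in>I. ua k * g k)"
    by (rule exI[of _ "\<lambda>k. q * u k"]) (simp add: algebra_simps sum_distrib_left)
qed

lemma gideal_sum: "(\<And>x. x \<in> A \<Longrightarrow> p x \<in> gideal g I) \<Longrightarrow> (\<Sum>x\<in>A. p x) \<in> gideal g I"
  by (induction A rule: infinite_finite_induct) (auto intro: gideal_add)

lemma gideal_uminus: "p \<in> gideal g I \<Longrightarrow> - p \<in> gideal g I"
  using gideal_mult[of p g I "-1"] by simp

lemma gideal_gen: "finite I \<Longrightarrow> k \<in> I \<Longrightarrow> g k \<in> gideal g I"
  unfolding gideal_def
  by (auto intro!: exI[of _ "\<lambda>j. if j = k then 1 else 0"] simp: if_distrib[of "\<lambda>x. x * _"] cong: if_cong)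

lemma gideal_insert:
  assumes "finite I" "i \<notin> I"
  shows "p \<in> gideal g (insert i I) \<longleftrightarrow> (\<exists>q\<in>gideal g I. \<exists>b. p = q + b * g i)"
proof
  assume "p \<in> gideal g (insert i I)"
  then obtain u where u: "p = (\<Sum>k\<in>insert i I. u k * g k)" by (auto simp: gideal_def)
  show "\<exists>q\<in>gideal g I. \<exists>b. p = q + b * g i"
    using u assms by (intro bexI[of _ "\<Sum>k\<in>I. u k * g k"] exI[of _ "u i"]) (auto simp: gideal_def)
next
  assume "\<exists>q\<in>gideal g I. \<exists>b. p = q + b * g i"
  then obtain u b where u: "p = (\<Sum>k\<in>I. u k * g k) + b * g i" by (auto simp: gideal_def)
  have "(\<Sum>k\<in>I. (u(i := b)) k * g k) = (\<Sum>k\<in>I. u k * g k)"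
    using assms by (intro sum.cong) auto
  then show "p \<in> gideal g (insert i I)"
    unfolding gideal_def using u assms by (auto intro!: exI[of _ "u(i := b)"])
qed

lemma gideal_trans:
  assumes "\<And>k. k \<in> I \<Longrightarrow> g k \<in> gideal h I'" "p \<in> gideal g I"
  shows "p \<in> gideal h I'"
  using assms(2) unfolding gideal_def[of g] by (auto intro!: gideal_sum gideal_mult assms(1))

text \<open>A chain assigns to \<open>S\<close> the coefficient of the basis vector \<open>e\<^sub>S\<close>; the sign counts the elements
  of \<open>S\<close> behind \<open>k\<close>, which makes \<open>koszul_sign_swap\<close> hold for every position of the new index, so that
  generators can be added to and removed from the complex in any order.\<close>

definition koszul_sign :: "nat set \<Rightarrow> nat \<Rightarrow> 'a::comm_ring_1" where
  "koszul_sign S k = (-1) ^ card {j\<in>S. k < j}"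

definition koszul_d :: "(nat \<Rightarrow> 'a::comm_ring_1) \<Rightarrow> nat set \<Rightarrow> (nat set \<Rightarrow> 'a) \<Rightarrow> nat set \<Rightarrow> 'a" where
  "koszul_d g I c S = (\<Sum>k\<in>I - S. koszul_sign S k * g k * c (insert k S))"

definition koszul_chain :: "nat set \<Rightarrow> nat \<Rightarrow> (nat set \<Rightarrow> 'a::comm_ring_1) \<Rightarrow> bool" where
  "koszul_chain I j c \<longleftrightarrow> (\<forall>S. c S \<noteq> 0 \<longrightarrow> S \<subseteq> I \<and> card S = j)"

text \<open>Vanishing of the Koszul homology in degree \<open>j\<close>. For finite \<open>I\<close>
  and \<open>j = 0\<close> it would make the \<open>g k\<close> generate the unit ideal, so the
  results on regular sequences speak of \<open>Suc j\<close>.\<close>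

definition koszul_exact :: "(nat \<Rightarrow> 'a::comm_ring_1) \<Rightarrow> nat set \<Rightarrow> nat \<Rightarrow> bool" where
  "koszul_exact g I j \<longleftrightarrow> (\<forall>c. koszul_chain I j c \<and> koszul_d g I c = (\<lambda>_. 0) \<longrightarrow>
     (\<exists>b. koszul_chain I (Suc j) b \<and> koszul_d g I b = c))"

text \<open>The chain \<open>a + b e_i\<close>. The sign is chosen so that the differential becomes
  \<open>(a, b) \<mapsto> (d a + g_i b, - d b)\<close>, with no sign left that depends on the
  position of \<open>i\<close>.\<close>

definition koszul_cone :: "nat \<Rightarrow> (nat set \<Rightarrow> 'a::comm_ring_1) \<Rightarrow> (nat set \<Rightarrow> 'a) \<Rightarrow> nat set \<Rightarrow> 'a" where
  "koszul_cone i a b S = (if i \<in> S then koszul_sign (S - {i}) i * b (S - {i}) else a S)"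

lemma koszul_sign_sq [simp]: "koszul_sign S k * koszul_sign S k = (1::'a::comm_ring_1)"
  by (simp add: koszul_sign_def flip: power_add mult_2)

lemma koszul_sign_sq' [simp]: "koszul_sign S k * (koszul_sign S k * x) = (x::'a::comm_ring_1)"
  by (metis koszul_sign_sq mult.assoc mult_1)

lemma koszul_sign_insert:
  assumes "finite S" "i \<notin> S"
  shows "koszul_sign (insert i S) k = (if k < i then - koszul_sign S k else (koszul_sign S k :: 'a::comm_ring_1))"
proof (cases "k < i")
  case True
  then have "{j\<in>insert i S. k < j} = insert i {j\<in>S. k < j}" by auto
  then show ?thesis using assms True by (simp add: koszul_sign_def)
next
  case False
  then have "{j\<in>insert i S. k < j} = {j\<in>S. k < j}" by auto
  then show ?thesis using False by (simp add: koszul_sign_def)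
qed

text \<open>The sign identity behind \<open>d d = 0\<close>. Inserting \<open>i\<close> flips the
  sign at \<open>k\<close> exactly if \<open>k < i\<close>, and inserting \<open>k\<close> flips the
  sign at \<open>i\<close> exactly if \<open>i < k\<close>, so one of the two factors flips.\<close>

lemma koszul_sign_swap:
  assumes "finite S" "i \<notin> S" "k \<notin> S" "i \<noteq> k"
  shows "koszul_sign (insert i S) k * koszul_sign (insert k S) i
     = - (koszul_sign S k * (koszul_sign S i :: 'a::comm_ring_1))"
  using assms(4) koszul_sign_insert[OF assms(1,2), of k, where 'a = 'a]
    koszul_sign_insert[OF assms(1,3), of i, where 'a = 'a]
  by (cases "k < i") simp_all

lemma koszul_chain_infinite: "koszul_chain I j c \<Longrightarrow> finite I \<Longrightarrow> infinite S \<Longrightarrow> c S = 0"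
  unfolding koszul_chain_def using finite_subset by blast

lemma koszul_chain_notin: "koszul_chain I j c \<Longrightarrow> i \<notin> I \<Longrightarrow> i \<in> S \<Longrightarrow> c S = 0"
  unfolding koszul_chain_def by blast

text \<open>The complex for \<open>insert i I\<close> is the mapping cone of multiplication by \<open>g i\<close> on the complex
  for \<open>I\<close>; this replaces all further sign computations.\<close>

lemma koszul_d_cone:
  assumes I: "finite I" "i \<notin> I" and a: "koszul_chain I j a" and b: "koszul_chain I j' b"
  shows "koszul_d g (insert i I) (koszul_cone i a b) =
     koszul_cone i (\<lambda>S. koszul_d g I a S + g i * b S) (\<lambda>S. - koszul_d g I b S)"
proof
  fix S
  show "koszul_d g (insert i I) (koszul_cone i a b) S =
     koszul_cone i (\<lambda>S. koszul_d g I a S + g i * b S) (\<lambda>S. - koszul_d g I b S) S"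
  proof (cases "finite S")
    case inf: False
    have *: "a T = 0" "b T = 0" if "infinite T" for T
      using that koszul_chain_infinite[OF a I(1)] koszul_chain_infinite[OF b I(1)] by simp_all
    have **: "koszul_cone i a b T = 0" if "infinite T" for T
      using that * by (simp add: koszul_cone_def)
    have "koszul_d g (insert i I) (koszul_cone i a b) S = 0"
      unfolding koszul_d_def using inf by (intro sum.neutral) (simp add: **)
    moreover have "koszul_d g I a T = 0" "koszul_d g I b T = 0" if "infinite T" for T
      unfolding koszul_d_def using that by (simp_all add: *)
    ultimately show ?thesis using inf * by (simp add: koszul_cone_def[of i _ _ S])
  next
    case fin: True
    show ?thesis
    proof (cases "i \<in> S")
      case True
      define T where "T = S - {i}"
      have T: "S = insert i T" "i \<notin> T" "finite T" using True fin by (auto simp: T_def)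
      have eq: "insert i I - S = I - T" using T I by auto
      have "koszul_d g (insert i I) (koszul_cone i a b) S =
        (\<Sum>k\<in>I - T. koszul_sign (insert i T) k * g k * (koszul_sign (insert k T) i * b (insert k T)))"
        unfolding koszul_d_def eq
      proof (rule sum.cong[OF refl])
        fix k assume k: "k \<in> I - T"
        then have "insert k S - {i} = insert k T" "i \<in> insert k S" using T I by auto
        then show "koszul_sign S k * g k * koszul_cone i a b (insert k S) =
           koszul_sign (insert i T) k * g k * (koszul_sign (insert k T) i * b (insert k T))"
          by (simp add: koszul_cone_def T(1))
      qed
      also have "\<dots> = (\<Sum>k\<in>I - T. (koszul_sign (insert i T) k * koszul_sign (insert k T) i) * (g k * b (insert k T)))"
        by (simp add: mult_ac)
      also have "\<dots> = (\<Sum>k\<in>I - T. - (koszul_sign T k * koszul_sign T i) * (g k * b (insert k T)))"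
        using T I by (intro sum.cong refl, subst koszul_sign_swap) auto
      also have "\<dots> = koszul_sign T i * (- koszul_d g I b T)"
        by (simp add: koszul_d_def sum_distrib_left sum_negf mult_ac)
      also have "\<dots> = koszul_cone i (\<lambda>S. koszul_d g I a S + g i * b S) (\<lambda>S. - koszul_d g I b S) S"
        using True by (simp add: koszul_cone_def T_def)
      finally show ?thesis .
    next
      case False
      have eq: "insert i I - S = insert i (I - S)" using False by auto
      have "koszul_d g (insert i I) (koszul_cone i a b) S =
          koszul_sign S i * g i * koszul_cone i a b (insert i S)
          + (\<Sum>k\<in>I - S. koszul_sign S k * g k * koszul_cone i a b (insert k S))"
        unfolding koszul_d_def eq using I by (subst sum.insert) auto
      also have "koszul_sign S i * g i * koszul_cone i a b (insert i S) = g i * b S"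
        using False by (simp add: koszul_cone_def mult_ac)
      also have "(\<Sum>k\<in>I - S. koszul_sign S k * g k * koszul_cone i a b (insert k S)) = koszul_d g I a S"
        unfolding koszul_d_def using False I by (intro sum.cong refl) (auto simp: koszul_cone_def)
      finally show ?thesis using False by (simp add: koszul_cone_def[of i _ _ S] add.commute)
    qed
  qed
qed

lemma koszul_chain_cone:
  assumes "finite I" "i \<notin> I" "koszul_chain I (Suc j) a" "koszul_chain I j b"
  shows "koszul_chain (insert i I) (Suc j) (koszul_cone i a b)"
  unfolding koszul_chain_def koszul_cone_def
proof (intro allI impI)
  fix S assume nz: "(if i \<in> S then koszul_sign (S - {i}) i * b (S - {i}) else a S) \<noteq> 0"
  show "S \<subseteq> insert i I \<and> card S = Suc j"
  proof (cases "i \<in> S")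
    case True
    then have "b (S - {i}) \<noteq> 0" using nz by auto
    then have "S - {i} \<subseteq> I" "card (S - {i}) = j" using assms(4) by (auto simp: koszul_chain_def)
    moreover have "finite S" using \<open>S - {i} \<subseteq> I\<close> assms(1) finite_subset[of "S - {i}" I] by simp
    ultimately show ?thesis using True card_Suc_Diff1[of S i] by auto
  next
    case False
    then show ?thesis using nz assms(3) by (auto simp: koszul_chain_def)
  qed
qed

lemma koszul_chain_decomp:
  assumes "finite I" "i \<notin> I" "koszul_chain (insert i I) (Suc j) c"
  obtains a b where "koszul_chain I (Suc j) a" "koszul_chain I j b" "c = koszul_cone i a b"
proof
  show "koszul_chain I (Suc j) (\<lambda>S. if i \<in> S then 0 else c S)"
    using assms by (auto simp: koszul_chain_def)
  show "koszul_chain I j (\<lambda>S. if i \<in> S then 0 else koszul_sign S i * c (insert i S))"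
    unfolding koszul_chain_def
  proof (intro allI impI)
    fix S assume nz: "(if i \<in> S then 0 else koszul_sign S i * c (insert i S)) \<noteq> 0"
    then have i: "i \<notin> S" and "c (insert i S) \<noteq> 0" by (auto split: if_splits)
    then have *: "insert i S \<subseteq> insert i I" "card (insert i S) = Suc j"
      using assms(3) unfolding koszul_chain_def by blast+
    then have "finite S" using assms(1) finite_subset[of "insert i S" "insert i I"] by simp
    then show "S \<subseteq> I \<and> card S = j" using * i by auto
  qed
  show "c = koszul_cone i (\<lambda>S. if i \<in> S then 0 else c S)
      (\<lambda>S. if i \<in> S then 0 else koszul_sign S i * c (insert i S))"
    by (auto simp: koszul_cone_def insert_absorb)
qed

text \<open>\<open>koszul_cone i\<close> reads \<open>a\<close> and \<open>b\<close> only at sets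
  without \<open>i\<close>; the second hypothesis pins the values that it cannot see.\<close>

lemma koszul_cone_inject:
  assumes "koszul_cone i a b = koszul_cone i a' b'" 
    and "\<And>S. i \<in> S \<Longrightarrow> a S = 0 \<and> a' S = 0 \<and> b S = 0 \<and> b' S = 0"
  shows "a = a'" "b = b'"
proof -
  have *: "koszul_cone i a b S = koszul_cone i a' b' S" for S using assms(1) by simp
  show "a = a'"
  proof
    fix S show "a S = a' S" using *[of S] assms(2)[of S] by (cases "i \<in> S") (auto simp: koszul_cone_def)
  qed
  show "b = b'"
  proof
    fix S show "b S = b' S"
    proof (cases "i \<in> S")
      case False
      then have "koszul_sign S i * b S = koszul_sign S i * b' S"
        using *[of "insert i S"] by (simp add: koszul_cone_def)
      then show ?thesis by (metis koszul_sign_sq')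
    qed (use assms(2) in auto)
  qed
qed

lemma koszul_d_notin:
  assumes "koszul_chain I j c" "i \<notin> I" "i \<in> S"
  shows "koszul_d g I c S = 0"
  unfolding koszul_d_def using assms by (intro sum.neutral) (auto simp: koszul_chain_notin)

lemma koszul_cone_zero [simp]: "koszul_cone i (\<lambda>_. 0) (\<lambda>_. 0) = (\<lambda>_. 0)"
  by (auto simp: koszul_cone_def)

lemma koszul_cone_cycleD:
  assumes I: "finite I" "i \<notin> I" and a: "koszul_chain I j a" and b: "koszul_chain I j' b"
    and "koszul_d g (insert i I) (koszul_cone i a b) = koszul_cone i a' b'"
    and "\<And>S. i \<in> S \<Longrightarrow> a' S = 0 \<and> b' S = 0"
  shows "a' S = koszul_d g I a S + g i * b S" "b' S = - koszul_d g I b S"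
proof -
  have *: "koszul_cone i a' b' = koszul_cone i (\<lambda>S. koszul_d g I a S + g i * b S) (\<lambda>S. - koszul_d g I b S)"
    using assms(5) koszul_d_cone[OF I a b] by metis
  have **: "i \<in> S \<Longrightarrow> a' S = 0 \<and> koszul_d g I a S + g i * b S = 0 \<and> b' S = 0 \<and> - koszul_d g I b S = 0" for S
    using assms(6) koszul_d_notin[OF a I(2)] koszul_d_notin[OF b I(2)] koszul_chain_notin[OF b I(2)] by simp
  show "a' S = koszul_d g I a S + g i * b S" "b' S = - koszul_d g I b S"
    using koszul_cone_inject[OF * **] by simp_all
qed

lemma koszul_d_add: "koszul_d g I (\<lambda>S. a S + b S) S = koszul_d g I a S + koszul_d g I b S"
  by (simp add: koszul_d_def algebra_simps sum.distrib)

lemma koszul_d_uminus: "koszul_d g I (\<lambda>S. - a S) S = - koszul_d g I a S"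
  by (simp add: koszul_d_def sum_negf)

lemma koszul_d_mult: "koszul_d g I (\<lambda>S. p * a S) S = p * koszul_d g I a S"
  by (simp add: koszul_d_def sum_distrib_left mult_ac)

lemma koszul_d_zero [simp]: "koszul_d g I (\<lambda>_. 0) S = 0"
  by (simp add: koszul_d_def)

lemma koszul_chain_zero [simp]: "koszul_chain I j (\<lambda>_. 0)"
  by (simp add: koszul_chain_def)

lemma koszul_chain_add: "koszul_chain I j a \<Longrightarrow> koszul_chain I j b \<Longrightarrow> koszul_chain I j (\<lambda>S. a S + b S)"
  unfolding koszul_chain_def
proof (intro allI impI)
  fix S assume "\<forall>S. a S \<noteq> 0 \<longrightarrow> S \<subseteq> I \<and> card S = j" "\<forall>S. b S \<noteq> 0 \<longrightarrow> S \<subseteq> I \<and> card S = j" "a S + b S \<noteq> 0"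
  then show "S \<subseteq> I \<and> card S = j" by (cases "a S = 0") auto
qed

lemma koszul_chain_mult: "koszul_chain I j a \<Longrightarrow> koszul_chain I j (\<lambda>S. p * a S)"
  unfolding koszul_chain_def
proof (intro allI impI)
  fix S assume "\<forall>S. a S \<noteq> 0 \<longrightarrow> S \<subseteq> I \<and> card S = j" "p * a S \<noteq> 0"
  then show "S \<subseteq> I \<and> card S = j" by (cases "a S = 0") auto
qed

lemma koszul_chain_uminus: "koszul_chain I j a \<Longrightarrow> koszul_chain I j (\<lambda>S. - a S)"
  unfolding koszul_chain_def by auto

section \<open>Exactness when generators are added or removed\<close>

lemma koszul_exactD:
  assumes "koszul_exact g I j" "koszul_chain I j c" "\<And>S. koszul_d g I c S = 0"
  shows "\<exists>b. koszul_chain I (Suc j) b \<and> (\<forall>S. koszul_d g I b S = c S)"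
proof -
  have "koszul_d g I c = (\<lambda>_. 0)" using assms(3) by auto
  then show ?thesis using assms(1,2) unfolding koszul_exact_def by metis
qed

text \<open>A piece of the long exact sequence of the cone: the homology for
  \<open>insert i I\<close> in degree \<open>Suc j\<close> is squeezed between that for
  \<open>I\<close> in degree \<open>Suc j\<close> and the kernel of \<open>g i\<close> on the
  homology in degree \<open>j\<close>. The hypothesis \<open>nzd\<close> says that this kernel is
  zero.\<close>

lemma koszul_exact_insert:
  assumes I: "finite I" "i \<notin> I" and ex: "koszul_exact g I (Suc j)"
    and nzd: "\<And>b c. koszul_chain I j b \<Longrightarrow> koszul_chain I (Suc j) c \<Longrightarrow> (\<And>S. koszul_d g I b S = 0) \<Longrightarrow>
      (\<And>S. koszul_d g I c S = g i * b S) \<Longrightarrow> \<exists>b'. koszul_chain I (Suc j) b' \<and> (\<forall>S. koszul_d g I b' S = b S)"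
  shows "koszul_exact g (insert i I) (Suc j)"
  unfolding koszul_exact_def
proof (intro allI impI, elim conjE)
  fix c assume c: "koszul_chain (insert i I) (Suc j) c" and dc: "koszul_d g (insert i I) c = (\<lambda>_. 0)"
  obtain a b where ab: "koszul_chain I (Suc j) a" "koszul_chain I j b" "c = koszul_cone i a b"
    using koszul_chain_decomp[OF I c] .
  have *: "0 = koszul_d g I a S + g i * b S" "0 = - koszul_d g I b S" for S
    using koszul_cone_cycleD[OF I ab(1,2), of g "\<lambda>_. 0" "\<lambda>_. 0"] dc ab(3) by auto
  have "\<exists>b'. koszul_chain I (Suc j) b' \<and> (\<forall>S. koszul_d g I b' S = b S)"
  proof (rule nzd[OF ab(2) koszul_chain_uminus[OF ab(1)]])
    show "koszul_d g I b S = 0" for S using *(2)[of S] by simp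
    show "koszul_d g I (\<lambda>S. - a S) S = g i * b S" for S
      using *(1)[of S] by (simp add: koszul_d_uminus minus_unique)
  qed
  then obtain b' where b': "koszul_chain I (Suc j) b'" "\<And>S. koszul_d g I b' S = b S" by auto
  \<comment> \<open>Since \<open>d a = - g_i b\<close> and \<open>b = d b'\<close>, adding
    \<open>g_i b'\<close> turns \<open>a\<close> into a cycle.\<close>
  have "koszul_d g I (\<lambda>S. a S + g i * b' S) S = 0" for S
    using *(1)[of S] by (simp add: koszul_d_add koszul_d_mult b')
  then obtain a' where a': "koszul_chain I (Suc (Suc j)) a'" "\<And>S. koszul_d g I a' S = a S + g i * b' S"
    using koszul_exactD[OF ex koszul_chain_add[OF ab(1) koszul_chain_mult[OF b'(1)]]] by blast
  have nb: "koszul_chain I (Suc j) (\<lambda>S. - b' S)" by (rule koszul_chain_uminus[OF b'(1)])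
  have "koszul_d g (insert i I) (koszul_cone i a' (\<lambda>S. - b' S)) = c"
    unfolding koszul_d_cone[OF I a'(1) nb] ab(3) by (simp add: koszul_d_uminus a' b')
  then show "\<exists>b. koszul_chain (insert i I) (Suc (Suc j)) b \<and> koszul_d g (insert i I) b = c"
    using koszul_chain_cone[OF I a'(1) nb] by blast
qed

lemma koszul_exact_insert':
  assumes "finite I" "i \<notin> I" "koszul_exact g I (Suc j)" "koszul_exact g I j"
  shows "koszul_exact g (insert i I) (Suc j)"
proof (rule koszul_exact_insert[OF assms(1-3)])
  fix b :: "nat set \<Rightarrow> 'a" assume "koszul_chain I j b" "\<And>S. koszul_d g I b S = 0"
  then show "\<exists>b'. koszul_chain I (Suc j) b' \<and> (\<forall>S. koszul_d g I b' S = b S)"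
    by (rule koszul_exactD[OF assms(4)])
qed

text \<open>Wedging with \<open>e_k\<close> is a homotopy for multiplication by \<open>g_k\<close>:
  if \<open>c = (a, b)\<close> is a cycle, then \<open>(0, a)\<close> has boundary
  \<open>(g_k a, - d a)\<close>, and the cycle condition turns \<open>- d a\<close> into
  \<open>g_k b\<close>.\<close>

lemma koszul_homotopy_gen:
  assumes "finite I" "k \<in> I" "koszul_chain I (Suc j) c" "\<And>S. koszul_d g I c S = 0"
  shows "\<exists>b. koszul_chain I (Suc (Suc j)) b \<and> (\<forall>S. koszul_d g I b S = g k * c S)"
proof -
  define I' where "I' = I - {k}"
  have I': "finite I'" "k \<notin> I'" "I = insert k I'" using assms by (auto simp: I'_def)
  obtain a b where ab: "koszul_chain I' (Suc j) a" "koszul_chain I' j b" "c = koszul_cone k a b"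
    using koszul_chain_decomp[OF I'(1,2)] assms(3) I'(3) by metis
  have "koszul_d g (insert k I') (koszul_cone k a b) = koszul_cone k (\<lambda>_. 0) (\<lambda>_. 0)"
    using assms(4) ab(3) I'(3) by auto
  note * = koszul_cone_cycleD[OF I'(1,2) ab(1,2) this]
  have **: "- koszul_d g I' a S = g k * b S" for S using *(1)[of S] by (simp add: minus_unique)
  have "koszul_d g I (koszul_cone k (\<lambda>_. 0) a) = (\<lambda>S. g k * c S)"
    unfolding I'(3) koszul_d_cone[OF I'(1,2) koszul_chain_zero[where j = "Suc (Suc j)"] ab(1)]
    using ** by (auto simp: koszul_cone_def ab(3) mult_ac)
  moreover have "koszul_chain I (Suc (Suc j)) (koszul_cone k (\<lambda>_. 0) a)"
    unfolding I'(3) by (rule koszul_chain_cone[OF I'(1,2) _ ab(1)]) simp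
  ultimately show ?thesis by metis
qed

lemma koszul_homotopy:
  assumes "finite I" "p \<in> gideal g I" "koszul_chain I (Suc j) c" "\<And>S. koszul_d g I c S = 0"
  shows "\<exists>b. koszul_chain I (Suc (Suc j)) b \<and> (\<forall>S. koszul_d g I b S = p * c S)"
proof -
  obtain u where u: "p = (\<Sum>k\<in>I. u k * g k)" using assms(2) by (auto simp: gideal_def)
  have "\<exists>b. koszul_chain I (Suc (Suc j)) b \<and> (\<forall>S. koszul_d g I b S = (\<Sum>k\<in>A. u k * g k) * c S)"
    if "finite A" "A \<subseteq> I" for A using that
  proof (induction A)
    case empty
    show ?case by (rule exI[of _ "\<lambda>_. 0"]) simp
  next
    case (insert k A)
    obtain b where b: "koszul_chain I (Suc (Suc j)) b" "\<And>S. koszul_d g I b S = (\<Sum>k\<in>A. u k * g k) * c S"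
      using insert by auto
    obtain b' where b': "koszul_chain I (Suc (Suc j)) b'" "\<And>S. koszul_d g I b' S = g k * c S"
      using koszul_homotopy_gen[OF assms(1) _ assms(3,4), of k] insert by auto
    have "koszul_chain I (Suc (Suc j)) (\<lambda>S. b S + u k * b' S)"
      by (intro koszul_chain_add koszul_chain_mult b(1) b'(1))
    moreover have "koszul_d g I (\<lambda>S. b S + u k * b' S) S = (\<Sum>k\<in>insert k A. u k * g k) * c S" for S
    proof -
      have "koszul_d g I (\<lambda>S. b S + u k * b' S) S = koszul_d g I b S + u k * koszul_d g I b' S"
        by (simp only: koszul_d_add koszul_d_mult)
      then show ?thesis using insert.hyps by (simp only: b(2) b'(2)) (simp add: algebra_simps)
    qed
    ultimately show ?case by blast
  qed
  then show ?thesis using u assms(1) by auto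
qed

text \<open>A cycle \<open>c\<close> killed by \<open>g i\<close> up to a boundary \<open>d a\<close> gives the cycle \<open>(a, - c)\<close> of the cone; writing
  that one as a boundary exhibits \<open>c\<close> as a boundary. Nilpotency reduces every cycle to this case.\<close>

lemma koszul_exact_remove:
  assumes I: "finite I" "i \<notin> I" and ex: "koszul_exact g (insert i I) (Suc (Suc j))"
    and nil: "g i ^ N \<in> gideal g I"
  shows "koszul_exact g I (Suc j)"
proof -
  have main: "\<exists>b. koszul_chain I (Suc (Suc j)) b \<and> (\<forall>S. koszul_d g I b S = c S)"
    if "koszul_chain I (Suc j) c" "\<And>S. koszul_d g I c S = 0"
      "\<exists>b. koszul_chain I (Suc (Suc j)) b \<and> (\<forall>S. koszul_d g I b S = g i ^ N * c S)" for c N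
    using that(3)
  proof (induction N)
    case (Suc N)
    then obtain a where a: "koszul_chain I (Suc (Suc j)) a" "\<And>S. koszul_d g I a S = g i ^ Suc N * c S" by auto
    let ?c' = "\<lambda>S. - (g i ^ N * c S)"
    have c': "koszul_chain I (Suc j) ?c'" using that(1) by (intro koszul_chain_uminus koszul_chain_mult)
    have "koszul_d g (insert i I) (koszul_cone i a ?c') = (\<lambda>_. 0)"
      unfolding koszul_d_cone[OF I a(1) c'] by (simp add: koszul_d_uminus koszul_d_mult a(2) that(2) mult.assoc)
    then obtain e where e: "koszul_chain (insert i I) (Suc (Suc (Suc j))) e"
        "\<And>S. koszul_d g (insert i I) e S = koszul_cone i a ?c' S"
      using koszul_exactD[OF ex koszul_chain_cone[OF I a(1) c']] by metis
    obtain a2 b2 where ab: "koszul_chain I (Suc (Suc (Suc j))) a2" "koszul_chain I (Suc (Suc j)) b2" "e = koszul_cone i a2 b2"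
      using koszul_chain_decomp[OF I e(1)] .
    have "?c' S = - koszul_d g I b2 S" for S
      using koszul_cone_cycleD(2)[OF I ab(1,2), of g a ?c'] e(2) ab(3)
        koszul_chain_notin[OF a(1) I(2)] koszul_chain_notin[OF c' I(2)] by auto
    then show ?case using Suc.IH ab(2) by auto
  qed simp
  show ?thesis
    unfolding koszul_exact_def
  proof (intro allI impI, elim conjE)
    fix c assume c: "koszul_chain I (Suc j) c" "koszul_d g I c = (\<lambda>_. 0)"
    then have c': "koszul_d g I c S = 0" for S by simp
    have "\<exists>b. koszul_chain I (Suc (Suc j)) b \<and> (\<forall>S. koszul_d g I b S = g i ^ N * c S)"
      by (rule koszul_homotopy[OF I(1) nil c(1)]) (rule c')
    with c(1) c' have "\<exists>b. koszul_chain I (Suc (Suc j)) b \<and> (\<forall>S. koszul_d g I b S = c S)"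
      by (rule main)
    then show "\<exists>b. koszul_chain I (Suc (Suc j)) b \<and> koszul_d g I b = c" by auto
  qed
qed

text \<open>Regularity is asked relative to every subset \<open>J\<close>, as the variables satisfy
  it, so it passes to subfamilies and the induction need not fix an order of the generators.\<close>

lemma koszul_exact_regular:
  assumes "finite I" 
    and "\<And>i J p. i \<in> I \<Longrightarrow> J \<subseteq> I - {i} \<Longrightarrow> g i * p \<in> gideal g J \<Longrightarrow> p \<in> gideal g J"
  shows "koszul_exact g I (Suc j)"
  using assms
proof (induction I arbitrary: j)
  case empty
  have "c = (\<lambda>_. 0)" if "koszul_chain {} (Suc j) c" for c :: "nat set \<Rightarrow> 'a"
  proof
    fix S show "c S = 0" using that by (cases "S = {}") (auto simp: koszul_chain_def)
  qed
  then show ?case unfolding koszul_exact_def using koszul_chain_zero by metis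
next
  case (insert i I)
  have ex: "koszul_exact g I (Suc j)" for j
  proof (rule insert.IH)
    fix k J p assume "k \<in> I" "J \<subseteq> I - {k}" "g k * p \<in> gideal g J"
    then show "p \<in> gideal g J" by (intro insert.prems[of k J p]) auto
  qed
  show ?case
  proof (cases j)
    \<comment> \<open>The homology in degree 0 is the ring modulo \<open>gideal g I\<close>, so
      injectivity of \<open>g i\<close> on it is regularity. In higher degrees exactness for
      \<open>I\<close> already suffices.\<close>
    case 0
    show ?thesis unfolding 0
    proof (rule koszul_exact_insert[OF insert(1,2) ex])
      fix b c :: "nat set \<Rightarrow> 'a"
      assume b: "koszul_chain I 0 b" and c: "koszul_chain I (Suc 0) c" 
        and dc: "\<And>S. koszul_d g I c S = g i * b S"
      have "g i * b {} = (\<Sum>k\<in>I. c {k} * g k)" 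
        using dc[of "{}"] by (simp add: koszul_d_def koszul_sign_def mult_ac)
      then have "g i * b {} \<in> gideal g I" by (auto simp: gideal_def)
      then have "b {} \<in> gideal g I" using insert.prems[of i I] insert(2) by auto
      then obtain u where u: "b {} = (\<Sum>k\<in>I. u k * g k)" by (auto simp: gideal_def)
      \<comment> \<open>The coefficients of the ideal membership, read as a 1-chain.\<close>
      define b' where "b' S = (if \<exists>k\<in>I. S = {k} then u (the_elem S) else 0)" for S
      have "koszul_chain I (Suc 0) b'" by (auto simp: koszul_chain_def b'_def)
      moreover have "koszul_d g I b' S = b S" for S
      proof (cases "S = {}")
        case True
        then show ?thesis by (simp add: koszul_d_def koszul_sign_def b'_def u mult_ac)
      next
        case False
        then have "b S = 0" using b insert(1) finite_subset[of S I] unfolding koszul_chain_def by (cases "b S = 0") auto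
        moreover have "b' (insert k S) = 0" if "k \<in> I - S" for k using False that by (auto simp: b'_def doubleton_eq_iff)
        ultimately show ?thesis by (simp add: koszul_d_def)
      qed
      ultimately show "\<exists>b'. koszul_chain I (Suc 0) b' \<and> (\<forall>S. koszul_d g I b' S = b S)" by auto
    qed
  next
    case (Suc j')
    then show ?thesis using ex koszul_exact_insert'[OF insert(1,2) ex] by auto
  qed
qed

text \<open>By \<open>koszul_exact_insert'\<close> each added generator lets homology climb by at
  most one degree.\<close>

lemma koszul_exact_union:
  assumes "finite A" "finite I" "A \<inter> I = {}" "\<And>j. j > m \<Longrightarrow> koszul_exact g I j"
  shows "j > m + card A \<Longrightarrow> koszul_exact g (A \<union> I) j"
  using assms(1,3)
proof (induction A arbitrary: j)
  case empty
  then show ?case using assms by auto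
next
  case (insert a A)
  then obtain j' where j: "j = Suc j'" "j' > m + card A" by (cases j) auto
  show ?case unfolding j(1) Un_insert_left
    by (rule koszul_exact_insert') (use insert j assms in auto)
qed

text \<open>Each use of \<open>koszul_exact_remove\<close> lowers by one the degree in which
  exactness is known. Nilpotency modulo \<open>gideal g I\<close> persists modulo the larger ideals
  of the intermediate complexes.\<close>

lemma koszul_exact_remove_many:
  assumes "finite A" "finite I" "A \<inter> I = {}" "\<And>i. i \<in> A \<Longrightarrow> \<exists>N. g i ^ N \<in> gideal g I"
    "koszul_exact g (A \<union> I) (Suc j + card A)"
  shows "koszul_exact g I (Suc j)"
  using assms(1,3-)
proof (induction A arbitrary: j)
  case (insert a A)
  obtain N where "g a ^ N \<in> gideal g I" using insert.prems(2)[of a] by auto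
  then have "g a ^ N \<in> gideal g (A \<union> I)"
    by (rule gideal_trans[rotated]) (use insert assms(2) in \<open>auto intro: gideal_gen\<close>)
  moreover have "koszul_exact g (insert a (A \<union> I)) (Suc (Suc (j + card A)))"
    using insert.prems(3) insert.hyps by simp
  moreover have "finite (A \<union> I)" "a \<notin> A \<union> I" using insert.hyps insert.prems(1) assms(2) by auto
  ultimately have "koszul_exact g (A \<union> I) (Suc j + card A)"
    using koszul_exact_remove[of "A \<union> I" a g "j + card A" N] by simp
  moreover have "A \<inter> I = {}" using insert.prems(1) by auto
  ultimately show ?case using insert.IH insert.prems(2) by blast
qed simp

text \<open>Depth does not depend on the sequence that computes it: adding the \<open>F\<close>-generators to the acyclic
  complex of \<open>X\<close> spreads homology over at most \<open>card F\<close> degrees, and removing the \<open>X\<close>-generators, which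
  act nilpotently on the homology, lowers the top degree by \<open>card X\<close>.\<close>

theorem koszul_exact_swap:
  assumes fin: "finite F" "finite X" and disj: "F \<inter> X = {}" and card: "card F = card X"
    and reg: "\<And>i J p. i \<in> X \<Longrightarrow> J \<subseteq> X - {i} \<Longrightarrow> g i * p \<in> gideal g J \<Longrightarrow> p \<in> gideal g J"
    and nil: "\<And>i. i \<in> X \<Longrightarrow> \<exists>N. g i ^ N \<in> gideal g F"
  shows "koszul_exact g F (Suc j)"
proof -
  have "koszul_exact g X j" if "j > 0" for j
    using koszul_exact_regular[OF fin(2) reg, where j = "j - 1"] that by simp
  then have "koszul_exact g (F \<union> X) (Suc j + card F)"
    by (rule koszul_exact_union[OF fin disj]) auto
  then have "koszul_exact g (X \<union> F) (Suc j + card X)"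
    using card by (simp only: Un_commute)
  moreover have "X \<inter> F = {}" using disj by blast
  ultimately show ?thesis using koszul_exact_remove_many[of X F g j] fin nil by blast
qed

section \<open>Weighted homogeneous components\<close>

abbreviation cst :: "complex \<Rightarrow> 'n::finite cmpoly" where
  "cst c \<equiv> Poly_Mapping.single 0 c"

definition var :: "'n::finite \<Rightarrow> 'n cmpoly" where
  "var i = Poly_Mapping.single (Poly_Mapping.single i 1) 1"

definition weight :: "('n::finite \<Rightarrow> nat) \<Rightarrow> 'n expo \<Rightarrow> nat" where
  "weight w \<alpha> = (\<Sum>i\<in>UNIV. Poly_Mapping.lookup \<alpha> i * w i)"

definition whomog :: "('n::finite \<Rightarrow> nat) \<Rightarrow> int \<Rightarrow> 'n cmpoly \<Rightarrow> bool" where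
  "whomog w k p \<longleftrightarrow> (\<forall>\<alpha>\<in>Poly_Mapping.keys p. int (weight w \<alpha>) = k)"

text \<open>Degrees are integers so that \<open>hpart_mult\<close> needs no case distinction.\<close>

definition hpart :: "('n::finite \<Rightarrow> nat) \<Rightarrow> int \<Rightarrow> 'n cmpoly \<Rightarrow> 'n cmpoly" where
  "hpart w k p = (\<Sum>\<alpha>\<in>{\<alpha>\<in>Poly_Mapping.keys p. int (weight w \<alpha>) = k}. Poly_Mapping.single \<alpha> (Poly_Mapping.lookup p \<alpha>))"

lemma lookup_sum_single:
  assumes "finite A"
  shows "Poly_Mapping.lookup (\<Sum>\<alpha>\<in>A. Poly_Mapping.single \<alpha> (c \<alpha>)) \<beta> = (if \<beta> \<in> A then c \<beta> else 0)"
  using assms by (simp add: lookup_sum lookup_single when_def if_distrib cong: if_cong)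

lemma cmpoly_sum_single: "(\<Sum>\<alpha>\<in>Poly_Mapping.keys p. Poly_Mapping.single \<alpha> (Poly_Mapping.lookup p \<alpha>)) = p"
  by (rule poly_mapping_eqI) (auto simp: lookup_sum_single in_keys_iff)

lemma cmpoly_induct [case_names single add]:
  assumes single: "\<And>\<alpha> c. P (Poly_Mapping.single \<alpha> c)" and add: "\<And>p q. P p \<Longrightarrow> P q \<Longrightarrow> P (p + q)"
  shows "P (p :: 'n::finite cmpoly)"
proof -
  have "P (\<Sum>\<alpha>\<in>A. Poly_Mapping.single \<alpha> (Poly_Mapping.lookup p \<alpha>))" if "finite A" for A
    using that
  proof (induction A)
    case empty
    show ?case using single[of 0 0] by simp
  qed (auto intro: single add)
  then show ?thesis by (metis cmpoly_sum_single finite_keys)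
qed

lemma weight_add: "weight w (\<alpha> + \<beta>) = weight w \<alpha> + weight w \<beta>"
  by (simp add: weight_def lookup_add algebra_simps sum.distrib)

lemma weight_zero [simp]: "weight w 0 = 0"
  by (simp add: weight_def)

lemma weight_single [simp]: "weight w (Poly_Mapping.single i n) = n * w i"
  by (simp add: weight_def lookup_single when_def if_distrib[of "\<lambda>x. x * _"] cong: if_cong)

lemma lookup_hpart:
  "Poly_Mapping.lookup (hpart w k p) \<alpha> = (if int (weight w \<alpha>) = k then Poly_Mapping.lookup p \<alpha> else 0)"
  by (auto simp: hpart_def lookup_sum_single in_keys_iff)

lemma hpart_add: "hpart w k (p + q) = hpart w k p + hpart w k q"
  by (rule poly_mapping_eqI) (simp add: lookup_hpart lookup_add)

lemma hpart_zero [simp]: "hpart w k 0 = 0"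
  by (rule poly_mapping_eqI) (simp add: lookup_hpart)

lemma hpart_uminus: "hpart w k (- p) = - hpart w k p"
  by (rule poly_mapping_eqI) (simp add: lookup_hpart)

lemma hpart_diff: "hpart w k (p - q) = hpart w k p - hpart w k q"
  by (rule poly_mapping_eqI) (simp add: lookup_hpart lookup_minus)

lemma hpart_sum: "hpart w k (\<Sum>x\<in>A. p x) = (\<Sum>x\<in>A. hpart w k (p x))"
  by (induction A rule: infinite_finite_induct) (simp_all add: hpart_add)

lemma hpart_single: "hpart w k (Poly_Mapping.single \<alpha> c) = (if int (weight w \<alpha>) = k then Poly_Mapping.single \<alpha> c else 0)"
  by (rule poly_mapping_eqI) (auto simp: lookup_hpart lookup_single when_def)

lemma whomog_iff: "whomog w k p \<longleftrightarrow> hpart w k p = p"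
  unfolding whomog_def poly_mapping_eq_iff fun_eq_iff lookup_hpart by (auto simp: in_keys_iff)

lemma whomog_hpart [simp]: "whomog w k (hpart w k p)"
  by (auto simp: whomog_def in_keys_iff lookup_hpart split: if_splits)

lemma hpart_whomog: "whomog w k p \<Longrightarrow> hpart w k p = p"
  by (simp add: whomog_iff)

lemma hpart_whomog_other: "whomog w k p \<Longrightarrow> k \<noteq> k' \<Longrightarrow> hpart w k' p = 0"
  unfolding whomog_def poly_mapping_eq_iff fun_eq_iff lookup_hpart by (auto simp: in_keys_iff)

lemma whomog_zero [simp]: "whomog w k 0" by (simp add: whomog_iff)
lemma whomog_add: "whomog w k p \<Longrightarrow> whomog w k q \<Longrightarrow> whomog w k (p + q)" by (simp add: whomog_iff hpart_add)
lemma whomog_uminus: "whomog w k p \<Longrightarrow> whomog w k (- p)" by (simp add: whomog_iff hpart_uminus)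
lemma whomog_sum: "(\<And>x. x \<in> A \<Longrightarrow> whomog w k (p x)) \<Longrightarrow> whomog w k (\<Sum>x\<in>A. p x)" by (simp add: whomog_iff hpart_sum)

lemma whomog_negative: "whomog w k p \<Longrightarrow> k < 0 \<Longrightarrow> p = 0"
  unfolding whomog_def poly_mapping_eq_iff fun_eq_iff by (force simp: in_keys_iff)

lemma hpart_eq_0_negative [simp]: "k < 0 \<Longrightarrow> hpart w k p = 0"
  using whomog_negative whomog_hpart by blast

lemma whomog_single: "int (weight w \<alpha>) = k \<Longrightarrow> whomog w k (Poly_Mapping.single \<alpha> c)"
  by (simp add: whomog_iff hpart_single)

lemma whomog_cst [simp]: "whomog w 0 (cst c)" by (simp add: whomog_single)
lemma whomog_var [simp]: "whomog w (int (w i)) (var i)" by (simp add: var_def whomog_single)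

text \<open>Both factors reduce to monomials by linearity. The lemma turns an equation between
  combinations of homogeneous generators into one for each weight, with homogeneous
  coefficients.\<close>

lemma hpart_mult:
  assumes "whomog w e g"
  shows "hpart w k (g * p) = g * hpart w (k - e) p"
proof -
  have *: "hpart w k (Poly_Mapping.single \<alpha> c * p) = Poly_Mapping.single \<alpha> c * hpart w (k - e) p"
    if "int (weight w \<alpha>) = e" for \<alpha> c
  proof (induction p rule: cmpoly_induct)
    case (single \<beta> b)
    show ?case using that by (auto simp: mult_single hpart_single weight_add)
  next
    case (add p q)
    then show ?case by (simp add: distrib_left hpart_add)
  qed
  have "hpart w k (g * p) = hpart w k ((\<Sum>\<alpha>\<in>Poly_Mapping.keys g. Poly_Mapping.single \<alpha> (Poly_Mapping.lookup g \<alpha>)) * p)"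
    by (simp add: cmpoly_sum_single)
  also have "\<dots> = (\<Sum>\<alpha>\<in>Poly_Mapping.keys g. Poly_Mapping.single \<alpha> (Poly_Mapping.lookup g \<alpha>)) * hpart w (k - e) p"
    using assms by (simp add: sum_distrib_right hpart_sum whomog_def *)
  finally show ?thesis by (simp add: cmpoly_sum_single)
qed

lemma whomog_mult: "whomog w k p \<Longrightarrow> whomog w l q \<Longrightarrow> whomog w (k + l) (p * q)"
  by (simp add: whomog_iff[of _ "k + l"] hpart_mult[of w k p] hpart_whomog)

lemma sum_hpart:
  assumes "finite K" "\<And>\<alpha>. \<alpha> \<in> Poly_Mapping.keys p \<Longrightarrow> int (weight w \<alpha>) \<in> K"
  shows "(\<Sum>k\<in>K. hpart w k p) = p"
  by (rule poly_mapping_eqI) (use assms in \<open>auto simp: lookup_sum lookup_hpart in_keys_iff\<close>)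

lemma hpart_eventually_0: "\<exists>N. \<forall>k\<ge>int N. hpart w k p = 0"
proof -
  obtain N where N: "\<And>\<alpha>. \<alpha> \<in> Poly_Mapping.keys p \<Longrightarrow> weight w \<alpha> < N"
    using finite_nat_set_iff_bounded[of "weight w ` Poly_Mapping.keys p"] by auto
  have "hpart w k p = 0" if k: "k \<ge> int N" for k
  proof (rule poly_mapping_eqI)
    fix \<alpha> show "Poly_Mapping.lookup (hpart w k p) \<alpha> = Poly_Mapping.lookup 0 \<alpha>"
      using N[of \<alpha>] k by (cases "\<alpha> \<in> Poly_Mapping.keys p") (auto simp: lookup_hpart in_keys_iff)
  qed
  then show ?thesis by blast
qed

lemma gideal_hpart:
  assumes "\<And>i. i \<in> I \<Longrightarrow> whomog w (e i) (g i)" "p \<in> gideal g I"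
  shows "hpart w k p \<in> gideal g I"
proof -
  obtain u where u: "p = (\<Sum>i\<in>I. u i * g i)" using assms(2) by (auto simp: gideal_def)
  have "hpart w k p = (\<Sum>i\<in>I. hpart w k (g i * u i))" by (simp add: u hpart_sum mult.commute)
  also have "\<dots> = (\<Sum>i\<in>I. hpart w (k - e i) (u i) * g i)"
    by (intro sum.cong refl) (use assms(1) in \<open>simp add: hpart_mult mult.commute\<close>)
  finally show ?thesis by (auto simp: gideal_def)
qed

lemma eval_poly_mult: "eval_poly (p * q) x = eval_poly p x * eval_poly q x"
proof (induction p rule: cmpoly_induct)
  case (single \<alpha> c)
  show ?case
    by (induction q rule: cmpoly_induct)
       (simp_all add: mult_single eval_poly_single eval_monom_add eval_poly_add distrib_left)
qed (simp add: distrib_right eval_poly_add)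

lemma eval_monom_zero [simp]: "eval_monom 0 x = 1"
  by (simp add: eval_monom_def)

lemma eval_poly_cst [simp]: "eval_poly (cst c) x = c"
  by (simp add: eval_poly_single)

lemma eval_poly_one [simp]: "eval_poly 1 x = 1"
  using eval_poly_cst[of 1 x] by simp

lemma eval_poly_var [simp]: "eval_poly (var i) x = x $ i"
  by (simp add: eval_poly_single var_def eval_monom_def lookup_single when_def if_distrib[of "\<lambda>n. _ ^ n"] cong: if_cong)

lemma eval_poly_uminus [simp]: "eval_poly (- p) x = - eval_poly p x"
  using eval_poly_add[of p "- p" x] by (simp add: eq_neg_iff_add_eq_0 add.commute)

lemma eval_poly_diff: "eval_poly (p - q) x = eval_poly p x - eval_poly q x"
  using eval_poly_add[of p "- q" x] by simp

lemma var_power: "var i ^ n = Poly_Mapping.single (Poly_Mapping.single i n) 1"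
  by (induction n) (simp_all add: var_def mult_single flip: single_add)

lemma prod_single: "(\<Prod>i\<in>A. Poly_Mapping.single (a i) (1::complex)) = Poly_Mapping.single (\<Sum>i\<in>A. a i) 1"
  by (induction A rule: infinite_finite_induct) (simp_all add: mult_single)

lemma expo_sum_single: "(\<Sum>i\<in>UNIV. Poly_Mapping.single i (Poly_Mapping.lookup \<alpha> i)) = (\<alpha> :: 'n::finite expo)"
  by (rule poly_mapping_eqI) (simp add: lookup_sum lookup_single when_def)

lemma single_eq_prod_var:
  "Poly_Mapping.single \<alpha> c = cst c * (\<Prod>i\<in>UNIV. var i ^ Poly_Mapping.lookup \<alpha> i)"
  by (simp add: var_power prod_single expo_sum_single mult_single)

lemma cmpoly_ring_induct [case_names cst var add mult]:
  assumes "\<And>c. P (cst c)" "\<And>i. P (var i)" "\<And>p q. P p \<Longrightarrow> P q \<Longrightarrow> P (p + q)" "\<And>p q. P p \<Longrightarrow> P q \<Longrightarrow> P (p * q)"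
  shows "P (p :: 'n::finite cmpoly)"
proof -
  have one: "P 1" using assms(1)[of 1] by simp
  have pow: "P (var i ^ n)" for i n by (induction n) (auto intro: one assms)
  have "P (\<Prod>i\<in>A. var i ^ n i)" for A n
    by (induction A rule: infinite_finite_induct) (auto intro: one pow assms)
  then have "P (Poly_Mapping.single \<alpha> c)" for \<alpha> c
    unfolding single_eq_prod_var[of \<alpha> c] by (intro assms(1,4))
  then show ?thesis by (induction p rule: cmpoly_induct) (auto intro: assms(3))
qed

section \<open>Common zeros of proper ideals\<close>

definition is_ideal :: "'a::comm_ring_1 set \<Rightarrow> bool" where
  "is_ideal J \<longleftrightarrow> 0 \<in> J \<and> (\<forall>p\<in>J. \<forall>q\<in>J. p + q \<in> J) \<and> (\<forall>p\<in>J. \<forall>q. q * p \<in> J)"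

lemma is_idealD:
  assumes "is_ideal J"
  shows "0 \<in> J" "p \<in> J \<Longrightarrow> q \<in> J \<Longrightarrow> p + q \<in> J" "p \<in> J \<Longrightarrow> q * p \<in> J" "p \<in> J \<Longrightarrow> p * q \<in> J"
    "p \<in> J \<Longrightarrow> - p \<in> J" "p \<in> J \<Longrightarrow> q \<in> J \<Longrightarrow> p - q \<in> J"
proof -
  show *: "0 \<in> J" "p \<in> J \<Longrightarrow> q \<in> J \<Longrightarrow> p + q \<in> J" "p \<in> J \<Longrightarrow> q * p \<in> J" for p q
    using assms by (auto simp: is_ideal_def)
  show "p \<in> J \<Longrightarrow> p * q \<in> J" using *(3)[of p q] by (simp add: mult.commute)
  show **: "p \<in> J \<Longrightarrow> - p \<in> J" for p using *(3)[of p "-1"] by simp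
  show "p \<in> J \<Longrightarrow> q \<in> J \<Longrightarrow> p - q \<in> J" using *(2)[of p "- q"] **[of q] by simp
qed

lemma is_ideal_sum: "is_ideal J \<Longrightarrow> (\<And>x. x \<in> A \<Longrightarrow> p x \<in> J) \<Longrightarrow> (\<Sum>x\<in>A. p x) \<in> J"
  by (induction A rule: infinite_finite_induct) (auto intro: is_idealD)

lemma is_ideal_gideal: "is_ideal (gideal g I)"
  by (auto simp: is_ideal_def intro: gideal_add gideal_mult)

definition adjoin :: "'a::comm_ring_1 set \<Rightarrow> 'a \<Rightarrow> 'a set" where
  "adjoin J g = {p + u * g | p u. p \<in> J}"

lemma is_ideal_adjoin:
  assumes "is_ideal J"
  shows "is_ideal (adjoin J g)"
  unfolding is_ideal_def
proof (intro conjI ballI allI)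
  show "0 \<in> adjoin J g" unfolding adjoin_def
    by (rule CollectI, intro exI[of _ 0]) (simp add: is_idealD(1)[OF assms])
next
  fix p q assume "p \<in> adjoin J g" "q \<in> adjoin J g"
  then obtain p' u q' v where *: "p = p' + u * g" "q = q' + v * g" "p' \<in> J" "q' \<in> J" by (auto simp: adjoin_def)
  have "p + q = (p' + q') + (u + v) * g" by (simp add: * algebra_simps)
  moreover have "p' + q' \<in> J" using * is_idealD[OF assms] by blast
  ultimately show "p + q \<in> adjoin J g" unfolding adjoin_def by blast
next
  fix p q assume "p \<in> adjoin J g"
  then obtain p' u where *: "p = p' + u * g" "p' \<in> J" by (auto simp: adjoin_def)
  have "q * p = q * p' + (q * u) * g" by (simp add: * algebra_simps)
  moreover have "q * p' \<in> J" using * is_idealD[OF assms] by blast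
  ultimately show "q * p \<in> adjoin J g" unfolding adjoin_def by blast
qed

lemma adjoin_superset: "J \<subseteq> adjoin J g"
  unfolding adjoin_def by (clarify, rename_tac p, rule_tac x = p in exI, rule_tac x = 0 in exI) simp

lemma adjoin_generator: "is_ideal J \<Longrightarrow> g \<in> adjoin J g"
  unfolding adjoin_def
  by (rule CollectI, rule exI[of _ 0], rule exI[of _ 1]) (simp add: is_idealD)

lemma one_in_adjoinD:
  assumes "is_ideal J" "1 \<in> adjoin J g"
  obtains u where "u * g - 1 \<in> J"
proof -
  obtain p u where "1 = p + u * g" "p \<in> J" using assms by (auto simp: adjoin_def)
  then have "u * g - 1 = - p" by (simp add: algebra_simps)
  then show ?thesis using that[of u] \<open>p \<in> J\<close> is_idealD[OF assms(1)] by metis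
qed

section \<open>Substitution into univariate polynomials\<close>

definition poly_at :: "'n::finite cmpoly \<Rightarrow> complex poly \<Rightarrow> 'n cmpoly" where
  "poly_at X p = poly (map_poly cst p) X"

lemma poly_at_pCons [simp]: "poly_at X (pCons c p) = cst c + X * poly_at X p"
  by (simp add: poly_at_def map_poly_pCons)

lemma poly_at_0 [simp]: "poly_at X 0 = 0"
  by (simp add: poly_at_def)

lemma poly_at_add: "poly_at X (p + q) = poly_at X p + poly_at X q"
  by (induction p q rule: poly_induct2) (simp_all add: single_add algebra_simps)

lemma poly_at_smult: "poly_at X (Polynomial.smult c p) = cst c * poly_at X p"
  by (induction p) (simp_all add: mult_single algebra_simps)

lemma poly_at_mult: "poly_at X (p * q) = poly_at X p * poly_at X q"
  by (induction p) (simp_all add: poly_at_add poly_at_smult algebra_simps)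

lemma poly_at_sum: "poly_at X (\<Sum>a\<in>A. p a) = (\<Sum>a\<in>A. poly_at X (p a))"
  by (induction A rule: infinite_finite_induct) (simp_all add: poly_at_add)

lemma unit_mod_ideal_mult:
  assumes "is_ideal J" "u * p - 1 \<in> J" "v * q - 1 \<in> J"
  shows "(u * v) * (p * q) - 1 \<in> J"
proof -
  have "(u * v) * (p * q) - 1 = (u * p) * (v * q - 1) + (u * p - 1)" by (simp add: algebra_simps)
  then show ?thesis using assms is_idealD[OF assms(1)] by metis
qed

text \<open>The fundamental theorem of algebra splits \<open>p\<close> into linear factors; each is
  invertible modulo \<open>J\<close> after substitution, and the inverses multiply.\<close>

lemma poly_at_unit_mod_ideal:
  assumes J: "is_ideal J" and lin: "\<And>a. \<exists>u. u * (X - cst a) - 1 \<in> J" and "p \<noteq> 0"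
  shows "\<exists>u. u * poly_at X p - 1 \<in> J"
  using assms(3)
proof (induction "degree p" arbitrary: p rule: less_induct)
  case less
  show ?case
  proof (cases "degree p = 0")
    case True
    then obtain c where c: "p = [:c:]" by (metis degree_eq_zeroE)
    then have "cst (1 / c) * poly_at X p - 1 = 0" using less.prems by (simp add: mult_single)
    then show ?thesis using is_idealD(1)[OF J] by metis
  next
    case False
    then obtain z where "poly p z = 0"
      using fundamental_theorem_of_algebra[of p] constant_degree[of p] by auto
    then obtain q where q: "p = [:- z, 1:] * q" by (metis dvdE poly_eq_0_iff_dvd)
    then have "q \<noteq> 0" using less.prems by auto
    then have "degree p = Suc (degree q)" unfolding q by (subst degree_mult_eq) auto
    then obtain u where u: "u * poly_at X q - 1 \<in> J" using less.hyps[of q] \<open>q \<noteq> 0\<close> by auto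
    obtain v where v: "v * (X - cst z) - 1 \<in> J" using lin by blast
    have "poly_at X p = (X - cst z) * poly_at X q"
      unfolding q poly_at_mult by (simp add: single_uminus)
    then show ?thesis using unit_mod_ideal_mult[OF J v u] by metis
  qed
qed

definition cscale :: "complex \<Rightarrow> 'n::finite cmpoly \<Rightarrow> 'n cmpoly" where
  "cscale c p = cst c * p"

interpretation cpoly: vector_space cscale
proof
  fix a b and x y :: "'n::finite cmpoly"
  show "cscale a (x + y) = cscale a x + cscale a y" by (simp only: cscale_def distrib_left)
  show "cscale (a + b) x = cscale a x + cscale b x" by (simp only: cscale_def single_add distrib_right)
  show "cscale a (cscale b x) = cscale (a * b) x"
    unfolding cscale_def mult.assoc[symmetric] mult_single by simp
  show "cscale 1 x = x" by (simp add: cscale_def)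
qed

lemma finite_expo_bounded: "finite {\<alpha> :: 'n::finite expo. \<forall>i. Poly_Mapping.lookup \<alpha> i \<le> N}"
proof -
  have "finite (PiE UNIV (\<lambda>i::'n. {..N}))" by (rule finite_PiE) simp_all
  moreover have "Poly_Mapping.lookup ` {\<alpha> :: 'n expo. \<forall>i. Poly_Mapping.lookup \<alpha> i \<le> N} \<subseteq> PiE UNIV (\<lambda>i. {..N})" by auto
  ultimately show ?thesis
    by (meson finite_subset finite_imageD inj_on_subset subset_UNIV inj_onI lookup_inject)
qed

lemma in_span_monomials:
  assumes "Poly_Mapping.keys p \<subseteq> E"
  shows "p \<in> cpoly.span ((\<lambda>\<alpha>. Poly_Mapping.single \<alpha> 1) ` E)"
proof -
  have "(\<Sum>\<alpha>\<in>Poly_Mapping.keys p. cscale (Poly_Mapping.lookup p \<alpha>) (Poly_Mapping.single \<alpha> 1)) \<in> cpoly.span ((\<lambda>\<alpha>. Poly_Mapping.single \<alpha> 1) ` E)"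
    using assms by (intro cpoly.span_sum cpoly.span_scale cpoly.span_base) auto
  then show ?thesis by (simp add: cscale_def mult_single cmpoly_sum_single)
qed

text \<open>Otherwise the inverses of \<open>X - a\<close> modulo \<open>J\<close> would be uncountably many linearly independent
  elements (clear denominators and factor over the complex numbers), but the polynomial ring has
  countable dimension.\<close>

lemma proper_adjoin_linear:
  fixes J :: "'n::finite cmpoly set"
  assumes J: "is_ideal J" "1 \<notin> J"
  shows "\<exists>a. 1 \<notin> adjoin J (X - cst a)"
proof (rule ccontr)
  assume "\<not> (\<exists>a. 1 \<notin> adjoin J (X - cst a))"
  then have ex: "\<exists>u. u * (X - cst a) - 1 \<in> J" for a using one_in_adjoinD[OF J(1), of "X - cst a"] by blast
  define u where "u a = (SOME u. u * (X - cst a) - 1 \<in> J)" for a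
  have u: "u a * (X - cst a) - 1 \<in> J" for a unfolding u_def by (rule someI_ex[OF ex])
  define E where "E N = {\<alpha> :: 'n expo. \<forall>i. Poly_Mapping.lookup \<alpha> i \<le> N}" for N
  \<comment> \<open>Countably many sets \<open>A N\<close> cover the uncountable set of complex
    numbers, so one of them is infinite, while the inverses that belong to it lie in the
    finite-dimensional span of the monomials from \<open>E N\<close>.\<close>
  define A where "A N = {a. Poly_Mapping.keys (u a) \<subseteq> E N}" for N
  have "\<exists>N. a \<in> A N" for a
  proof -
    let ?N = "\<Sum>\<alpha>\<in>Poly_Mapping.keys (u a). \<Sum>i\<in>UNIV. Poly_Mapping.lookup \<alpha> i"
    have "Poly_Mapping.lookup \<alpha> i \<le> ?N" if "\<alpha> \<in> Poly_Mapping.keys (u a)" for \<alpha> i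
    proof -
      have "Poly_Mapping.lookup \<alpha> i \<le> (\<Sum>i\<in>UNIV. Poly_Mapping.lookup \<alpha> i)" by (rule member_le_sum) auto
      also have "\<dots> \<le> ?N" using that by (intro member_le_sum) auto
      finally show ?thesis .
    qed
    then show ?thesis by (auto simp: A_def E_def)
  qed
  then have "(\<Union>N. A N) = UNIV" by blast
  then have "uncountable (\<Union>N. A N)" using uncountable_UNIV_complex by simp
  then have "\<exists>N. infinite (A N)"
    using countable_UN[of "UNIV :: nat set" A] by (auto intro: countable_finite)
  then obtain N where N: "infinite (A N)" by blast
  \<comment> \<open>\<open>u a = u b\<close> with \<open>a \<noteq> b\<close> would put a nonzero
    multiple of \<open>u a\<close>, hence \<open>u a\<close>, hence 1 into \<open>J\<close>.\<close>
  have inj: "inj u"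
  proof (rule injI, rule ccontr)
    fix a b assume ab: "u a = u b" "a \<noteq> b"
    have "(u b * (X - cst b) - 1) - (u a * (X - cst a) - 1) = u a * cst (a - b)"
      by (simp add: ab(1) single_diff algebra_simps)
    then have "u a * cst (a - b) \<in> J" using u is_idealD(6)[OF J(1)] by metis
    then have "u a * cst (a - b) * cst (1 / (a - b)) \<in> J" by (rule is_idealD[OF J(1)])
    then have "u a \<in> J" using ab by (simp add: mult.assoc mult_single)
    then have "u a * (X - cst a) - (u a * (X - cst a) - 1) \<in> J"
      by (intro is_idealD(4,6) J(1) u)
    then show False using J by simp
  qed
  have "cpoly.dependent (u ` A N)"
  proof (rule ccontr)
    assume ind: "cpoly.independent (u ` A N)"
    have "u ` A N \<subseteq> cpoly.span ((\<lambda>\<alpha>. Poly_Mapping.single \<alpha> 1) ` E N)"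
      using in_span_monomials by (auto simp: A_def)
    moreover have "finite ((\<lambda>\<alpha>. Poly_Mapping.single \<alpha> (1::complex)) ` E N)"
      unfolding E_def using finite_expo_bounded by blast
    ultimately have "finite (u ` A N)" using cpoly.independent_span_bound ind by blast
    then show False using N inj finite_imageD inj_on_subset by blast
  qed
  then obtain S c v where S: "finite S" "S \<subseteq> u ` A N" "(\<Sum>v\<in>S. cscale (c v) v) = 0" "v \<in> S" "c v \<noteq> 0"
    unfolding cpoly.dependent_explicit by blast
  define B where "B = u -` S"
  have B: "finite B" "S = u ` B" using S(1,2) inj by (auto simp: B_def finite_vimageI)
  obtain a0 where a0: "a0 \<in> B" "v = u a0" using S(4) B by auto
  \<comment> \<open>The numerator of the relation \<open>\<Sum> c_a / (X - a)\<close> over the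
    common denominator. At \<open>a0\<close> only the summand of \<open>a0\<close> survives, so
    \<open>P \<noteq> 0\<close>.\<close>
  define P where "P = (\<Sum>a\<in>B. Polynomial.smult (c (u a)) (\<Prod>b\<in>B-{a}. [:-b, 1:]))"
  have "poly P a0 = (\<Sum>a\<in>B. c (u a) * (\<Prod>b\<in>B-{a}. a0 - b))"
    by (simp add: P_def poly_sum poly_prod)
  also have "\<dots> = (\<Sum>a\<in>{a0}. c (u a) * (\<Prod>b\<in>B-{a}. a0 - b))"
    using B a0 by (intro sum.mono_neutral_right) auto
  also have "\<dots> \<noteq> 0" using S(5) a0 B by auto
  finally have "P \<noteq> 0" by auto
  then obtain y where y: "y * poly_at X P - 1 \<in> J" using poly_at_unit_mod_ideal[OF J(1) ex] by blast
  define Q where "Q = poly_at X (\<Prod>b\<in>B. [:-b, 1:])"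
  \<comment> \<open>Modulo \<open>J\<close>, \<open>Q * u a\<close> is the product of the other
    linear factors, so multiplying the linear relation by \<open>Q\<close> yields
    \<open>poly_at X P\<close>.\<close>
  have "poly_at X P - Q * (\<Sum>v\<in>S. cscale (c v) v) \<in> J"
  proof -
    have e1: "(\<Sum>v\<in>S. cscale (c v) v) = (\<Sum>a\<in>B. cst (c (u a)) * u a)"
      unfolding B(2) using inj_on_subset[OF inj subset_UNIV, of B]
      by (subst sum.reindex) (simp_all add: cscale_def)
    have e2: "poly_at X P = (\<Sum>a\<in>B. cst (c (u a)) * poly_at X (\<Prod>b\<in>B-{a}. [:-b, 1:]))"
      by (simp add: P_def poly_at_sum poly_at_smult)
    have "cst (c (u a)) * poly_at X (\<Prod>b\<in>B-{a}. [:-b, 1:]) - Q * (cst (c (u a)) * u a) \<in> J"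
      (is "?C * ?R - _ \<in> J") if "a \<in> B" for a
    proof -
      have Q: "Q = (X - cst a) * ?R"
        unfolding Q_def prod.remove[OF B(1) that] by (simp only: poly_at_mult) (simp add: single_uminus)
      have "?C * ?R - Q * (?C * u a) = (- ?C * ?R) * (u a * (X - cst a) - 1)"
        unfolding Q by (simp add: algebra_simps)
      then show ?thesis using is_idealD(3)[OF J(1) u[of a], of "- ?C * ?R"] by simp
    qed
    then have "(\<Sum>a\<in>B. cst (c (u a)) * poly_at X (\<Prod>b\<in>B-{a}. [:-b, 1:]) - Q * (cst (c (u a)) * u a)) \<in> J"
      by (rule is_ideal_sum[OF J(1)])
    then show ?thesis unfolding e1 e2 sum_distrib_left sum_subtractf .
  qed
  then have "poly_at X P \<in> J" using S(3) by simp
  then have "y * poly_at X P - (y * poly_at X P - 1) \<in> J" by (intro is_idealD(3,6) J(1) y)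
  then show False using J by simp
qed

text \<open>Applying \<open>proper_adjoin_linear\<close> to one variable after another gives a
  proper ideal \<open>J'\<close> that contains \<open>J\<close> and all
  \<open>var i - cst (a i)\<close>. Modulo \<open>J'\<close> a polynomial equals its value at
  \<open>a\<close>, so an element of \<open>J\<close> with nonzero value would make
  \<open>J'\<close> improper.\<close>

lemma weak_nullstellensatz:
  fixes J :: "'n::finite cmpoly set"
  assumes J: "is_ideal J" "1 \<notin> J"
  shows "\<exists>x. \<forall>p\<in>J. eval_poly p x = 0"
proof -
  have "\<exists>a J'. is_ideal J' \<and> 1 \<notin> J' \<and> J \<subseteq> J' \<and> (\<forall>i\<in>I. var i - cst (a i) \<in> J')" if "finite I" for I :: "'n set"
    using that
  proof (induction I)
    case empty
    show ?case using J by auto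
  next
    case (insert i I)
    then obtain a J' where IH: "is_ideal J'" "1 \<notin> J'" "J \<subseteq> J'" "\<forall>i\<in>I. var i - cst (a i) \<in> J'" by auto
    obtain b where b: "1 \<notin> adjoin J' (var i - cst b)" using proper_adjoin_linear[OF IH(1,2)] by blast
    have "J' \<subseteq> adjoin J' (var i - cst b)" by (rule adjoin_superset)
    then show ?case using IH b insert.hyps is_ideal_adjoin[OF IH(1)] adjoin_generator[OF IH(1)]
      by (intro exI[of _ "a(i := b)"] exI[of _ "adjoin J' (var i - cst b)"]) auto
  qed
  from this[of UNIV] obtain a :: "'n \<Rightarrow> complex" and J' where
    J': "is_ideal J'" "1 \<notin> J'" "J \<subseteq> J'" "\<And>i. var i - cst (a i) \<in> J'" by auto
  define x where "x = (\<chi> i. a i)"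
  have *: "p - cst (eval_poly p x) \<in> J'" for p
  proof (induction p rule: cmpoly_ring_induct)
    case (cst c) then show ?case using is_idealD(1)[OF J'(1)] by simp
  next
    case (var i) then show ?case using J'(4)[of i] by (simp add: x_def)
  next
    case (add p q)
    have "p + q - cst (eval_poly (p + q) x) = (p - cst (eval_poly p x)) + (q - cst (eval_poly q x))"
      by (simp add: eval_poly_add single_add algebra_simps)
    then show ?case using add is_idealD(2)[OF J'(1)] by metis
  next
    case (mult p q)
    have "p * q - cst (eval_poly (p * q) x) = p * (q - cst (eval_poly q x)) + cst (eval_poly q x) * (p - cst (eval_poly p x))"
      by (simp add: eval_poly_mult algebra_simps mult_single)
    also have "\<dots> \<in> J'" by (intro is_idealD(2,3) J'(1) mult)
    finally show ?case .
  qed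
  have "eval_poly p x = 0" if "p \<in> J" for p
  proof (rule ccontr)
    assume nz: "eval_poly p x \<noteq> 0"
    have "p - (p - cst (eval_poly p x)) \<in> J'" using * that J' is_idealD(6)[OF J'(1)] by blast
    then have "cst (1 / eval_poly p x) * (p - (p - cst (eval_poly p x))) \<in> J'" by (rule is_idealD[OF J'(1)])
    then show False using nz J'(2) by (simp add: mult_single)
  qed
  then show ?thesis by blast
qed

text \<open>Plays the role of the Rabinowitsch trick: an inverse of \<open>var i - 1\<close> modulo a homogeneous ideal has
  the powers of \<open>var i\<close> as components, and almost all components vanish.\<close>

lemma graded_ideal_var_nilpotent:
  assumes J: "is_ideal J" "\<And>k p. p \<in> J \<Longrightarrow> hpart w k p \<in> J" and w: "w i > 0"
    and "1 \<in> adjoin J (var i - 1)"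
  shows "\<exists>N. var i ^ N \<in> J"
proof -
  obtain h where h: "h * (var i - 1) - 1 \<in> J" using one_in_adjoinD[OF J(1) assms(4)] .
  have part: "var i * hpart w (k - int (w i)) h - hpart w k h - hpart w k 1 \<in> J" for k
  proof -
    have "hpart w k (h * (var i - 1) - 1) = var i * hpart w (k - int (w i)) h - hpart w k h - hpart w k 1"
      using hpart_mult[OF whomog_var[of w i], of k h] by (simp add: hpart_diff right_diff_distrib mult.commute)
    then show ?thesis using J(2)[OF h] by metis
  qed
  have one: "hpart w k 1 = (if k = 0 then 1 else 0)" for k
    using hpart_single[of w k 0 1] by auto
  \<comment> \<open>Formally \<open>h = - 1 / (1 - x_i)\<close>, whose component of weight
    \<open>n * w i\<close> is \<open>- x_i ^ n\<close>; the recursion \<open>part\<close> makes this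
    precise modulo \<open>J\<close>.\<close>
  have *: "var i ^ n + hpart w (int (n * w i)) h \<in> J" for n
  proof (induction n)
    case 0
    have "- hpart w 0 h - 1 \<in> J" using part[of 0] w one[of 0] by simp
    from is_idealD(5)[OF J(1) this] show ?case by (simp add: add.commute)
  next
    case (Suc n)
    let ?k = "int (Suc n * w i)"
    have k: "?k - int (w i) = int (n * w i)" by simp
    have k0: "?k \<noteq> 0" using w by (simp only: of_nat_eq_0_iff mult_eq_0_iff) simp
    have 1: "var i * hpart w (int (n * w i)) h - hpart w ?k h \<in> J"
      using part[of ?k] one[of ?k] unfolding k using k0 by simp
    have "var i ^ Suc n + hpart w ?k h = var i * (var i ^ n + hpart w (int (n * w i)) h)
        - (var i * hpart w (int (n * w i)) h - hpart w ?k h)"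
      by (simp add: algebra_simps)
    then show ?case using is_idealD(6)[OF J(1) is_idealD(3)[OF J(1) Suc] 1] by metis
  qed
  obtain N where N: "\<And>k. k \<ge> int N \<Longrightarrow> hpart w k h = 0" using hpart_eventually_0[of w h] by blast
  have "1 \<le> w i" using w by simp
  then have "N * 1 \<le> N * w i" by (rule mult_le_mono2)
  then have "hpart w (int (N * w i)) h = 0" by (intro N) (simp only: of_nat_le_iff mult_1_right)
  then show ?thesis using *[of N] by auto
qed

text \<open>The action \<open>x_j \<mapsto> t ^ w_j x_j\<close> multiplies the values of
  \<open>p\<close> by a power of \<open>t\<close>.\<close>

lemma eval_poly_scaled_zero:
  assumes "whomog w e p" "eval_poly p x = 0"
  shows "eval_poly p (\<chi> j. t ^ w j * x $ j) = 0"
proof -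
  have "eval_monom \<alpha> (\<chi> j. t ^ w j * x $ j) = t ^ nat e * eval_monom \<alpha> x" if "\<alpha> \<in> Poly_Mapping.keys p" for \<alpha>
  proof -
    have "eval_monom \<alpha> (\<chi> j. t ^ w j * x $ j) = t ^ weight w \<alpha> * eval_monom \<alpha> x"
      by (simp add: eval_monom_def power_mult_distrib prod.distrib weight_def power_sum mult.commute flip: power_mult)
    then show ?thesis using assms(1) that by (auto simp: whomog_def)
  qed
  then have "eval_poly p (\<chi> j. t ^ w j * x $ j) = t ^ nat e * eval_poly p x"
    unfolding eval_poly_def sum_distrib_left by (intro sum.cong) auto
  then show ?thesis using assms(2) by simp
qed

text \<open>By \<open>graded_ideal_var_nilpotent\<close> it is enough that the \<open>g l\<close>
  and \<open>var i - 1\<close> generate the unit ideal. Otherwise they have a common zero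
  \<open>x\<close> with \<open>x $ i = 1\<close>, and its orbit under the scaling action consists of
  zeros of the \<open>g l\<close> that tend to the origin as \<open>t\<close> tends to 0 but differ
  from it for \<open>t \<noteq> 0\<close>.\<close>

lemma isolated_zero_nilpotent:
  fixes g :: "'n::finite \<Rightarrow> 'n cmpoly"
  assumes w: "\<And>i. w i > 0" and g: "\<And>l. whomog w (e l) (g l)"
    and U: "open U" "0 \<in> U" "\<And>x. x \<in> U \<Longrightarrow> (\<And>l. eval_poly (g l) x = 0) \<Longrightarrow> x = 0"
  shows "\<exists>N. var i ^ N \<in> gideal g UNIV"
proof (rule graded_ideal_var_nilpotent[where w = w])
  let ?J = "gideal g UNIV"
  show J: "is_ideal ?J" by (rule is_ideal_gideal)
  show "hpart w k p \<in> ?J" if "p \<in> ?J" for k p using gideal_hpart[OF _ that] g by blast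
  show "1 \<in> adjoin ?J (var i - 1)"
  proof (rule ccontr)
    assume "1 \<notin> adjoin ?J (var i - 1)"
    then obtain x where x: "\<And>p. p \<in> adjoin ?J (var i - 1) \<Longrightarrow> eval_poly p x = 0"
      using weak_nullstellensatz is_ideal_adjoin[OF J] by blast
    have xi: "x $ i = 1" using x[OF adjoin_generator[OF J]] by (simp add: eval_poly_diff)
    have xg: "eval_poly (g l) x = 0" for l
      by (rule x[OF subsetD[OF adjoin_superset gideal_gen]]) simp_all
    let ?y = "\<lambda>t. (\<chi> j. t ^ w j * x $ j)"
    have "(\<chi> j. 0 ^ w j * x $ j) = 0" using w by (simp add: vec_eq_iff)
    moreover have "(?y \<longlongrightarrow> (\<chi> j. 0 ^ w j * x $ j)) (at 0)"
      by (intro tendsto_vec_lambda tendsto_intros)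
    ultimately have "(?y \<longlongrightarrow> 0) (at 0)" by simp
    then have "\<forall>\<^sub>F t in at 0. ?y t \<in> U" using U(1,2) by (rule topological_tendstoD)
    moreover have "\<forall>\<^sub>F t in at 0. t \<noteq> (0::complex)" by (rule eventually_neq_at_within)
    ultimately have "\<forall>\<^sub>F t in at 0. ?y t \<in> U \<and> t \<noteq> 0" by (rule eventually_conj)
    then have "\<exists>t. ?y t \<in> U \<and> t \<noteq> 0" by (rule eventually_happens'[rotated]) simp
    then obtain t where t: "?y t \<in> U" "t \<noteq> 0" by blast
    have "?y t = 0" by (rule U(3)[OF t(1)]) (rule eval_poly_scaled_zero[OF g xg])
    then have "?y t $ i = 0" by simp
    then show False using t xi by simp
  qed
qed (rule w)

section \<open>Homogeneous Koszul chains and regularity\<close>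

lemma gideal_cong: "(\<And>i. i \<in> I \<Longrightarrow> g i = g' i) \<Longrightarrow> gideal g I = gideal g' I"
  by (simp add: gideal_def)

text \<open>Transports ideals along an enumeration of the variables, from the unordered type that
  indexes the generators to the natural numbers that index Koszul complexes.\<close>

lemma gideal_reindex:
  assumes "inj_on h I"
  shows "gideal g (h ` I) = gideal (\<lambda>i. g (h i)) I"
proof (intro Set.set_eqI iffI)
  fix p assume "p \<in> gideal g (h ` I)"
  then obtain u where "p = (\<Sum>k\<in>h ` I. u k * g k)" by (auto simp: gideal_def)
  then have "p = (\<Sum>k\<in>I. u (h k) * g (h k))" using assms by (simp add: sum.reindex)
  then show "p \<in> gideal (\<lambda>i. g (h i)) I" unfolding gideal_def by (intro CollectI exI)
next
  fix p assume "p \<in> gideal (\<lambda>i. g (h i)) I"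
  then obtain u where "p = (\<Sum>k\<in>I. u k * g (h k))" by (auto simp: gideal_def)
  also have "\<dots> = (\<Sum>k\<in>I. u (the_inv_into I h (h k)) * g (h k))"
    using assms by (intro sum.cong) (simp_all add: the_inv_into_f_f)
  also have "\<dots> = (\<Sum>k\<in>h ` I. u (the_inv_into I h k) * g k)" using assms by (simp add: sum.reindex)
  finally show "p \<in> gideal g (h ` I)" unfolding gideal_def by (intro CollectI exI)
qed

lemma lookup_single_mult:
  "Poly_Mapping.lookup (Poly_Mapping.single \<beta> c * p) (\<beta> + \<alpha>) = c * Poly_Mapping.lookup (p :: 'n::finite cmpoly) \<alpha>"
proof (induction p rule: cmpoly_induct)
  case (single \<gamma> b) then show ?case by (simp add: mult_single lookup_single when_def)
next
  case (add p q) then show ?case by (simp add: distrib_left lookup_add)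
qed

text \<open>Ideals generated by variables are monomial, so membership is decided at each exponent
  separately and the regularity of the variables becomes a matter of exponents.\<close>

lemma var_ideal_iff:
  assumes "finite I"
  shows "p \<in> gideal (\<lambda>i. var (h i)) I \<longleftrightarrow> (\<forall>\<alpha>\<in>Poly_Mapping.keys p. \<exists>i\<in>I. Poly_Mapping.lookup \<alpha> (h i) > 0)"
    (is "_ \<longleftrightarrow> (\<forall>\<alpha>\<in>_. ?Q \<alpha>)")
proof
  assume "p \<in> gideal (\<lambda>i. var (h i)) I"
  then obtain u where p: "p = (\<Sum>i\<in>I. u i * var (h i))" by (auto simp: gideal_def)
  have "\<forall>\<alpha>\<in>Poly_Mapping.keys (\<Sum>i\<in>A. u i * var (h i)). ?Q \<alpha>" if "finite A" "A \<subseteq> I" for A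
    using that
  proof (induction A)
    case (insert i A)
    have "?Q \<alpha>" if \<alpha>: "\<alpha> \<in> Poly_Mapping.keys (u i * var (h i))" for \<alpha>
    proof -
      obtain a b where "\<alpha> = a + b" "b \<in> Poly_Mapping.keys (var (h i) :: 'b cmpoly)"
        using \<alpha> keys_mult[of "u i" "var (h i)"] by blast
      then have "Poly_Mapping.lookup \<alpha> (h i) > 0" by (simp add: var_def lookup_add)
      moreover have "i \<in> I" using insert.prems by simp
      ultimately show ?thesis by blast
    qed
    moreover have "Poly_Mapping.keys (\<Sum>i\<in>insert i A. u i * var (h i)) \<subseteq>
        Poly_Mapping.keys (u i * var (h i)) \<union> Poly_Mapping.keys (\<Sum>i\<in>A. u i * var (h i))"
      unfolding sum.insert[OF insert.hyps] by (rule keys_add)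
    moreover have "\<forall>\<alpha>\<in>Poly_Mapping.keys (\<Sum>i\<in>A. u i * var (h i)). ?Q \<alpha>"
      by (rule insert.IH) (use insert.prems in simp)
    ultimately show ?case by blast
  qed simp
  then show "\<forall>\<alpha>\<in>Poly_Mapping.keys p. ?Q \<alpha>" using p assms by simp
next
  assume Q: "\<forall>\<alpha>\<in>Poly_Mapping.keys p. ?Q \<alpha>"
  have "(\<Sum>\<alpha>\<in>Poly_Mapping.keys p. Poly_Mapping.single \<alpha> (Poly_Mapping.lookup p \<alpha>)) \<in> gideal (\<lambda>i. var (h i)) I"
  proof (rule gideal_sum)
    fix \<alpha> assume "\<alpha> \<in> Poly_Mapping.keys p"
    then obtain i where i: "i \<in> I" "Poly_Mapping.lookup \<alpha> (h i) > 0" using Q by blast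
    have "(\<alpha> - Poly_Mapping.single (h i) 1) + Poly_Mapping.single (h i) 1 = \<alpha>"
      using i(2) by (intro poly_mapping_eqI) (auto simp: lookup_add lookup_minus lookup_single when_def)
    then have "Poly_Mapping.single \<alpha> (Poly_Mapping.lookup p \<alpha>) =
        Poly_Mapping.single (\<alpha> - Poly_Mapping.single (h i) 1) (Poly_Mapping.lookup p \<alpha>) * var (h i)"
      by (simp add: var_def mult_single)
    then show "Poly_Mapping.single \<alpha> (Poly_Mapping.lookup p \<alpha>) \<in> gideal (\<lambda>i. var (h i)) I"
      using gideal_mult[OF gideal_gen[OF assms i(1), of "\<lambda>i. var (h i)"]] by metis
  qed
  then show "p \<in> gideal (\<lambda>i. var (h i)) I" by (simp add: cmpoly_sum_single)
qed

text \<open>As \<open>h\<close> is injective, multiplying by \<open>var (h i)\<close> leaves the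
  exponents of the variables from \<open>J\<close> alone.\<close>

lemma var_regular:
  assumes "finite J" "i \<notin> J" "inj_on h (insert i J)" "var (h i) * p \<in> gideal (\<lambda>i. var (h i)) J"
  shows "p \<in> gideal (\<lambda>i. var (h i)) J"
  unfolding var_ideal_iff[OF assms(1)]
proof
  fix \<alpha> assume \<alpha>: "\<alpha> \<in> Poly_Mapping.keys p"
  let ?e = "Poly_Mapping.single (h i) 1"
  have "?e + \<alpha> \<in> Poly_Mapping.keys (var (h i) * p)"
    using \<alpha> lookup_single_mult[of ?e 1 p \<alpha>] by (simp add: in_keys_iff var_def)
  then obtain k where k: "k \<in> J" "Poly_Mapping.lookup (?e + \<alpha>) (h k) > 0"
    using assms(4) unfolding var_ideal_iff[OF assms(1)] by blast
  moreover have "h i \<noteq> h k" using k(1) assms(2,3) by (auto dest: inj_onD)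
  ultimately show "\<exists>i\<in>J. Poly_Mapping.lookup \<alpha> (h i) > 0"
    by (auto simp: lookup_add lookup_single when_def)
qed

text \<open>The basis vector \<open>e_S\<close> has degree \<open>sum e S\<close>, which makes the
  differential preserve the total degree \<open>k\<close>.\<close>

definition hchain :: "('n::finite \<Rightarrow> nat) \<Rightarrow> (nat \<Rightarrow> int) \<Rightarrow> int \<Rightarrow> (nat set \<Rightarrow> 'n cmpoly) \<Rightarrow> bool" where
  "hchain w e k c \<longleftrightarrow> (\<forall>S. whomog w (k - sum e S) (c S))"

definition hproj :: "('n::finite \<Rightarrow> nat) \<Rightarrow> (nat \<Rightarrow> int) \<Rightarrow> int \<Rightarrow> (nat set \<Rightarrow> 'n cmpoly) \<Rightarrow> nat set \<Rightarrow> 'n cmpoly" where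
  "hproj w e k c S = hpart w (k - sum e S) (c S)"

text \<open>Only homogeneous cycles are tested, because the induction on the degree in
  \<open>hexact_remove\<close> reaches no others. The bounding chain may be inhomogeneous;
  \<open>hproj\<close> repairs this where it matters.\<close>

definition hexact :: "('n::finite \<Rightarrow> nat) \<Rightarrow> (nat \<Rightarrow> int) \<Rightarrow> (nat \<Rightarrow> 'n cmpoly) \<Rightarrow> nat set \<Rightarrow> nat \<Rightarrow> bool" where
  "hexact w e g I j \<longleftrightarrow> (\<forall>k c. koszul_chain I j c \<longrightarrow> hchain w e k c \<longrightarrow> (\<forall>S. koszul_d g I c S = 0) \<longrightarrow>
     (\<exists>b. koszul_chain I (Suc j) b \<and> (\<forall>S. koszul_d g I b S = c S)))"

lemma koszul_exact_imp_hexact: "koszul_exact g I j \<Longrightarrow> hexact w e g I j"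
  unfolding hexact_def using koszul_exactD by blast

lemma hchain_hproj: "hchain w e k (hproj w e k c)"
  by (simp add: hchain_def hproj_def)

lemma koszul_chain_hproj: "koszul_chain I j c \<Longrightarrow> koszul_chain I j (hproj w e k c)"
  unfolding koszul_chain_def hproj_def by (metis hpart_zero)

lemma whomog_koszul_sign: "whomog w 0 (koszul_sign S k)"
proof -
  have "whomog w 0 (1 :: 'a cmpoly)" using whomog_cst[of w 1] by simp
  then show ?thesis
    unfolding koszul_sign_def using whomog_uminus[of w 0 1]
    by (cases "even (card {j\<in>S. k < j})") simp_all
qed

text \<open>The degree of \<open>g i\<close> makes up for the drop of the coefficient degree by
  \<open>e i\<close>, so projection to a total degree is a chain map.\<close>

lemma koszul_d_hproj:
  assumes "finite I" "\<And>i. i \<in> I \<Longrightarrow> whomog w (e i) (g i)" "koszul_chain I j c"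
  shows "koszul_d g I (hproj w e k c) S = hpart w (k - sum e S) (koszul_d g I c S)"
proof (cases "finite S")
  case True
  have "koszul_sign S i * g i * hproj w e k c (insert i S) =
      hpart w (k - sum e S) (koszul_sign S i * g i * c (insert i S))" if "i \<in> I - S" for i
  proof -
    have "whomog w (0 + e i) (koszul_sign S i * g i)"
      using that assms(2) by (intro whomog_mult whomog_koszul_sign) auto
    moreover have "k - sum e (insert i S) = k - sum e S - (0 + e i)" using that True by simp
    ultimately show ?thesis unfolding hproj_def by (metis hpart_mult)
  qed
  then show ?thesis unfolding koszul_d_def hpart_sum by (intro sum.cong) auto
next
  \<comment> \<open>For infinite \<open>S\<close> the default value 0 of \<open>sum e S\<close>
    spoils the degree count, but the chain vanishes at all sets involved.\<close>
  case False
  then have "c (insert i S) = 0" for i using koszul_chain_infinite[OF assms(3,1)] by simp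
  then show ?thesis by (simp add: koszul_d_def hproj_def)
qed

text \<open>Graded Nakayama: a homogeneous cycle is, modulo boundaries, \<open>g i\<close> times a homogeneous cycle of
  smaller degree.\<close>

lemma hexact_remove:
  assumes I: "finite I" "i \<notin> I" and g: "\<And>k. k \<in> insert i I \<Longrightarrow> whomog w (e k) (g k)"
    and e: "e i > 0" "\<And>k. k \<in> I \<Longrightarrow> e k \<ge> 0" and ex: "hexact w e g (insert i I) (Suc j)"
  shows "hexact w e g I (Suc j)"
proof -
  have "\<exists>b. koszul_chain I (Suc (Suc j)) b \<and> (\<forall>S. koszul_d g I b S = c S)"
    if "koszul_chain I (Suc j) c" "hchain w e k c" "\<And>S. koszul_d g I c S = 0" for k c
    using that
  \<comment> \<open>The shift by one keeps the measure decreasing when the degree drops from 0 to a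
    negative value. Negative degrees are the base case, where the chain is 0.\<close>
  proof (induction "nat (k + 1)" arbitrary: k c rule: less_induct)
    case less
    show ?case
    proof (cases "k < 0")
      case True
      have "c S = 0" for S
      proof (rule ccontr)
        assume nz: "c S \<noteq> 0"
        then have "S \<subseteq> I" using less.prems(1) by (auto simp: koszul_chain_def)
        then have "sum e S \<ge> 0" using e(2) by (intro sum_nonneg) auto
        then have "k - sum e S < 0" using True by simp
        moreover have "whomog w (k - sum e S) (c S)" using less.prems(2) by (simp add: hchain_def)
        ultimately show False using nz whomog_negative by blast
      qed
      then show ?thesis by (intro exI[of _ "\<lambda>_. 0"]) simp
    next
      case False
      \<comment> \<open>Without an \<open>e_i\<close> part, \<open>c\<close> is also a cycle of the
        larger complex. A chain \<open>(a, b)\<close> that it bounds gives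
        \<open>c = d a + g_i b\<close> with \<open>d b = 0\<close>.\<close>
      let ?c = "koszul_cone i c (\<lambda>_. 0)"
      have c: "koszul_chain (insert i I) (Suc j) ?c"
        by (rule koszul_chain_cone[OF I less.prems(1)]) simp
      have hc: "hchain w e k ?c"
        using less.prems(2) by (simp add: hchain_def koszul_cone_def)
      have dc: "koszul_d g (insert i I) ?c S = 0" for S
        unfolding koszul_d_cone[OF I less.prems(1) koszul_chain_zero[where j = j]]
        by (simp add: less.prems(3))
      obtain d where d: "koszul_chain (insert i I) (Suc (Suc j)) d" "\<And>S. koszul_d g (insert i I) d S = ?c S"
        using ex c hc dc unfolding hexact_def by blast
      obtain a b where ab: "koszul_chain I (Suc (Suc j)) a" "koszul_chain I (Suc j) b" "d = koszul_cone i a b"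
        using koszul_chain_decomp[OF I d(1)] .
      have "koszul_d g (insert i I) (koszul_cone i a b) = ?c" using d(2) ab(3) by auto
      note cyc = koszul_cone_cycleD[OF I ab(1,2) this]
      have c_eq: "c S = koszul_d g I a S + g i * b S" for S
        by (rule cyc(1)) (simp add: koszul_chain_notin[OF less.prems(1) I(2)])
      have "0 = - koszul_d g I b S" for S
        by (rule cyc(2)) (simp add: koszul_chain_notin[OF less.prems(1) I(2)])
      then have b_cyc: "koszul_d g I b S = 0" for S by simp
      \<comment> \<open>Projecting \<open>c = d a + g_i b\<close> to degree \<open>k\<close> leaves
        only this part of \<open>b\<close>, which is a homogeneous cycle of smaller degree.\<close>
      let ?b = "hproj w e (k - e i) b"
      have gI: "whomog w (e k) (g k)" if "k \<in> I" for k using g that by blast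
      have "\<exists>b'. koszul_chain I (Suc (Suc j)) b' \<and> (\<forall>S. koszul_d g I b' S = ?b S)"
      proof (rule less.hyps)
        show "nat (k - e i + 1) < nat (k + 1)" using e(1) False by simp
        show "koszul_chain I (Suc j) ?b" by (rule koszul_chain_hproj[OF ab(2)])
        show "hchain w e (k - e i) ?b" by (rule hchain_hproj)
        show "koszul_d g I ?b S = 0" for S
          by (simp add: koszul_d_hproj[OF I(1) gI ab(2)] b_cyc)
      qed
      then obtain b' where b': "koszul_chain I (Suc (Suc j)) b'" "\<And>S. koszul_d g I b' S = ?b S" by blast
      have "koszul_d g I (\<lambda>S. hproj w e k a S + g i * b' S) S = c S" for S
      proof -
        have "koszul_d g I (\<lambda>S. hproj w e k a S + g i * b' S) S
            = koszul_d g I (hproj w e k a) S + g i * koszul_d g I b' S"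
          by (simp only: koszul_d_add koszul_d_mult)
        also have "\<dots> = hpart w (k - sum e S) (koszul_d g I a S) + g i * hpart w (k - e i - sum e S) (b S)"
          by (simp only: koszul_d_hproj[OF I(1) gI ab(1)] b'(2)) (simp only: hproj_def)
        also have "g i * hpart w (k - e i - sum e S) (b S) = hpart w (k - sum e S) (g i * b S)"
          by (subst hpart_mult[OF g]) (simp_all add: algebra_simps)
        also have "hpart w (k - sum e S) (koszul_d g I a S) + \<dots> = hpart w (k - sum e S) (c S)"
          by (simp only: hpart_add c_eq)
        also have "\<dots> = c S" using less.prems(2) by (simp add: hchain_def hpart_whomog)
        finally show ?thesis .
      qed
      moreover have "koszul_chain I (Suc (Suc j)) (\<lambda>S. hproj w e k a S + g i * b' S)"
        by (intro koszul_chain_add koszul_chain_mult koszul_chain_hproj ab(1) b'(1))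
      ultimately show ?thesis by blast
    qed
  qed
  then show ?thesis unfolding hexact_def by blast
qed

text \<open>A relation \<open>g i * p = \<Sum> u k * g k\<close> is a 1-cycle of the larger complex
  whose coefficient at \<open>i\<close> is \<open>p\<close> up to sign. Once it is a boundary, the
  \<open>i\<close>-part of the bounding chain writes \<open>p\<close> in terms of the
  \<open>g k\<close> with \<open>k \<in> I\<close>.\<close>

lemma hexact_nonzerodivisor:
  assumes I: "finite I" "i \<notin> I" and g: "\<And>k. k \<in> insert i I \<Longrightarrow> whomog w (e k) (g k)"
    and ex: "hexact w e g (insert i I) (Suc 0)" and p: "whomog w m p" "g i * p \<in> gideal g I"
  shows "p \<in> gideal g I"
proof -
  obtain u where u: "g i * p = (\<Sum>k\<in>I. u k * g k)" using p(2) by (auto simp: gideal_def)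
  \<comment> \<open>Cutting the coefficients down to these degrees makes the cycle homogeneous, as
    \<open>hexact\<close> demands.\<close>
  define u' where "u' k = hpart w (e i + m - e k) (u k)" for k
  have "g i * p = hpart w (e i + m) (g i * p)" using whomog_mult[OF g p(1), of i] by (simp add: hpart_whomog)
  also have "\<dots> = (\<Sum>k\<in>I. hpart w (e i + m) (g k * u k))"
    unfolding u hpart_sum by (simp add: mult.commute)
  also have "\<dots> = (\<Sum>k\<in>I. g k * u' k)"
    unfolding u'_def using g by (intro sum.cong refl hpart_mult) auto
  finally have gp: "g i * p = (\<Sum>k\<in>I. g k * u' k)" .
  define a where "a S = (if \<exists>k\<in>I. S = {k} then - u' (the_elem S) else 0)" for S
  define b where "b S = (if S = {} then p else 0)" for S :: "nat set"
  have a: "koszul_chain I (Suc 0) a" by (auto simp: koszul_chain_def a_def)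
  have b: "koszul_chain I 0 b" by (auto simp: koszul_chain_def b_def)
  have da: "koszul_d g I a S + g i * b S = 0" for S
  proof (cases "S = {}")
    case True
    then show ?thesis by (simp add: koszul_d_def koszul_sign_def a_def b_def gp sum_negf)
  next
    case False
    have "a (insert k S) = 0" if "k \<in> I - S" for k using False that by (auto simp: a_def doubleton_eq_iff)
    then show ?thesis using False by (simp add: koszul_d_def b_def)
  qed
  have db: "koszul_d g I b S = 0" for S by (simp add: koszul_d_def b_def)
  let ?c = "koszul_cone i a b"
  have c: "koszul_chain (insert i I) (Suc 0) ?c" by (rule koszul_chain_cone[OF I a b])
  have dc: "koszul_d g (insert i I) ?c S = 0" for S
    unfolding koszul_d_cone[OF I a b] by (simp add: da db)
  have "whomog w (e i + m - sum e S) (?c S)" for S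
  proof (cases "i \<in> S")
    case i: True
    have p': "whomog w m (koszul_sign {} i * p)"
      using whomog_mult[OF whomog_koszul_sign p(1), of "{}" i] by simp
    show ?thesis
    proof (cases "S - {i} = {}")
      case True
      then have "S = {i}" using i by auto
      then show ?thesis using p' by (simp add: koszul_cone_def b_def)
    next
      case False
      then show ?thesis by (simp add: koszul_cone_def b_def i)
    qed
  next
    case False
    then show ?thesis by (auto simp: koszul_cone_def a_def u'_def intro: whomog_uminus)
  qed
  then have hc: "hchain w e (e i + m) ?c" by (simp add: hchain_def)
  obtain d where d: "koszul_chain (insert i I) (Suc (Suc 0)) d" "\<And>S. koszul_d g (insert i I) d S = ?c S"
    using ex c hc dc unfolding hexact_def by blast
  obtain a2 b2 where ab: "koszul_chain I (Suc (Suc 0)) a2" "koszul_chain I (Suc 0) b2" "d = koszul_cone i a2 b2"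
    using koszul_chain_decomp[OF I d(1)] .
  have "koszul_d g (insert i I) (koszul_cone i a2 b2) = ?c" using d(2) ab(3) by auto
  then have "b {} = - koszul_d g I b2 {}"
    by (rule koszul_cone_cycleD(2)[OF I ab(1,2)])
       (simp add: koszul_chain_notin[OF a I(2)] koszul_chain_notin[OF b I(2)])
  then have "p = - (\<Sum>k\<in>I. b2 {k} * g k)" by (simp add: b_def koszul_d_def koszul_sign_def mult.commute)
  moreover have "(\<Sum>k\<in>I. b2 {k} * g k) \<in> gideal g I"
    unfolding gideal_def by (rule CollectI) (rule exI[of _ "\<lambda>k. b2 {k}"], rule refl)
  ultimately show ?thesis using gideal_uminus by simp
qed

lemma eval_monom_at_0: "eval_monom \<alpha> 0 = (if \<alpha> = 0 then 1 else 0)"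
proof (cases "\<alpha> = 0")
  case False
  then obtain i where i: "Poly_Mapping.lookup \<alpha> i \<noteq> 0" by (metis lookup_zero poly_mapping_eqI)
  have "eval_monom \<alpha> (0 :: complex ^ 'a) = 0"
    unfolding eval_monom_def using i by (intro prod_zero) auto
  then show ?thesis using False by simp
qed simp

lemma eval_poly_at_0: "eval_poly p 0 = Poly_Mapping.lookup p 0"
  unfolding eval_poly_def eval_monom_at_0 by (simp add: if_distrib in_keys_iff cong: if_cong)

lemma weight_pos:
  assumes "\<And>i. w i > 0" "\<alpha> \<noteq> 0"
  shows "weight w \<alpha> > 0"
proof -
  obtain i where i: "Poly_Mapping.lookup \<alpha> i \<noteq> 0" using assms(2) by (metis lookup_zero poly_mapping_eqI)
  then show ?thesis unfolding weight_def using assms(1)[of i] by (intro sum_pos2[of _ i]) auto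
qed

text \<open>What the partial derivatives supply. Indexing \<open>g\<close> by the type of the
  variables encodes that there are as many generators as variables; positivity of the degrees is
  derived in \<open>e_pos\<close>.\<close>

locale graded_zero_dimensional =
  fixes w :: "'n::finite \<Rightarrow> nat" and e :: "'n \<Rightarrow> int" and g :: "'n \<Rightarrow> 'n cmpoly"
  assumes w_pos: "\<And>i. w i > 0"
    and whomog_g: "\<And>l. whomog w (e l) (g l)"
    and g_at_0: "\<And>l. eval_poly (g l) 0 = 0"
    and nilpotent: "\<And>i. \<exists>N. var i ^ N \<in> gideal g UNIV"
begin

definition num :: "nat \<Rightarrow> 'n" where
  "num = (SOME h. bij_betw h {..<CARD('n)} UNIV)"

lemma bij_num: "bij_betw num {..<CARD('n)} UNIV"
proof -
  have "\<exists>h. bij_betw h {..<CARD('n)} (UNIV :: 'n set)"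
    using ex_bij_betw_nat_finite[of "UNIV :: 'n set"] unfolding atLeast0LessThan by simp
  then show ?thesis unfolding num_def by (rule someI_ex)
qed

abbreviation gn :: "nat \<Rightarrow> 'n cmpoly" where "gn k \<equiv> g (num k)"

lemma gideal_gn: "gideal gn {..<CARD('n)} = gideal g UNIV"
  using gideal_reindex[of num "{..<CARD('n)}" g] bij_num by (auto simp: bij_betw_def)

lemma koszul_exact_gn: "koszul_exact gn {..<CARD('n)} (Suc j)"
proof -
  let ?r = "CARD('n)"
  \<comment> \<open>\<open>koszul_exact_swap\<close> compares two disjoint index sets of one family:
    the generators take the first \<open>?r\<close> indices, the variables the next
    \<open>?r\<close>.\<close>
  define G where "G k = (if k < ?r then gn k else var (num (k - ?r)))" for k
  have GF: "gideal G {..<?r} = gideal g UNIV"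
    using gideal_gn gideal_cong[of "{..<?r}" G gn] by (simp add: G_def)
  have inj: "inj_on (\<lambda>k. num (k - ?r)) {?r..<2 * ?r}"
  proof (rule inj_onI)
    fix x y assume xy: "x \<in> {?r..<2 * ?r}" "y \<in> {?r..<2 * ?r}" "num (x - ?r) = num (y - ?r)"
    then have "x - ?r = y - ?r" using bij_num by (intro inj_onD[of num "{..<?r}"]) (auto simp: bij_betw_def)
    then show "x = y" using xy by auto
  qed
  have "koszul_exact G {..<?r} (Suc j)"
  proof (rule koszul_exact_swap[of _ "{?r..<2 * ?r}"])
    fix i J p assume i: "i \<in> {?r..<2 * ?r}" and J: "J \<subseteq> {?r..<2 * ?r} - {i}" and p: "G i * p \<in> gideal G J"
    have eq: "gideal G J = gideal (\<lambda>k. var (num (k - ?r))) J"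
      using J by (intro gideal_cong) (auto simp: G_def)
    have "G i = var (num (i - ?r))" using i by (simp add: G_def)
    moreover have "finite J" using J finite_subset by blast
    moreover have "inj_on (\<lambda>k. num (k - ?r)) (insert i J)" using inj by (rule inj_on_subset) (use i J in auto)
    ultimately show "p \<in> gideal G J"
      using var_regular[of J i "\<lambda>k. num (k - ?r)" p] J p unfolding eq by auto
  next
    fix i assume "i \<in> {?r..<2 * ?r}"
    then have "G i = var (num (i - ?r))" by (simp add: G_def)
    then show "\<exists>N. G i ^ N \<in> gideal G {..<?r}" using nilpotent GF by simp
  qed auto
  moreover have "koszul_d G {..<?r} = koszul_d gn {..<?r}"
    unfolding koszul_d_def fun_eq_iff by (intro allI sum.cong) (auto simp: G_def)
  ultimately show ?thesis unfolding koszul_exact_def by simp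
qed

text \<open>Otherwise the basis vector \<open>e_k\<close> would be a 1-cycle, hence a boundary.
  Coefficients of boundaries vanish at the origin, since the generators do, but its coefficient is
  1.\<close>

lemma g_nonzero: "gn k \<noteq> 0" if k: "k < CARD('n)"
proof
  assume 0: "gn k = 0"
  let ?I = "{..<CARD('n)}"
  define c where "c S = (if S = {k} then (1 :: 'n cmpoly) else 0)" for S
  have c: "koszul_chain ?I (Suc 0) c" using k by (auto simp: koszul_chain_def c_def)
  have "koszul_sign S i * gn i * c (insert i S) = 0" if "i \<notin> S" for i S
    using that 0 by (auto simp: c_def)
  then have "koszul_d gn ?I c S = 0" for S unfolding koszul_d_def by (intro sum.neutral) simp
  then obtain b where b: "\<And>S. koszul_d gn ?I b S = c S"
    using koszul_exactD[OF koszul_exact_gn c] by blast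
  have "eval_poly (koszul_d gn ?I b {k}) 0 = 0"
    by (simp add: koszul_d_def eval_poly_sum eval_poly_mult g_at_0)
  then show False by (simp add: b c_def)
qed

text \<open>A nonzero polynomial without constant term has a monomial of positive weight. For the
  partial derivatives this is \<open>d > w_i\<close>.\<close>

lemma e_pos: "e l > 0"
proof -
  obtain k where k: "k < CARD('n)" "l = num k" using bij_num by (auto simp: bij_betw_def)
  then obtain \<alpha> where \<alpha>: "\<alpha> \<in> Poly_Mapping.keys (g l)" using g_nonzero by fastforce
  then have "\<alpha> \<noteq> 0" using g_at_0[of l] by (auto simp: eval_poly_at_0 in_keys_iff)
  then have "weight w \<alpha> > 0" by (rule weight_pos[OF w_pos])
  moreover have "int (weight w \<alpha>) = e l" using whomog_g[of l] \<alpha> unfolding whomog_def by simp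
  ultimately show ?thesis by simp
qed

text \<open>Descending induction from the full sequence; \<open>hexact_remove\<close> strips the
  last generator.\<close>

lemma hexact_initial:
  assumes "s \<le> CARD('n)"
  shows "hexact w (\<lambda>k. e (num k)) gn {..<s} (Suc j)"
  using assms
proof (induction s rule: inc_induct)
  case base
  show ?case by (rule koszul_exact_imp_hexact) (rule koszul_exact_gn)
next
  case (step s)
  show ?case
    by (rule hexact_remove[where i = s])
       (use step.IH e_pos whomog_g in \<open>simp_all add: lessThan_Suc less_imp_le\<close>)
qed

lemma regular:
  assumes "s < CARD('n)" "whomog w m p" "gn s * p \<in> gideal gn {..<s}"
  shows "p \<in> gideal gn {..<s}"
proof (rule hexact_nonzerodivisor[where i = s and w = w and e = "\<lambda>k. e (num k)" and g = gn])
  show "hexact w (\<lambda>k. e (num k)) gn (insert s {..<s}) (Suc 0)"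
    using hexact_initial[of "Suc s" 0] assms(1) by (simp add: lessThan_Suc)
qed (use assms whomog_g in auto)

end

section \<open>Hilbert series\<close>

lemma cscale_mult_right: "g * cscale c p = cscale c (g * p)"
  by (simp add: cscale_def mult.left_commute)

text \<open>The polynomial ring has infinite dimension; the finite spanning set \<open>F\<close>
  guarantees that \<open>cpoly.dim\<close> counts a finite basis.\<close>

lemma obtain_basis:
  assumes "finite F" "V \<subseteq> cpoly.span F" "S \<subseteq> V" "cpoly.independent S"
  obtains B where "S \<subseteq> B" "B \<subseteq> V" "cpoly.independent B" "V \<subseteq> cpoly.span B" "finite B" "card B = cpoly.dim V"
proof -
  obtain B where B: "S \<subseteq> B" "B \<subseteq> V" "cpoly.independent B" "V \<subseteq> cpoly.span B"
    using cpoly.maximal_independent_subset_extend[OF assms(3,4)] .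
  have "finite B" using cpoly.independent_span_bound[OF assms(1) B(3)] B(2) assms(2) by blast
  moreover have "card B = cpoly.dim V" by (rule cpoly.basis_card_eq_dim[OF B(2,4,3)])
  ultimately show ?thesis using that B by blast
qed

lemma obtain_basis0:
  assumes "finite F" "V \<subseteq> cpoly.span F"
  obtains B where "B \<subseteq> V" "cpoly.independent B" "V \<subseteq> cpoly.span B" "finite B" "card B = cpoly.dim V"
  by (rule obtain_basis[OF assms empty_subsetI cpoly.independent_empty])

lemma independentD_sum:
  assumes "cpoly.independent B" "finite B" "(\<Sum>v\<in>B. cscale (c v) v) = 0" "v \<in> B"
  shows "c v = 0"
  using assms unfolding cpoly.independent_explicit_finite_subsets by blast

lemma in_span_finite:
  assumes "finite B" "p \<in> cpoly.span B"
  shows "\<exists>c. p = (\<Sum>v\<in>B. cscale (c v) v)"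
  using assms(2) unfolding cpoly.span_finite[OF assms(1)] by blast

lemma sum_cscale_add: "(\<Sum>v\<in>B. cscale (c v) v) + (\<Sum>v\<in>B. cscale (d v) v) = (\<Sum>v\<in>B. cscale (c v + d v) v)"
  by (simp add: cpoly.scale_left_distrib sum.distrib)

text \<open>Moving the part in the span of \<open>C\<close> to the other side gives a relation on
  the independent set \<open>D\<close>.\<close>

lemma complement_coeffs_zero:
  assumes D: "cpoly.independent D" "finite D" "C \<subseteq> D" and c: "(\<Sum>v\<in>D - C. cscale (c v) v) \<in> cpoly.span C" and v: "v \<in> D - C"
  shows "c v = 0"
proof -
  have fC: "finite C" using D finite_subset by blast
  obtain a where a: "(\<Sum>v\<in>D - C. cscale (c v) v) = (\<Sum>v\<in>C. cscale (a v) v)"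
    using in_span_finite[OF fC c] by blast
  define b where "b v = (if v \<in> C then - a v else c v)" for v
  have "(\<Sum>v\<in>D. cscale (b v) v) = (\<Sum>v\<in>D - C. cscale (b v) v) + (\<Sum>v\<in>C. cscale (b v) v)"
    by (rule sum.subset_diff[OF D(3,2)])
  also have "(\<Sum>v\<in>D - C. cscale (b v) v) = (\<Sum>v\<in>D - C. cscale (c v) v)"
    by (intro sum.cong) (auto simp: b_def)
  also have "(\<Sum>v\<in>C. cscale (b v) v) = - (\<Sum>v\<in>C. cscale (a v) v)"
    unfolding sum_negf[symmetric] by (intro sum.cong) (auto simp: b_def)
  finally have "(\<Sum>v\<in>D. cscale (b v) v) = 0" by (simp add: a)
  then have "b v = 0" using independentD_sum[OF D(1,2)] v by blast
  then show ?thesis using v by (simp add: b_def)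
qed

text \<open>Rank count for the map \<open>q \<mapsto> g q\<close> from \<open>R\<close> to
  \<open>(A + g R) / A\<close>, whose kernel is \<open>U\<close>. A basis \<open>C\<close> of
  \<open>U\<close> is extended to a basis \<open>D\<close> of \<open>R\<close>; then a basis of
  \<open>A\<close> and the products \<open>g v\<close> with \<open>v \<in> D - C\<close> form a
  basis of \<open>A + g R\<close>. The additive form avoids truncated subtraction.\<close>

lemma dim_adjoin_regular:
  assumes A: "cpoly.subspace A" and U: "cpoly.subspace U" and R: "cpoly.subspace R" and UR: "U \<subseteq> R"
    and fin: "finite F" "R \<subseteq> cpoly.span F" "finite F'" "A \<subseteq> cpoly.span F'"
    and gU: "\<And>q. q \<in> U \<Longrightarrow> g * q \<in> A" and reg: "\<And>q. q \<in> R \<Longrightarrow> g * q \<in> A \<Longrightarrow> q \<in> U"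
  shows "cpoly.dim {a + g * q | a q. a \<in> A \<and> q \<in> R} + cpoly.dim U = cpoly.dim A + cpoly.dim R"
proof -
  have UF: "U \<subseteq> cpoly.span F" using UR fin(2) by (rule subset_trans)
  obtain C where C: "C \<subseteq> U" "cpoly.independent C" "U \<subseteq> cpoly.span C" "finite C" "card C = cpoly.dim U"
    using obtain_basis0[OF fin(1) UF] .
  have CR: "C \<subseteq> R" using C(1) UR by blast
  obtain D where D: "C \<subseteq> D" "D \<subseteq> R" "cpoly.independent D" "R \<subseteq> cpoly.span D" "finite D" "card D = cpoly.dim R"
    using obtain_basis[OF fin(1,2) CR C(2)] .
  obtain C' where C': "C' \<subseteq> A" "cpoly.independent C'" "A \<subseteq> cpoly.span C'" "finite C'" "card C' = cpoly.dim A"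
    using obtain_basis0[OF fin(3,4)] .
  let ?G = "(*) g" and ?W = "{a + g * q | a q. a \<in> A \<and> q \<in> R}"
  let ?E = "D - C"
  have coeff0: "c v = 0" if "g * (\<Sum>v\<in>?E. cscale (c v) v) \<in> A" "v \<in> ?E" for c v
  proof -
    have "(\<Sum>v\<in>?E. cscale (c v) v) \<in> R"
      by (rule cpoly.subspace_sum[OF R]) (use D(2) in \<open>auto intro: cpoly.subspace_scale[OF R]\<close>)
    then have "(\<Sum>v\<in>?E. cscale (c v) v) \<in> U" using reg that(1) by blast
    then have "(\<Sum>v\<in>?E. cscale (c v) v) \<in> cpoly.span C" using C(3) by blast
    then show ?thesis using complement_coeffs_zero[OF D(3,5,1)] that(2) by blast
  qed
  have fE: "finite ?E" using D(5) by simp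
  have inj: "inj_on ?G ?E"
  proof (rule inj_onI, rule ccontr)
    fix x y assume xy: "x \<in> ?E" "y \<in> ?E" "g * x = g * y" "x \<noteq> y"
    define c where "c v = (if v = x then 1 else if v = y then -1 else 0 :: complex)" for v
    have "(\<Sum>v\<in>?E. cscale (c v) v) = (\<Sum>v\<in>{x, y}. cscale (c v) v)"
      using xy fE by (intro sum.mono_neutral_right) (auto simp: c_def)
    also have "\<dots> = x - y" using xy(4) by (simp add: c_def)
    finally have "g * (\<Sum>v\<in>?E. cscale (c v) v) = 0" using xy(3) by (simp add: right_diff_distrib)
    then have "g * (\<Sum>v\<in>?E. cscale (c v) v) \<in> A" using cpoly.subspace_0[OF A] by simp
    then have "c x = 0" by (rule coeff0[OF _ xy(1)])
    then show False by (simp add: c_def)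
  qed
  \<comment> \<open>Independence is stated with separate coefficients for the two parts because
    their disjointness, which a sum over the union requires, is itself deduced from it.\<close>
  have main: "(\<forall>v\<in>C'. c v = 0) \<and> (\<forall>v\<in>?E. d v = 0)"
    if s: "(\<Sum>v\<in>C'. cscale (c v) v) + (\<Sum>v\<in>?E. cscale (d v) (g * v)) = 0" for c d
  proof -
    have a: "(\<Sum>v\<in>C'. cscale (c v) v) \<in> A"
      by (rule cpoly.subspace_sum[OF A]) (use C'(1) in \<open>auto intro: cpoly.subspace_scale[OF A]\<close>)
    have gd: "(\<Sum>v\<in>?E. cscale (d v) (g * v)) = g * (\<Sum>v\<in>?E. cscale (d v) v)"
      by (simp add: sum_distrib_left cscale_mult_right)
    have "g * (\<Sum>v\<in>?E. cscale (d v) v) = - (\<Sum>v\<in>C'. cscale (c v) v)"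
      using s unfolding gd by (simp add: eq_neg_iff_add_eq_0 add.commute)
    then have gA: "g * (\<Sum>v\<in>?E. cscale (d v) v) \<in> A" using cpoly.subspace_neg[OF A a] by simp
    have d0: "d v = 0" if "v \<in> ?E" for v by (rule coeff0[OF gA that])
    then have "(\<Sum>v\<in>C'. cscale (c v) v) = 0" using s by simp
    then show ?thesis using independentD_sum[OF C'(2,4)] d0 by blast
  qed
  have disj: "C' \<inter> ?G ` ?E = {}"
  proof (rule ccontr)
    assume "C' \<inter> ?G ` ?E \<noteq> {}"
    then obtain x where x: "x \<in> ?E" "g * x \<in> C'" by auto
    have "(\<Sum>v\<in>C'. cscale (if v = g * x then 1 else 0) v) = g * x"
      using x(2) C'(4) by (simp add: if_distrib[of "\<lambda>c. cscale c _"] cong: if_cong)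
    moreover have "(\<Sum>v\<in>?E. cscale (if v = x then -1 else 0) (g * v)) = - (g * x)"
      using x(1) fE by (simp add: if_distrib[of "\<lambda>c. cscale c _"] cong: if_cong)
    ultimately have "(\<Sum>v\<in>C'. cscale (if v = g * x then 1 else 0) v)
        + (\<Sum>v\<in>?E. cscale (if v = x then -1 else 0) (g * v)) = 0" by simp
    then have "\<forall>v\<in>C'. (if v = g * x then 1 else 0 :: complex) = 0" by (rule conjunct1[OF main])
    then have "(if g * x = g * x then 1 else 0 :: complex) = 0" by (rule bspec) (rule x(2))
    then show False by simp
  qed
  let ?B = "C' \<union> ?G ` ?E"
  have fB: "finite ?B" using C'(4) fE by simp
  have fG: "finite (?G ` ?E)" using fE by (rule finite_imageI)
  have split: "(\<Sum>v\<in>?B. cscale (c v) v) = (\<Sum>v\<in>C'. cscale (c v) v) + (\<Sum>v\<in>?E. cscale (c (g * v)) (g * v))" for c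
    unfolding sum.union_disjoint[OF C'(4) fG disj] sum.reindex[OF inj] by (simp only: comp_def)
  have "cpoly.independent ?B"
  proof (rule cpoly.independent_if_scalars_zero[OF fB])
    fix c x assume s: "(\<Sum>v\<in>?B. cscale (c v) v) = 0" and x: "x \<in> ?B"
    have m: "(\<forall>v\<in>C'. c v = 0) \<and> (\<forall>v\<in>?E. c (g * v) = 0)"
      by (rule main) (rule s[unfolded split])
    show "c x = 0" using x
    proof
      assume "x \<in> C'" then show ?thesis using m by blast
    next
      assume "x \<in> ?G ` ?E"
      then obtain v where "v \<in> ?E" "x = g * v" by (rule imageE)
      then show ?thesis using m by simp
    qed
  qed
  moreover have "?B \<subseteq> ?W"
  proof
    fix x assume "x \<in> ?B"
    then consider "x \<in> C'" | y where "y \<in> ?E" "x = g * y" by blast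
    then show "x \<in> ?W"
    proof cases
      case 1
      then have "x = x + g * 0" "x \<in> A" "0 \<in> R" using C'(1) cpoly.subspace_0[OF R] by auto
      then show ?thesis by blast
    next
      case 2
      then have "x = 0 + g * y" "0 \<in> A" "y \<in> R" using D(2) cpoly.subspace_0[OF A] by auto
      then show ?thesis by blast
    qed
  qed
  moreover have "?W \<subseteq> cpoly.span ?B"
  proof clarify
    fix a q assume a: "a \<in> A" and q: "q \<in> R"
    obtain c where c: "q = (\<Sum>v\<in>D. cscale (c v) v)" using in_span_finite[OF D(5)] D(4) q by blast
    have aB: "x \<in> cpoly.span ?B" if "x \<in> A" for x
      using that C'(3) cpoly.span_mono[of C' ?B] by blast
    have "q = (\<Sum>v\<in>?E. cscale (c v) v) + (\<Sum>v\<in>C. cscale (c v) v)"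
      unfolding c by (rule sum.subset_diff[OF D(1,5)])
    then have gq: "g * q = (\<Sum>v\<in>?E. cscale (c v) (g * v)) + g * (\<Sum>v\<in>C. cscale (c v) v)"
      by (simp add: distrib_left sum_distrib_left cscale_mult_right)
    have "(\<Sum>v\<in>C. cscale (c v) v) \<in> U"
      by (rule cpoly.subspace_sum[OF U]) (use C(1) in \<open>auto intro: cpoly.subspace_scale[OF U]\<close>)
    then have 1: "g * (\<Sum>v\<in>C. cscale (c v) v) \<in> cpoly.span ?B" using gU aB by blast
    have 2: "(\<Sum>v\<in>?E. cscale (c v) (g * v)) \<in> cpoly.span ?B"
      by (intro cpoly.span_sum cpoly.span_scale cpoly.span_base) auto
    show "a + g * q \<in> cpoly.span ?B"
      unfolding gq by (intro cpoly.span_add aB a 1 2)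
  qed
  ultimately have "card ?B = cpoly.dim ?W" by (intro cpoly.basis_card_eq_dim)
  moreover have "card ?B = card C' + card ?E"
    unfolding card_Un_disjoint[OF C'(4) fG disj] card_image[OF inj] ..
  moreover have "card ?E = card D - card C" using card_Diff_subset[OF C(4) D(1)] .
  moreover have "card C \<le> card D" using card_mono[OF D(5,1)] .
  ultimately show ?thesis using C(5) D(6) C'(5) by linarith
qed

section \<open>Weight spaces and the counting of monomials\<close>

definition hspace :: "('n::finite \<Rightarrow> nat) \<Rightarrow> int \<Rightarrow> 'n cmpoly set" where
  "hspace w k = {p. whomog w k p}"

lemma lookup_le_weight:
  assumes "w i > 0"
  shows "Poly_Mapping.lookup \<alpha> i \<le> weight w \<alpha>"
proof -
  have "Poly_Mapping.lookup \<alpha> i \<le> Poly_Mapping.lookup \<alpha> i * w i" using assms by simp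
  also have "\<dots> \<le> weight w \<alpha>" unfolding weight_def by (rule member_le_sum) auto
  finally show ?thesis .
qed

lemma finite_weight:
  assumes "\<And>i. w i > 0"
  shows "finite {\<alpha> :: 'n::finite expo. weight w \<alpha> = n}"
proof (rule finite_subset[OF _ finite_expo_bounded[of n]])
  show "{\<alpha>. weight w \<alpha> = n} \<subseteq> {\<alpha>. \<forall>i. Poly_Mapping.lookup \<alpha> i \<le> n}"
    using lookup_le_weight assms by blast
qed

lemma hspace_span:
  "hspace w k \<subseteq> cpoly.span ((\<lambda>\<alpha>. Poly_Mapping.single \<alpha> 1) ` {\<alpha>. int (weight w \<alpha>) = k})"
proof
  fix p assume "p \<in> hspace w k"
  then show "p \<in> cpoly.span ((\<lambda>\<alpha>. Poly_Mapping.single \<alpha> 1) ` {\<alpha>. int (weight w \<alpha>) = k})"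
    by (intro in_span_monomials) (auto simp: hspace_def whomog_def)
qed

lemma finite_weight_int:
  assumes "\<And>i. w i > 0"
  shows "finite {\<alpha> :: 'n::finite expo. int (weight w \<alpha>) = k}"
  by (rule finite_subset[OF _ finite_weight[OF assms, where n = "nat k"]]) auto

lemma dim_hspace:
  fixes w :: "'n::finite \<Rightarrow> nat"
  assumes "\<And>i. w i > 0"
  shows "cpoly.dim (hspace w k) = card {\<alpha> :: 'n expo. int (weight w \<alpha>) = k}"
proof -
  let ?E = "{\<alpha> :: 'n expo. int (weight w \<alpha>) = k}" and ?m = "\<lambda>\<alpha> :: 'n expo. Poly_Mapping.single \<alpha> (1::complex)"
  have fE: "finite ?E" by (rule finite_weight_int) (rule assms)
  have inj: "inj_on ?m ?E"
  proof (rule inj_onI)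
    fix \<alpha> \<beta> assume "?m \<alpha> = ?m \<beta>"
    then show "\<alpha> = \<beta>" by (metis keys_single one_neq_zero singleton_inject)
  qed
  have "cpoly.independent (?m ` ?E)"
  proof (rule cpoly.independent_if_scalars_zero)
    show "finite (?m ` ?E)" by (rule finite_imageI[OF fE])
    fix c x assume s: "(\<Sum>x\<in>?m ` ?E. cscale (c x) x) = 0" and "x \<in> ?m ` ?E"
    then obtain \<alpha> where \<alpha>: "\<alpha> \<in> ?E" "x = ?m \<alpha>" by blast
    have "(\<Sum>\<alpha>\<in>?E. Poly_Mapping.single \<alpha> (c (?m \<alpha>))) = 0"
      using s inj by (simp add: sum.reindex cscale_def mult_single)
    then have "0 = Poly_Mapping.lookup (\<Sum>\<alpha>\<in>?E. Poly_Mapping.single \<alpha> (c (?m \<alpha>))) \<alpha>" by simp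
    also have "\<dots> = c (?m \<alpha>)" by (subst lookup_sum_single[OF fE]) (use \<alpha>(1) in simp)
    finally show "c x = 0" using \<alpha>(2) by simp
  qed
  moreover have "?m ` ?E \<subseteq> hspace w k" by (auto simp: hspace_def whomog_single)
  ultimately have "card (?m ` ?E) = cpoly.dim (hspace w k)"
    by (intro cpoly.basis_card_eq_dim hspace_span)
  then show ?thesis using card_image[OF inj] by simp
qed

lemma whomog_cscale: "whomog w k p \<Longrightarrow> whomog w k (cscale c p)"
  using whomog_mult[OF whomog_cst] by (simp add: cscale_def)

lemma subspace_hspace: "cpoly.subspace (hspace w k)"
  by (rule cpoly.subspaceI) (simp_all add: hspace_def whomog_add whomog_cscale)

lemma subspace_gideal: "cpoly.subspace (gideal g I)"
  by (rule cpoly.subspaceI) (simp_all add: gideal_add gideal_mult cscale_def)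

text \<open>The Hilbert series of the polynomial ring in the variables from
  \<open>I\<close>.\<close>

definition count_fps :: "('n::finite \<Rightarrow> nat) \<Rightarrow> 'n set \<Rightarrow> int fps" where
  "count_fps w I = Abs_fps (\<lambda>n. int (card {\<alpha>. Poly_Mapping.keys \<alpha> \<subseteq> I \<and> weight w \<alpha> = n}))"

text \<open>A monomial of weight \<open>n\<close> either omits the variable \<open>i\<close> or is
  that variable times a monomial of weight \<open>n - w i\<close>.\<close>

lemma count_fps_insert:
  fixes w :: "'n::finite \<Rightarrow> nat"
  assumes w: "\<And>i. w i > 0" and i: "i \<notin> I"
  shows "count_fps w (insert i I) * (1 - fps_X ^ w i) = count_fps w I"
proof (rule fps_ext)
  fix n
  let ?S = "\<lambda>I n. {\<alpha> :: 'n expo. Poly_Mapping.keys \<alpha> \<subseteq> I \<and> weight w \<alpha> = n}"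
  have fin: "finite (?S I n)" for I n by (rule finite_subset[OF _ finite_weight[OF w, where n = n]]) auto
  let ?e = "Poly_Mapping.single i (1::nat)"
  let ?T = "{\<alpha> \<in> ?S (insert i I) n. Poly_Mapping.lookup \<alpha> i \<noteq> 0}"
  have keys_iff: "Poly_Mapping.keys \<alpha> \<subseteq> I \<longleftrightarrow>
      Poly_Mapping.keys \<alpha> \<subseteq> insert i I \<and> Poly_Mapping.lookup \<alpha> i = 0" for \<alpha> :: "'n expo"
    using i not_in_keys_iff_lookup_eq_zero[of i \<alpha>] by blast
  have uni: "?S (insert i I) n = ?S I n \<union> ?T" unfolding keys_iff by blast
  have disj: "?S I n \<inter> ?T = {}" unfolding keys_iff by blast
  have finT: "finite ?T" by (rule finite_subset[OF _ fin[of "insert i I" n]]) blast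
  have card: "card (?S (insert i I) n) = card (?S I n) + card ?T"
    using arg_cong[OF uni, of card] card_Un_disjoint[OF fin finT disj] by (rule trans)
  have plus: "(\<alpha> - ?e) + ?e = \<alpha>" if "Poly_Mapping.lookup \<alpha> i \<noteq> 0" for \<alpha>
    using that by (intro poly_mapping_eqI) (auto simp: lookup_add lookup_minus lookup_single when_def)
  \<comment> \<open>For \<open>n < w i\<close> the truncated difference would wrongly count the
    monomial 1.\<close>
  have T: "card ?T = (if n < w i then 0 else card (?S (insert i I) (n - w i)))"
  proof (cases "n < w i")
    case True
    have "weight w \<alpha> \<ge> w i" if nz: "Poly_Mapping.lookup \<alpha> i \<noteq> 0" for \<alpha>
    proof -
      have "weight w ((\<alpha> - ?e) + ?e) \<ge> w i" unfolding weight_add by simp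
      with plus[OF nz] show ?thesis by metis
    qed
    then have TE: "?T = {}" using True by fastforce
    show ?thesis unfolding TE using True by simp
  next
    case False
    have "bij_betw (\<lambda>\<alpha>. \<alpha> + ?e) (?S (insert i I) (n - w i)) ?T"
    proof (rule bij_betwI[where g = "\<lambda>\<alpha>. \<alpha> - ?e"])
      show "(\<lambda>\<alpha>. \<alpha> + ?e) \<in> ?S (insert i I) (n - w i) \<rightarrow> ?T"
      proof
        fix \<alpha> assume \<alpha>: "\<alpha> \<in> ?S (insert i I) (n - w i)"
        have "Poly_Mapping.keys (\<alpha> + ?e) \<subseteq> insert i I" using keys_add[of \<alpha> ?e] \<alpha> by auto
        then show "\<alpha> + ?e \<in> ?T" using \<alpha> False by (simp add: weight_add lookup_add)
      qed
      show "(\<lambda>\<alpha>. \<alpha> - ?e) \<in> ?T \<rightarrow> ?S (insert i I) (n - w i)"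
      proof
        fix \<alpha> assume \<alpha>: "\<alpha> \<in> ?T"
        then have "weight w ((\<alpha> - ?e) + ?e) = n" using plus by simp
        then have "weight w (\<alpha> - ?e) = n - w i" by (simp only: weight_add) simp
        moreover have "Poly_Mapping.keys (\<alpha> - ?e) \<subseteq> Poly_Mapping.keys \<alpha>"
          by (auto simp: in_keys_iff lookup_minus)
        then have "Poly_Mapping.keys (\<alpha> - ?e) \<subseteq> insert i I" using \<alpha> by blast
        ultimately show "\<alpha> - ?e \<in> ?S (insert i I) (n - w i)" by simp
      qed
    qed (use plus in simp_all)
    then have "card (?S (insert i I) (n - w i)) = card ?T" by (rule bij_betw_same_card)
    then show ?thesis unfolding if_not_P[OF False] by (rule sym)
  qed
  show "fps_nth (count_fps w (insert i I) * (1 - fps_X ^ w i)) n = fps_nth (count_fps w I) n"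
    unfolding right_diff_distrib mult_1_right fps_sub_nth fps_X_power_mult_right_nth
      count_fps_def fps_nth_Abs_fps card T by simp
qed

lemma count_fps_prod:
  assumes "\<And>i. w i > 0"
  shows "count_fps w I * (\<Prod>i\<in>I. 1 - fps_X ^ w i) = 1"
proof -
  have "finite I" by simp
  then show ?thesis
  proof (induction I)
    case empty
    have "{\<alpha>. Poly_Mapping.keys \<alpha> \<subseteq> {} \<and> weight w \<alpha> = n} = (if n = 0 then {0} else {})" for n by auto
    then show ?case by (intro fps_ext) (simp add: count_fps_def)
  next
    case (insert i I)
    have "count_fps w (insert i I) * (1 - fps_X ^ w i) = count_fps w I"
      by (rule count_fps_insert) (use assms insert.hyps in simp_all)
    then have "count_fps w (insert i I) * (\<Prod>i\<in>insert i I. 1 - fps_X ^ w i) = count_fps w I * (\<Prod>i\<in>I. 1 - fps_X ^ w i)"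
      using insert.hyps by (simp add: mult.assoc[symmetric])
    then show ?case using insert.IH by simp
  qed
qed

text \<open>Both sides are divisible by \<open>(1 - x) ^ card A\<close>; the identity is the quotient at \<open>x = 1\<close>.\<close>

lemma hilbert_evaluate:
  fixes D :: "nat \<Rightarrow> int" and w :: "'i \<Rightarrow> nat" and e :: "'j \<Rightarrow> nat"
  assumes fin: "finite A" "finite B" "card A = card B" and D0: "\<And>n. n \<ge> N \<Longrightarrow> D n = 0"
    and eq: "Abs_fps D * (\<Prod>i\<in>A. 1 - fps_X ^ w i) = (\<Prod>j\<in>B. 1 - fps_X ^ e j)"
  shows "(\<Sum>n<N. D n) * (\<Prod>i\<in>A. int (w i)) = (\<Prod>j\<in>B. int (e j))"
proof -
  define p where "p = (\<Sum>n<N. Polynomial.monom (D n) n)"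
  have "Polynomial.coeff p n = D n" for n
    using D0[of n] by (cases "n < N") (simp_all add: p_def Polynomial.coeff_sum)
  then have p: "fps_of_poly p = Abs_fps D" by (intro fps_ext) simp
  define x where "x = (Polynomial.monom 1 1 :: int poly)"
  have fx: "fps_of_poly (1 - x ^ m) = 1 - fps_X ^ m" for m
    by (simp add: x_def fps_of_poly_diff fps_of_poly_power fps_of_poly_monom)
  have "fps_of_poly (p * (\<Prod>i\<in>A. 1 - x ^ w i)) = fps_of_poly (\<Prod>j\<in>B. 1 - x ^ e j)"
    using eq by (simp add: fps_of_poly_mult fps_of_poly_prod fx p)
  then have "p * (\<Prod>i\<in>A. 1 - x ^ w i) = (\<Prod>j\<in>B. 1 - x ^ e j)" by simp
  \<comment> \<open>\<open>1 - x ^ m\<close> is \<open>1 - x\<close> times a geometric sum whose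
    value at 1 is \<open>m\<close>; as \<open>card A = card B\<close>, the powers of
    \<open>1 - x\<close> cancel.\<close>
  then have "p * ((1 - x) ^ card A * (\<Prod>i\<in>A. \<Sum>k<w i. x ^ k)) = (1 - x) ^ card A * (\<Prod>j\<in>B. \<Sum>k<e j. x ^ k)"
    by (simp add: one_diff_power_eq prod.distrib fin(3))
  moreover have "(1 - x) ^ card A \<noteq> 0"
  proof -
    have "poly (1 - x) 0 = 1" by (simp add: x_def poly_monom)
    then have "1 - x \<noteq> 0" by fastforce
    then show ?thesis by simp
  qed
  ultimately have "p * (\<Prod>i\<in>A. \<Sum>k<w i. x ^ k) = (\<Prod>j\<in>B. \<Sum>k<e j. x ^ k)"
    by (simp only: mult.left_commute[of p] mult_cancel_left) simp
  then have "poly (p * (\<Prod>i\<in>A. \<Sum>k<w i. x ^ k)) 1 = poly (\<Prod>j\<in>B. \<Sum>k<e j. x ^ k) 1" by simp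
  then show ?thesis by (simp add: poly_prod poly_sum poly_power x_def poly_monom p_def)
qed

section \<open>Hilbert series of the successive quotients\<close>

context graded_zero_dimensional
begin

definition Jh :: "nat \<Rightarrow> int \<Rightarrow> 'n cmpoly set" where
  "Jh s k = gideal gn {..<s} \<inter> hspace w k"

text \<open>The Hilbert function of the ring modulo the first \<open>s\<close> generators,
  integer-valued because the recursion in \<open>s\<close> subtracts.\<close>

definition qdim :: "nat \<Rightarrow> int \<Rightarrow> int" where
  "qdim s k = int (cpoly.dim (hspace w k)) - int (cpoly.dim (Jh s k))"

lemma Jh_Suc:
  "Jh (Suc s) k = {a + gn s * q | a q. a \<in> Jh s k \<and> q \<in> hspace w (k - e (num s))}"
proof (intro Set.set_eqI iffI)
  fix p assume "p \<in> Jh (Suc s) k"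
  then have p: "p \<in> gideal gn (insert s {..<s})" "whomog w k p"
    by (simp_all add: Jh_def hspace_def lessThan_Suc)
  obtain a b where ab: "a \<in> gideal gn {..<s}" "p = a + b * gn s"
    using p(1) unfolding gideal_insert[of "{..<s}" s, simplified] by blast
  have "p = hpart w k a + gn s * hpart w (k - e (num s)) b"
    using hpart_whomog[OF p(2)] hpart_mult[OF whomog_g, of k "num s" b] by (simp add: ab(2) hpart_add mult.commute)
  moreover have "hpart w k a \<in> Jh s k"
    using gideal_hpart[OF _ ab(1), of w "\<lambda>k. e (num k)" k] whomog_g by (simp add: Jh_def hspace_def)
  moreover have "hpart w (k - e (num s)) b \<in> hspace w (k - e (num s))" by (simp add: hspace_def)
  ultimately show "p \<in> {a + gn s * q | a q. a \<in> Jh s k \<and> q \<in> hspace w (k - e (num s))}"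
    by blast
next
  fix p assume "p \<in> {a + gn s * q | a q. a \<in> Jh s k \<and> q \<in> hspace w (k - e (num s))}"
  then obtain a q where aq: "p = a + gn s * q" "a \<in> gideal gn {..<s}" "whomog w k a" "whomog w (k - e (num s)) q"
    by (auto simp: Jh_def hspace_def)
  have "whomog w (e (num s) + (k - e (num s))) (gn s * q)" by (rule whomog_mult[OF whomog_g aq(4)])
  then have "whomog w k p" using aq by (simp add: whomog_add)
  moreover have "p \<in> gideal gn (insert s {..<s})"
    using aq(1,2) gideal_insert[of "{..<s}" s p gn] by (auto simp: mult.commute)
  ultimately show "p \<in> Jh (Suc s) k" by (simp add: Jh_def hspace_def lessThan_Suc)
qed

text \<open>On homogeneous elements modulo the first \<open>s\<close> generators, multiplication by
  \<open>gn s\<close> is injective and raises the weight by \<open>e (num s)\<close>; its cokernel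
  is the next quotient.\<close>

lemma qdim_Suc:
  assumes "s < CARD('n)"
  shows "qdim (Suc s) k = qdim s k - qdim s (k - e (num s))"
proof -
  let ?k = "k - e (num s)"
  let ?F = "\<lambda>k. (\<lambda>\<alpha>. Poly_Mapping.single \<alpha> (1::complex)) ` {\<alpha> :: 'n expo. int (weight w \<alpha>) = k}"
  have "cpoly.dim {a + gn s * q | a q. a \<in> Jh s k \<and> q \<in> hspace w ?k} + cpoly.dim (Jh s ?k)
      = cpoly.dim (Jh s k) + cpoly.dim (hspace w ?k)"
  proof (rule dim_adjoin_regular)
    show "cpoly.subspace (Jh s k)" "cpoly.subspace (Jh s ?k)"
      by (simp_all add: Jh_def cpoly.subspace_inter subspace_gideal subspace_hspace)
    show "cpoly.subspace (hspace w ?k)" by (rule subspace_hspace)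
    show "finite (?F ?k)" "finite (?F k)" using finite_weight_int[of w] w_pos by simp_all
    show "hspace w ?k \<subseteq> cpoly.span (?F ?k)" by (rule hspace_span)
    show "Jh s k \<subseteq> cpoly.span (?F k)" using hspace_span[of w k] by (auto simp: Jh_def)
    show "Jh s ?k \<subseteq> hspace w ?k" by (simp add: Jh_def)
    show "gn s * q \<in> Jh s k" if "q \<in> Jh s ?k" for q
      using that whomog_mult[OF whomog_g, of ?k q "num s"] by (simp add: Jh_def hspace_def gideal_mult)
    show "q \<in> Jh s ?k" if "q \<in> hspace w ?k" "gn s * q \<in> Jh s k" for q
      using that regular[OF assms] by (auto simp: Jh_def hspace_def)
  qed
  then have "cpoly.dim (Jh (Suc s) k) + cpoly.dim (Jh s ?k) = cpoly.dim (Jh s k) + cpoly.dim (hspace w ?k)"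
    unfolding Jh_Suc .
  then show ?thesis unfolding qdim_def by linarith
qed

lemma Jh_0: "Jh 0 k = {0}"
  by (auto simp: Jh_def gideal_def hspace_def)

lemma qdim_0: "qdim 0 k = int (card {\<alpha> :: 'n expo. int (weight w \<alpha>) = k})"
proof -
  have "cpoly.dim {0 :: 'n cmpoly} = cpoly.dim ({} :: 'n cmpoly set)"
    using cpoly.dim_span[of "{} :: 'n cmpoly set"] by simp
  also have "\<dots> = 0" using cpoly.dim_eq_card_independent[OF cpoly.independent_empty] by simp
  finally have "cpoly.dim {0 :: 'n cmpoly} = 0" .
  then show ?thesis by (simp add: qdim_def Jh_0 dim_hspace w_pos)
qed

lemma qdim_negative: "k < 0 \<Longrightarrow> qdim s k = 0"
proof -
  assume "k < 0"
  then have "hspace w k = {0}" using whomog_negative by (auto simp: hspace_def)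
  moreover have "Jh s k = {0}" using calculation by (auto simp: Jh_def)
  ultimately show ?thesis by (simp add: qdim_def)
qed

lemma hilbert_series:
  assumes "s \<le> CARD('n)"
  shows "Abs_fps (\<lambda>n. qdim s (int n)) = count_fps w UNIV * (\<Prod>k<s. 1 - fps_X ^ nat (e (num k)))"
  using assms
proof (induction s)
  case 0
  show ?case by (rule fps_ext) (simp add: qdim_0 count_fps_def)
next
  case (Suc s)
  have "Abs_fps (\<lambda>n. qdim (Suc s) (int n)) = Abs_fps (\<lambda>n. qdim s (int n)) * (1 - fps_X ^ nat (e (num s)))"
  proof (rule fps_ext)
    fix n
    \<comment> \<open>Vanishing in negative weights matches the zeros that multiplication by a power
      of \<open>fps_X\<close> shifts in.\<close>
    have "qdim s (int n - e (num s)) = (if n < nat (e (num s)) then 0 else qdim s (int (n - nat (e (num s)))))"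
      using e_pos[of "num s"] by (auto simp: qdim_negative of_nat_diff)
    then show "fps_nth (Abs_fps (\<lambda>n. qdim (Suc s) (int n))) n = fps_nth (Abs_fps (\<lambda>n. qdim s (int n)) * (1 - fps_X ^ nat (e (num s)))) n"
      using Suc.prems by (simp add: qdim_Suc right_diff_distrib fps_X_power_mult_right_nth)
  qed
  then show ?case using Suc by (simp add: mult.assoc)
qed

abbreviation J :: "'n cmpoly set" where "J \<equiv> gideal g UNIV"

text \<open>If every exponent stayed below \<open>M i\<close>, the weight would be at most
  \<open>\<Sum> M i * w i\<close>; beyond that bound some \<open>var i ^ M i\<close> divides the
  monomial.\<close>

lemma large_weight: "\<exists>N. \<forall>\<alpha> c. weight w \<alpha> \<ge> N \<longrightarrow> Poly_Mapping.single \<alpha> c \<in> J"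
proof -
  obtain M where M: "\<And>i. var i ^ M i \<in> J" using nilpotent by metis
  have "Poly_Mapping.single \<alpha> c \<in> J" if "weight w \<alpha> \<ge> Suc (\<Sum>i\<in>UNIV. M i * w i)" for \<alpha> c
  proof -
    have "\<exists>i. Poly_Mapping.lookup \<alpha> i \<ge> M i"
    proof (rule ccontr)
      assume "\<not> (\<exists>i. Poly_Mapping.lookup \<alpha> i \<ge> M i)"
      then have "weight w \<alpha> \<le> (\<Sum>i\<in>UNIV. M i * w i)"
        unfolding weight_def by (intro sum_mono mult_right_mono) (auto simp: not_le less_imp_le)
      then show False using that by simp
    qed
    then obtain i where i: "Poly_Mapping.lookup \<alpha> i \<ge> M i" by blast
    have "(\<alpha> - Poly_Mapping.single i (M i)) + Poly_Mapping.single i (M i) = \<alpha>"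
      using i by (intro poly_mapping_eqI) (auto simp: lookup_add lookup_minus lookup_single when_def)
    then have "Poly_Mapping.single \<alpha> c = Poly_Mapping.single (\<alpha> - Poly_Mapping.single i (M i)) c * var i ^ M i"
      by (simp add: var_power mult_single)
    then show ?thesis using gideal_mult[OF M] by metis
  qed
  then show ?thesis by blast
qed

text \<open>A basis of the weight \<open>k\<close> part of \<open>J\<close> is extended to one of
  the whole weight space; the added vectors form \<open>B\<close>.\<close>

lemma homogeneous_complement:
  "\<exists>B. finite B \<and> B \<subseteq> hspace w k \<and> int (card B) = qdim CARD('n) k \<and>
     (\<forall>p\<in>hspace w k. \<exists>c. p - (\<Sum>b\<in>B. cscale (c b) b) \<in> J) \<and>
     (\<forall>c. (\<Sum>b\<in>B. cscale (c b) b) \<in> J \<longrightarrow> (\<forall>b\<in>B. c b = 0))"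
proof -
  let ?F = "(\<lambda>\<alpha>. Poly_Mapping.single \<alpha> (1::complex)) ` {\<alpha> :: 'n expo. int (weight w \<alpha>) = k}"
  let ?U = "Jh CARD('n) k" and ?R = "hspace w k"
  have U: "?U = J \<inter> ?R" by (simp add: Jh_def gideal_gn)
  have fin: "finite ?F" using finite_weight_int[of w] w_pos by simp
  have UF: "?U \<subseteq> cpoly.span ?F" using hspace_span[of w k] by (auto simp: Jh_def)
  obtain C where C: "C \<subseteq> ?U" "cpoly.independent C" "?U \<subseteq> cpoly.span C" "finite C" "card C = cpoly.dim ?U"
    using obtain_basis0[OF fin UF] .
  have CR: "C \<subseteq> ?R" using C(1) U by blast
  obtain D where D: "C \<subseteq> D" "D \<subseteq> ?R" "cpoly.independent D" "?R \<subseteq> cpoly.span D" "finite D" "card D = cpoly.dim ?R"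
    using obtain_basis[OF fin hspace_span CR C(2)] .
  have "card (D - C) = card D - card C" using card_Diff_subset[OF C(4) D(1)] .
  then have card: "int (card (D - C)) = qdim CARD('n) k"
    using card_mono[OF D(5,1)] C(5) D(6) by (simp add: qdim_def)
  have span: "\<exists>c. p - (\<Sum>b\<in>D - C. cscale (c b) b) \<in> J" if pR: "p \<in> ?R" for p
  proof -
    obtain c where c: "p = (\<Sum>v\<in>D. cscale (c v) v)" using in_span_finite[OF D(5) subsetD[OF D(4) pR]] by blast
    have "p = (\<Sum>v\<in>D - C. cscale (c v) v) + (\<Sum>v\<in>C. cscale (c v) v)"
      unfolding c by (rule sum.subset_diff[OF D(1,5)])
    moreover have "(\<Sum>v\<in>C. cscale (c v) v) \<in> J"
      by (rule cpoly.subspace_sum[OF subspace_gideal])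
         (use C(1) U in \<open>auto intro: cpoly.subspace_scale[OF subspace_gideal]\<close>)
    ultimately have "p - (\<Sum>v\<in>D - C. cscale (c v) v) \<in> J" by simp
    then show ?thesis by blast
  qed
  have indep: "\<forall>b\<in>D - C. c b = 0" if "(\<Sum>b\<in>D - C. cscale (c b) b) \<in> J" for c
  proof -
    have "(\<Sum>b\<in>D - C. cscale (c b) b) \<in> ?R"
      by (rule cpoly.subspace_sum[OF subspace_hspace])
         (use D(2) in \<open>auto intro: cpoly.subspace_scale[OF subspace_hspace]\<close>)
    then have "(\<Sum>b\<in>D - C. cscale (c b) b) \<in> ?U" using that U by simp
    then have "(\<Sum>b\<in>D - C. cscale (c b) b) \<in> cpoly.span C" using C(3) by (rule rev_subsetD)
    then show ?thesis by (intro ballI complement_coeffs_zero[OF D(3,5,1)])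
  qed
  show ?thesis
    by (rule exI[of _ "D - C"]) (use D card span indep in auto)
qed

text \<open>Glues the complements of the weights below \<open>N\<close>, since all higher weights
  lie in \<open>J\<close>. As \<open>J\<close> is homogeneous, relations modulo \<open>J\<close>
  split by weight.\<close>

theorem quotient_basis:
  "\<exists>B. finite B \<and> int (card B) * (\<Prod>i\<in>UNIV. int (w i)) = (\<Prod>l\<in>UNIV. e l) \<and>
     (\<forall>p. \<exists>c. p - (\<Sum>b\<in>B. cscale (c b) b) \<in> J) \<and>
     (\<forall>c. (\<Sum>b\<in>B. cscale (c b) b) \<in> J \<longrightarrow> (\<forall>b\<in>B. c b = 0))"
proof -
  let ?r = "CARD('n)"
  obtain N where N: "\<And>\<alpha> c. weight w \<alpha> \<ge> N \<Longrightarrow> Poly_Mapping.single \<alpha> c \<in> J" using large_weight by blast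
  let ?P = "\<lambda>k B. finite B \<and> B \<subseteq> hspace w k \<and> int (card B) = qdim CARD('n) k \<and>
     (\<forall>p\<in>hspace w k. \<exists>c. p - (\<Sum>b\<in>B. cscale (c b) b) \<in> J) \<and>
     (\<forall>c. (\<Sum>b\<in>B. cscale (c b) b) \<in> J \<longrightarrow> (\<forall>b\<in>B. c b = 0))"
  have "\<forall>k. \<exists>B. ?P k B" by (rule allI) (rule homogeneous_complement)
  from choice[OF this] obtain B where HB: "\<forall>k. ?P k (B k)" by (rule exE)
  have B: "finite (B k)" "B k \<subseteq> hspace w k" "int (card (B k)) = qdim ?r k" for k
    using spec[OF HB, of k] by simp_all
  have Bspan: "\<exists>c. p - (\<Sum>b\<in>B k. cscale (c b) b) \<in> J" if "p \<in> hspace w k" for k p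
    using spec[OF HB, of k] that by simp
  have Bind: "c b = 0" if "(\<Sum>b\<in>B k. cscale (c b) b) \<in> J" "b \<in> B k" for k c b
    using spec[OF HB, of k] that by simp
  \<comment> \<open>Only the zero polynomial is homogeneous of two degrees; excluding it makes the
    \<open>B k\<close> disjoint, so that their cardinalities add up.\<close>
  have zero: "0 \<notin> B k" for k
  proof
    assume 0: "0 \<in> B k"
    have "(\<Sum>b\<in>B k. cscale (if b = 0 then 1 else 0) b) = 0" by (intro sum.neutral) simp
    then have "(\<Sum>b\<in>B k. cscale (if b = 0 then 1 else 0) b) \<in> J" by simp
    then have "(if (0 :: 'n cmpoly) = 0 then 1 else 0 :: complex) = 0" by (rule Bind) (rule 0)
    then show False by simp
  qed
  have disj: "B k \<inter> B l = {}" if "k \<noteq> l" for k l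
  proof (rule ccontr)
    assume "B k \<inter> B l \<noteq> {}"
    then obtain b where b: "b \<in> B k" "b \<in> B l" by blast
    then have "whomog w k b" "whomog w l b" using B(2) by (auto simp: hspace_def)
    then have "b = 0" using hpart_whomog_other[of w k b l] hpart_whomog[of w l b] that by simp
    then show False using b zero by blast
  qed
  define BB where "BB = (\<Union>k<N. B (int k))"
  have fBB: "finite BB" using B(1) by (simp add: BB_def)
  have "card BB = (\<Sum>k<N. card (B (int k)))"
    unfolding BB_def using B(1) disj by (intro card_UN_disjoint) auto
  then have card: "int (card BB) = (\<Sum>k<N. qdim ?r (int k))" by (simp add: B(3))
  have qdim_large: "qdim ?r (int n) = 0" if "n \<ge> N" for n
  proof -
    have "hspace w (int n) \<subseteq> J"
    proof
      fix p assume "p \<in> hspace w (int n)"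
      then have "weight w \<alpha> \<ge> N" if "\<alpha> \<in> Poly_Mapping.keys p" for \<alpha>
        using that \<open>n \<ge> N\<close> by (auto simp: hspace_def whomog_def)
      then have "(\<Sum>\<alpha>\<in>Poly_Mapping.keys p. Poly_Mapping.single \<alpha> (Poly_Mapping.lookup p \<alpha>)) \<in> J"
        using N by (intro gideal_sum) blast
      then show "p \<in> J" by (simp add: cmpoly_sum_single)
    qed
    then have "Jh ?r (int n) = hspace w (int n)" by (auto simp: Jh_def gideal_gn)
    then show ?thesis by (simp add: qdim_def)
  qed
  have "Abs_fps (\<lambda>n. qdim ?r (int n)) * (\<Prod>i\<in>UNIV. 1 - fps_X ^ w i)
      = (count_fps w UNIV * (\<Prod>i\<in>UNIV. 1 - fps_X ^ w i)) * (\<Prod>k<?r. 1 - fps_X ^ nat (e (num k)))"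
  proof -
    have "Abs_fps (\<lambda>n. qdim ?r (int n)) = count_fps w UNIV * (\<Prod>k<?r. 1 - fps_X ^ nat (e (num k)))"
      by (rule hilbert_series) (rule order_refl)
    then show ?thesis by (simp only: mult_ac)
  qed
  then have series: "Abs_fps (\<lambda>n. qdim ?r (int n)) * (\<Prod>i\<in>UNIV. 1 - fps_X ^ w i)
      = (\<Prod>k<?r. 1 - fps_X ^ nat (e (num k)))"
    by (simp only: count_fps_prod[of w, OF w_pos] mult_1_left)
  have "(\<Sum>n<N. qdim ?r (int n)) * (\<Prod>i\<in>UNIV. int (w i)) = (\<Prod>k<?r. int (nat (e (num k))))"
    by (rule hilbert_evaluate[OF _ _ _ qdim_large series]) simp_all
  also have "\<dots> = (\<Prod>k<?r. e (num k))" using e_pos by (simp add: less_imp_le)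
  also have "\<dots> = (\<Prod>l\<in>UNIV. e l)" by (rule prod.reindex_bij_betw[OF bij_num])
  finally have count: "int (card BB) * (\<Prod>i\<in>UNIV. int (w i)) = (\<Prod>l\<in>UNIV. e l)" by (simp only: card)
  have span: "\<exists>c. p - (\<Sum>b\<in>BB. cscale (c b) b) \<in> J" for p
  proof (induction p rule: cmpoly_induct)
    case (single \<alpha> a)
    show ?case
    proof (cases "weight w \<alpha> < N")
      case True
      let ?k = "int (weight w \<alpha>)"
      have "Poly_Mapping.single \<alpha> a \<in> hspace w ?k" by (simp add: hspace_def whomog_single)
      then obtain c where c: "Poly_Mapping.single \<alpha> a - (\<Sum>b\<in>B ?k. cscale (c b) b) \<in> J" using Bspan by blast
      have "B ?k \<subseteq> BB" using True by (auto simp: BB_def)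
      then have "(\<Sum>b\<in>BB. cscale (if b \<in> B ?k then c b else 0) b) = (\<Sum>b\<in>B ?k. cscale (c b) b)"
        by (intro sum.mono_neutral_cong_right[OF fBB]) auto
      then have "Poly_Mapping.single \<alpha> a - (\<Sum>b\<in>BB. cscale (if b \<in> B ?k then c b else 0) b) \<in> J"
        using c by simp
      then show ?thesis by (rule exI[of _ "\<lambda>b. if b \<in> B ?k then c b else 0"])
    next
      case False
      then have "Poly_Mapping.single \<alpha> a - (\<Sum>b\<in>BB. cscale 0 b) \<in> J" using N by simp
      then show ?thesis by (rule exI[of _ "\<lambda>_. 0"])
    qed
  next
    case (add p q)
    then obtain c d where cd: "p - (\<Sum>b\<in>BB. cscale (c b) b) \<in> J" "q - (\<Sum>b\<in>BB. cscale (d b) b) \<in> J" by blast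
    have "p + q - (\<Sum>b\<in>BB. cscale (c b + d b) b) = (p - (\<Sum>b\<in>BB. cscale (c b) b)) + (q - (\<Sum>b\<in>BB. cscale (d b) b))"
      by (simp flip: sum_cscale_add)
    then have "p + q - (\<Sum>b\<in>BB. cscale (c b + d b) b) \<in> J" using gideal_add[OF cd] by (simp only:)
    then show ?case by (rule exI[of _ "\<lambda>b. c b + d b"])
  qed
  have indep: "\<forall>b\<in>BB. c b = 0" if cJ: "(\<Sum>b\<in>BB. cscale (c b) b) \<in> J" for c
  proof
    fix b assume "b \<in> BB"
    then obtain k where k: "k < N" "b \<in> B (int k)" by (auto simp: BB_def)
    have "hpart w (int k) (\<Sum>b\<in>BB. cscale (c b) b) = (\<Sum>b\<in>BB. hpart w (int k) (cscale (c b) b))"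
      by (rule hpart_sum)
    also have "\<dots> = (\<Sum>b\<in>B (int k). cscale (c b) b)"
    proof (rule sum.mono_neutral_cong_right[OF fBB])
      show "B (int k) \<subseteq> BB" using k(1) by (auto simp: BB_def)
      show "\<forall>b\<in>BB - B (int k). hpart w (int k) (cscale (c b) b) = 0"
      proof
        fix b assume "b \<in> BB - B (int k)"
        then obtain l where "b \<in> B (int l)" "l \<noteq> k" by (auto simp: BB_def)
        then show "hpart w (int k) (cscale (c b) b) = 0"
          using B(2)[of "int l"] by (intro hpart_whomog_other[of w "int l"] whomog_cscale) (auto simp: hspace_def)
      qed
      show "hpart w (int k) (cscale (c b) b) = cscale (c b) b" if "b \<in> B (int k)" for b
        using that B(2)[of "int k"] by (intro hpart_whomog whomog_cscale) (auto simp: hspace_def)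
    qed
    finally have "(\<Sum>b\<in>B (int k). cscale (c b) b) \<in> J"
      using gideal_hpart[OF whomog_g cJ, of "int k"] by simp
    then show "c b = 0" using k(2) by (rule Bind)
  qed
  show ?thesis using fBB count span indep by blast
qed

end

section \<open>Convergent power series\<close>

abbreviation tdeg :: "'n::finite expo \<Rightarrow> nat" where "tdeg \<equiv> weight (\<lambda>_. 1)"

lemma eval_monom_const: "eval_monom \<alpha> (\<chi> j. c) = c ^ tdeg \<alpha>"
  by (simp add: eval_monom_def weight_def power_sum)

text \<open>At a diagonal point \<open>(t, ..., t)\<close> a monomial has the value
  \<open>t ^ tdeg \<alpha>\<close>; conversely such a bound dominates the series on a whole ball. In
  this form restricting and shifting a series are plain comparisons.\<close>

lemma convergent_series_iff:
  fixes a :: "'n::finite cseries"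
  shows "convergent_series a \<longleftrightarrow> (\<exists>\<epsilon>>0. (\<lambda>\<alpha>. norm (a \<alpha>) * \<epsilon> ^ tdeg \<alpha>) summable_on UNIV)"
proof
  assume "convergent_series a"
  then obtain U where U: "open U" "0 \<in> U" "\<And>x. x \<in> U \<Longrightarrow> (\<lambda>\<alpha>. a \<alpha> * eval_monom \<alpha> x) summable_on UNIV"
    unfolding convergent_series_def by blast
  have "((\<lambda>t. \<chi> j::'n. complex_of_real t) \<longlongrightarrow> (\<chi> j. complex_of_real 0)) (at_right 0)"
    by (intro tendsto_vec_lambda tendsto_of_real tendsto_ident_at)
  moreover have "(\<chi> j::'n. complex_of_real 0) = 0" by (simp add: vec_eq_iff)
  ultimately have "((\<lambda>t. \<chi> j. complex_of_real t) \<longlongrightarrow> (0 :: complex ^ 'n)) (at_right 0)" by simp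
  then have "\<forall>\<^sub>F t in at_right 0. (\<chi> j. complex_of_real t) \<in> U" using U(1,2) by (rule topological_tendstoD)
  moreover have "\<forall>\<^sub>F t in at_right 0. t > (0::real)" by (rule eventually_at_right_less)
  ultimately have "\<forall>\<^sub>F t in at_right 0. (\<chi> j. complex_of_real t) \<in> U \<and> t > 0" by (rule eventually_conj)
  then have "\<exists>t. (\<chi> j. complex_of_real t) \<in> U \<and> t > 0" by (rule eventually_happens'[rotated]) simp
  then obtain t where t: "(\<chi> j. complex_of_real t) \<in> U" "t > 0" by blast
  have "(\<lambda>\<alpha>. a \<alpha> * eval_monom \<alpha> (\<chi> j. complex_of_real t)) summable_on UNIV"
    by (rule U(3)[OF t(1)])
  then have "(\<lambda>\<alpha>. norm (a \<alpha> * eval_monom \<alpha> (\<chi> j. complex_of_real t))) summable_on UNIV"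
    by (simp only: summable_on_iff_abs_summable_on_complex)
  then have "(\<lambda>\<alpha>. norm (a \<alpha>) * t ^ tdeg \<alpha>) summable_on UNIV"
    using t(2) by (simp add: eval_monom_const norm_mult norm_power)
  then show "\<exists>\<epsilon>>0. (\<lambda>\<alpha>. norm (a \<alpha>) * \<epsilon> ^ tdeg \<alpha>) summable_on UNIV" using t(2) by blast
next
  assume "\<exists>\<epsilon>>0. (\<lambda>\<alpha>. norm (a \<alpha>) * \<epsilon> ^ tdeg \<alpha>) summable_on UNIV"
  then obtain \<epsilon> where \<epsilon>: "\<epsilon> > 0" "(\<lambda>\<alpha>. norm (a \<alpha>) * \<epsilon> ^ tdeg \<alpha>) summable_on UNIV" by blast
  have "(\<lambda>\<alpha>. a \<alpha> * eval_monom \<alpha> x) summable_on UNIV" if x: "x \<in> ball 0 \<epsilon>" for x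
  proof -
    have "norm (eval_monom \<alpha> x) \<le> \<epsilon> ^ tdeg \<alpha>" for \<alpha>
    proof -
      have "norm (eval_monom \<alpha> x) = (\<Prod>i\<in>UNIV. norm (x $ i) ^ Poly_Mapping.lookup \<alpha> i)"
        by (simp add: eval_monom_def norm_power flip: prod_norm)
      also have "\<dots> \<le> (\<Prod>i\<in>UNIV. \<epsilon> ^ Poly_Mapping.lookup \<alpha> i)"
      proof (rule prod_mono)
        fix i
        have "norm (x $ i) \<le> \<epsilon>" using Finite_Cartesian_Product.norm_nth_le[of x i] x by simp
        then show "0 \<le> norm (x $ i) ^ Poly_Mapping.lookup \<alpha> i \<and> norm (x $ i) ^ Poly_Mapping.lookup \<alpha> i \<le> \<epsilon> ^ Poly_Mapping.lookup \<alpha> i"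
          by (simp add: power_mono)
      qed
      also have "\<dots> = \<epsilon> ^ tdeg \<alpha>" by (simp add: weight_def power_sum)
      finally show ?thesis .
    qed
    then have le: "norm (a \<alpha> * eval_monom \<alpha> x) \<le> norm (a \<alpha>) * \<epsilon> ^ tdeg \<alpha>" for \<alpha>
      unfolding norm_mult by (intro mult_left_mono norm_ge_zero)
    have "(\<lambda>\<alpha>. norm (a \<alpha> * eval_monom \<alpha> x)) summable_on UNIV"
      by (rule summable_on_comparison_test[OF \<epsilon>(2)]) (rule le, rule norm_ge_zero)
    then show ?thesis by (simp only: summable_on_iff_abs_summable_on_complex)
  qed
  then show "convergent_series a"
    unfolding convergent_series_def using \<epsilon>(1) by (intro exI[of _ "ball 0 \<epsilon>"]) auto
qed

lemma convergent_seriesE: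
  assumes "convergent_series a"
  obtains \<epsilon> where "\<epsilon> > 0" "(\<lambda>\<alpha>. norm (a \<alpha>) * \<epsilon> ^ tdeg \<alpha>) summable_on UNIV"
proof -
  have "\<exists>\<epsilon>>0. (\<lambda>\<alpha>. norm (a \<alpha>) * \<epsilon> ^ tdeg \<alpha>) summable_on UNIV"
    using assms by (rule convergent_series_iff[THEN iffD1])
  then show ?thesis by (elim exE conjE) (rule that)
qed

lemma convergent_seriesI:
  assumes "\<epsilon> > 0" "(\<lambda>\<alpha>. norm (a \<alpha>) * \<epsilon> ^ tdeg \<alpha>) summable_on UNIV"
  shows "convergent_series a"
  unfolding convergent_series_iff by (intro exI[of _ \<epsilon>] conjI assms)

lemma convergent_series_restrict:
  assumes "convergent_series a"
  shows "convergent_series (\<lambda>\<alpha>. if P \<alpha> then a \<alpha> else 0)"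
proof -
  obtain \<epsilon> where \<epsilon>: "\<epsilon> > 0" "(\<lambda>\<alpha>. norm (a \<alpha>) * \<epsilon> ^ tdeg \<alpha>) summable_on UNIV"
    using convergent_seriesE[OF assms] .
  have "(\<lambda>\<alpha>. norm (if P \<alpha> then a \<alpha> else 0) * \<epsilon> ^ tdeg \<alpha>) summable_on UNIV"
  proof (rule summable_on_comparison_test[OF \<epsilon>(2)])
    fix \<alpha> :: "'a expo"
    have pos: "0 \<le> \<epsilon> ^ tdeg \<alpha>" using \<epsilon>(1) by simp
    show "norm (if P \<alpha> then a \<alpha> else 0) * \<epsilon> ^ tdeg \<alpha> \<le> norm (a \<alpha>) * \<epsilon> ^ tdeg \<alpha>"
      "0 \<le> norm (if P \<alpha> then a \<alpha> else 0) * \<epsilon> ^ tdeg \<alpha>"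
      using pos by (simp_all split: if_split)
  qed
  with \<epsilon>(1) show ?thesis by (rule convergent_seriesI)
qed

text \<open>Division by the monomial of exponent \<open>\<gamma>\<close>, applied to the terms that
  it divides. The radius stays, at the cost of a constant factor.\<close>

lemma convergent_series_shift:
  assumes "convergent_series a"
  shows "convergent_series (\<lambda>\<beta>. a (\<beta> + \<gamma>))"
proof -
  obtain \<epsilon> where \<epsilon>: "\<epsilon> > 0" "(\<lambda>\<alpha>. norm (a \<alpha>) * \<epsilon> ^ tdeg \<alpha>) summable_on UNIV"
    using convergent_seriesE[OF assms] .
  have "(\<lambda>\<alpha>. norm (a \<alpha>) * \<epsilon> ^ tdeg \<alpha>) summable_on range (\<lambda>\<beta>. \<beta> + \<gamma>)"
    by (rule summable_on_subset_banach[OF \<epsilon>(2)]) simp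
  then have "(\<lambda>\<beta>. norm (a (\<beta> + \<gamma>)) * \<epsilon> ^ tdeg (\<beta> + \<gamma>)) summable_on UNIV"
    by (subst (asm) summable_on_reindex) (simp_all add: comp_def)
  then have "(\<lambda>\<beta>. inverse (\<epsilon> ^ tdeg \<gamma>) * (norm (a (\<beta> + \<gamma>)) * \<epsilon> ^ tdeg (\<beta> + \<gamma>))) summable_on UNIV"
    by (rule summable_on_cmult_right)
  moreover have "inverse (\<epsilon> ^ tdeg \<gamma>) * (norm (a (\<beta> + \<gamma>)) * \<epsilon> ^ tdeg (\<beta> + \<gamma>)) = norm (a (\<beta> + \<gamma>)) * \<epsilon> ^ tdeg \<beta>" for \<beta>
    using \<epsilon>(1) by (simp add: weight_add power_add)
  ultimately have "(\<lambda>\<beta>. norm (a (\<beta> + \<gamma>)) * \<epsilon> ^ tdeg \<beta>) summable_on UNIV" by (simp only:)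
  with \<epsilon>(1) show ?thesis by (rule convergent_seriesI)
qed

lemma series_mult_add_right:
  "series_mult a (\<lambda>\<alpha>. b \<alpha> + c \<alpha>) = (\<lambda>\<alpha>. series_mult a b \<alpha> + series_mult a c \<alpha>)"
  using series_mult_add[of b c a] by (simp add: series_mult_commute[of a])

text \<open>The condition is divisibility by the monomial; without it the truncated
  \<open>\<gamma> - \<delta>\<close> would select a wrong coefficient.\<close>

lemma series_mult_single:
  "series_mult a (Poly_Mapping.lookup (Poly_Mapping.single \<delta> c)) \<gamma> =
     (if \<exists>\<beta>. \<gamma> = \<beta> + \<delta> then a (\<gamma> - \<delta>) * c else 0)"
proof (cases "\<exists>\<beta>. \<gamma> = \<beta> + \<delta>")
  case True
  then obtain \<beta> where \<beta>: "\<gamma> = \<beta> + \<delta>" by blast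
  have "series_mult a (Poly_Mapping.lookup (Poly_Mapping.single \<delta> c)) \<gamma> = (\<Sum>p\<in>{(\<beta>, \<delta>)}. a (fst p) * c)"
    unfolding series_mult_def case_prod_beta
    by (rule sum.mono_neutral_cong_right)
       (auto simp: finite_expo_splits[unfolded case_prod_beta] lookup_single when_def \<beta>)
  then show ?thesis using True by (simp add: \<beta>)
next
  case False
  then show ?thesis
    unfolding series_mult_def by (auto simp: lookup_single when_def intro!: sum.neutral)
qed

lemma lookup_mult_series:
  "Poly_Mapping.lookup (p * q) = series_mult (Poly_Mapping.lookup p) (Poly_Mapping.lookup (q :: 'n::finite cmpoly))"
proof (induction q rule: cmpoly_induct)
  case (single \<delta> c)
  show ?case
  proof
    fix \<gamma>
    show "Poly_Mapping.lookup (p * Poly_Mapping.single \<delta> c) \<gamma> =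
        series_mult (Poly_Mapping.lookup p) (Poly_Mapping.lookup (Poly_Mapping.single \<delta> c)) \<gamma>"
    proof (induction p rule: cmpoly_induct)
      case (single \<alpha> d)
      show ?case
      proof (cases "\<exists>\<beta>. \<gamma> = \<beta> + \<delta>")
        case True
        then obtain \<beta> where "\<gamma> = \<beta> + \<delta>" by (rule exE)
        then show ?thesis unfolding mult_single series_mult_single by (simp add: lookup_single when_def)
      next
        case False
        then have "\<alpha> + \<delta> \<noteq> \<gamma>" by auto
        then show ?thesis unfolding mult_single series_mult_single if_not_P[OF False] by (simp add: lookup_single)
      qed
    next
      case (add p q)
      then show ?case by (simp add: distrib_right lookup_add series_mult_single algebra_simps)
    qed
  qed
next
  case (add q q')
  have "Poly_Mapping.lookup (q + q') = (\<lambda>\<alpha>. Poly_Mapping.lookup q \<alpha> + Poly_Mapping.lookup q' \<alpha>)"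
    by (simp add: fun_eq_iff lookup_add)
  then show ?case using add by (simp add: distrib_left lookup_add series_mult_add_right fun_eq_iff)
qed

text \<open>Only meaningful for positive weights: otherwise the index set may be infinite and the sum is \<open>0\<close>.\<close>

definition spart :: "('n::finite \<Rightarrow> nat) \<Rightarrow> int \<Rightarrow> 'n cseries \<Rightarrow> 'n cmpoly" where
  "spart w k a = (\<Sum>\<alpha>\<in>{\<alpha>. int (weight w \<alpha>) = k}. Poly_Mapping.single \<alpha> (a \<alpha>))"

lemma lookup_spart:
  assumes "\<And>i. w i > 0"
  shows "Poly_Mapping.lookup (spart w k a) \<alpha> = (if int (weight w \<alpha>) = k then a \<alpha> else 0)"
proof -
  have "finite {\<alpha>. int (weight w \<alpha>) = k}" by (rule finite_weight_int) (rule assms)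
  from lookup_sum_single[OF this, of a \<alpha>] show ?thesis by (simp add: spart_def)
qed

lemma whomog_spart:
  assumes "\<And>i. w i > 0"
  shows "whomog w k (spart w k a)"
  unfolding whomog_def
proof
  fix \<alpha> assume "\<alpha> \<in> Poly_Mapping.keys (spart w k a)"
  then have "Poly_Mapping.lookup (spart w k a) \<alpha> \<noteq> 0" by (simp add: in_keys_iff)
  then show "int (weight w \<alpha>) = k" unfolding lookup_spart[of w, OF assms] by (simp split: if_splits)
qed

text \<open>Terms of \<open>g\<close> have weight \<open>e\<close>, so only the terms of
  \<open>a\<close> of weight \<open>k - e\<close> contribute. They form a polynomial, which replaces
  the series.\<close>

lemma series_mult_component:
  assumes w: "\<And>i. w i > 0" and g: "whomog w e g" and k: "int (weight w \<gamma>) = k"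
  shows "series_mult a (Poly_Mapping.lookup g) \<gamma> = Poly_Mapping.lookup (spart w (k - e) a * g) \<gamma>"
  unfolding lookup_mult_series series_mult_def
proof (rule sum.cong[OF refl], clarify)
  fix \<alpha> \<beta> :: "'a expo" assume \<gamma>: "\<gamma> = \<alpha> + \<beta>"
  show "a \<alpha> * Poly_Mapping.lookup g \<beta> = Poly_Mapping.lookup (spart w (k - e) a) \<alpha> * Poly_Mapping.lookup g \<beta>"
  proof (cases "Poly_Mapping.lookup g \<beta> = 0")
    case False
    then have "int (weight w \<beta>) = e" using g by (simp add: whomog_def in_keys_iff)
    then have "int (weight w \<alpha>) = k - e" using k by (simp add: \<gamma> weight_add)
    then show ?thesis by (simp add: lookup_spart[of w, OF w])
  qed simp
qed

section \<open>Ideals of the ring of convergent power series\<close>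

abbreviation CSR :: "'n::finite cseries ring" where "CSR \<equiv> convergent_series_ring"

lemma CSR_simps:
  "a \<in> carrier CSR \<longleftrightarrow> convergent_series a" "a \<otimes>\<^bsub>CSR\<^esub> b = series_mult a b"
  "a \<oplus>\<^bsub>CSR\<^esub> b = (\<lambda>\<alpha>. a \<alpha> + b \<alpha>)" "\<one>\<^bsub>CSR\<^esub> = const_series 1" "\<zero>\<^bsub>CSR\<^esub> = const_series 0"
  by (simp_all add: convergent_series_ring_def)

text \<open>A generated ideal is defined as an intersection and shows no coefficients. This set is
  an ideal that contains the generators, hence contains the generated ideal.\<close>

definition series_combinations :: "('n::finite \<Rightarrow> 'n cmpoly) \<Rightarrow> 'n cseries set" where
  "series_combinations g =
     {\<lambda>\<gamma>. \<Sum>i\<in>UNIV. series_mult (u i) (Poly_Mapping.lookup (g i)) \<gamma> | u. \<forall>i. convergent_series (u i)}"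

lemma series_combinationsI:
  "(\<And>i. convergent_series (u i)) \<Longrightarrow>
     (\<lambda>\<gamma>. \<Sum>i\<in>UNIV. series_mult (u i) (Poly_Mapping.lookup (g i)) \<gamma>) \<in> series_combinations g"
  unfolding series_combinations_def by (intro CollectI exI[of _ u] conjI refl allI)

lemma convergent_series_sum:
  "(\<And>i. i \<in> A \<Longrightarrow> convergent_series (u i)) \<Longrightarrow> convergent_series (\<lambda>\<alpha>. \<Sum>i\<in>A. u i \<alpha>)"
proof (induction A rule: infinite_finite_induct)
  case (insert i A)
  then show ?case using convergent_series_add[of "u i" "\<lambda>\<alpha>. \<Sum>i\<in>A. u i \<alpha>"] by simp
qed (use convergent_series_const[of 0] in \<open>simp_all add: const_series_def\<close>)

lemma series_mult_sum_right: "series_mult a (\<lambda>\<alpha>. \<Sum>i\<in>A. b i \<alpha>) = (\<lambda>\<gamma>. \<Sum>i\<in>A. series_mult a (b i) \<gamma>)"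
proof
  fix \<gamma>
  show "series_mult a (\<lambda>\<alpha>. \<Sum>i\<in>A. b i \<alpha>) \<gamma> = (\<Sum>i\<in>A. series_mult a (b i) \<gamma>)"
    unfolding series_mult_def case_prod_beta sum_distrib_left by (rule sum.swap)
qed

lemma const_series_eq_lookup: "const_series c = Poly_Mapping.lookup (cst c)"
  by (auto simp: const_series_def fun_eq_iff lookup_single when_def)

lemma CSR_a_inv:
  assumes "convergent_series a"
  shows "\<ominus>\<^bsub>CSR\<^esub> a = (\<lambda>\<alpha>. - a \<alpha>)"
proof -
  interpret R: cring "CSR :: 'a cseries ring" by (rule convergent_series_ring_is_cring)
  have "convergent_series (series_mult (const_series (-1)) a)"
    by (intro convergent_series_mult convergent_series_const assms)
  then have neg: "convergent_series (\<lambda>\<alpha>. - a \<alpha>)" by (simp add: series_mult_const)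
  show ?thesis
  proof (rule R.minus_equality)
    show "(\<lambda>\<alpha>. - a \<alpha>) \<oplus>\<^bsub>CSR\<^esub> a = \<zero>\<^bsub>CSR\<^esub>"
      unfolding CSR_simps(3,5) by (simp add: const_series_def)
    show "a \<in> carrier CSR" "(\<lambda>\<alpha>. - a \<alpha>) \<in> carrier CSR"
      unfolding CSR_simps(1) by (rule assms, rule neg)
  qed
qed

lemma ideal_series_combinations: "ideal (series_combinations g) CSR"
proof -
  interpret R: cring "CSR :: 'a cseries ring" by (rule convergent_series_ring_is_cring)
  have conv: "convergent_series a" if "a \<in> series_combinations g" for a
    using that unfolding series_combinations_def
    by (auto intro!: convergent_series_sum convergent_series_mult convergent_series_lookup)
  have mult: "series_mult c a \<in> series_combinations g" if c: "convergent_series c" and a: "a \<in> series_combinations g" for a c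
  proof -
    obtain u where u: "a = (\<lambda>\<gamma>. \<Sum>i\<in>UNIV. series_mult (u i) (Poly_Mapping.lookup (g i)) \<gamma>)" "\<And>i. convergent_series (u i)"
      using a unfolding series_combinations_def by blast
    have "series_mult c a = (\<lambda>\<gamma>. \<Sum>i\<in>UNIV. series_mult (series_mult c (u i)) (Poly_Mapping.lookup (g i)) \<gamma>)"
      by (simp add: u(1) series_mult_sum_right series_mult_assoc)
    then show ?thesis using series_combinationsI[of "\<lambda>i. series_mult c (u i)" g]
      by (simp add: c u(2) convergent_series_mult)
  qed
  have add: "(\<lambda>\<alpha>. a \<alpha> + b \<alpha>) \<in> series_combinations g" if ab: "a \<in> series_combinations g" "b \<in> series_combinations g" for a b
  proof -
    obtain u v where u: "a = (\<lambda>\<gamma>. \<Sum>i\<in>UNIV. series_mult (u i) (Poly_Mapping.lookup (g i)) \<gamma>)" "\<And>i. convergent_series (u i)"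
      and v: "b = (\<lambda>\<gamma>. \<Sum>i\<in>UNIV. series_mult (v i) (Poly_Mapping.lookup (g i)) \<gamma>)" "\<And>i. convergent_series (v i)"
      using ab unfolding series_combinations_def by blast
    have "(\<lambda>\<alpha>. a \<alpha> + b \<alpha>) = (\<lambda>\<gamma>. \<Sum>i\<in>UNIV. series_mult (\<lambda>\<alpha>. u i \<alpha> + v i \<alpha>) (Poly_Mapping.lookup (g i)) \<gamma>)"
      by (simp add: u(1) v(1) series_mult_add sum.distrib)
    then show ?thesis using series_combinationsI[of "\<lambda>i \<alpha>. u i \<alpha> + v i \<alpha>" g]
      by (simp add: u(2) v(2) convergent_series_add)
  qed
  have zero: "(\<lambda>\<alpha>. 0) \<in> series_combinations g"
    using series_combinationsI[of "\<lambda>_. const_series 0" g] convergent_series_const[of 0]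
    by (simp add: series_mult_const)
  show ?thesis
  proof (rule idealI)
    show "subgroup (series_combinations g) (add_monoid CSR)"
    proof (rule R.add.subgroupI)
      show "series_combinations g \<subseteq> carrier CSR" using conv by (auto simp: CSR_simps)
      show "series_combinations g \<noteq> {}" using zero by blast
      show "\<ominus>\<^bsub>CSR\<^esub> a \<in> series_combinations g" if "a \<in> series_combinations g" for a
        using mult[OF convergent_series_const[of "-1"] that] CSR_a_inv[OF conv[OF that]]
        by (simp add: series_mult_const)
      show "a \<oplus>\<^bsub>CSR\<^esub> b \<in> series_combinations g" if "a \<in> series_combinations g" "b \<in> series_combinations g" for a b
        using add[OF that] by (simp add: CSR_simps)
    qed
    show "x \<otimes>\<^bsub>CSR\<^esub> a \<in> series_combinations g" if "a \<in> series_combinations g" "x \<in> carrier CSR" for a x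
      using mult[of x a] that by (simp add: CSR_simps)
    show "a \<otimes>\<^bsub>CSR\<^esub> x \<in> series_combinations g" if "a \<in> series_combinations g" "x \<in> carrier CSR" for a x
      using mult[of x a] that by (simp add: CSR_simps series_mult_commute)
  qed (rule R.ring_axioms)
qed

context graded_zero_dimensional
begin

text \<open>This is \<open>jacobian_ideal f\<close> if \<open>g\<close> consists of the partial
  derivatives of \<open>f\<close>.\<close>

definition SI :: "'n cseries set" where
  "SI = Idl\<^bsub>CSR\<^esub> {Poly_Mapping.lookup (g i) | i. True}"

lemma ideal_SI: "ideal SI CSR"
proof -
  interpret R: cring "CSR :: 'n cseries ring" by (rule convergent_series_ring_is_cring)
  show ?thesis unfolding SI_def
    by (rule R.genideal_ideal) (auto simp: CSR_simps convergent_series_lookup)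
qed

lemma SI_gen: "Poly_Mapping.lookup (g i) \<in> SI"
proof -
  interpret R: cring "CSR :: 'n cseries ring" by (rule convergent_series_ring_is_cring)
  have "{Poly_Mapping.lookup (g i) | i. True} \<subseteq> SI" unfolding SI_def
    by (rule R.genideal_self) (auto simp: CSR_simps convergent_series_lookup)
  then show ?thesis by blast
qed

lemma SI_zero: "(\<lambda>_. 0) \<in> SI"
proof -
  have "\<zero>\<^bsub>CSR\<^esub> \<in> SI" using additive_subgroup.zero_closed[OF ideal.axioms(1)[OF ideal_SI]] .
  then show ?thesis by (simp add: CSR_simps const_series_def)
qed

lemma SI_add: "a \<in> SI \<Longrightarrow> b \<in> SI \<Longrightarrow> (\<lambda>\<alpha>. a \<alpha> + b \<alpha>) \<in> SI"
  using additive_subgroup.a_closed[OF ideal.axioms(1)[OF ideal_SI]] by (simp add: CSR_simps)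

lemma SI_mult: "convergent_series c \<Longrightarrow> a \<in> SI \<Longrightarrow> series_mult c a \<in> SI"
  using ideal.I_l_closed[OF ideal_SI, of a c] by (simp add: CSR_simps)

lemma SI_sum: "(\<And>i. i \<in> A \<Longrightarrow> b i \<in> SI) \<Longrightarrow> (\<lambda>\<alpha>. \<Sum>i\<in>A. b i \<alpha>) \<in> SI"
proof (induction A rule: infinite_finite_induct)
  case (insert i A)
  then show ?case using SI_add[of "b i" "\<lambda>\<alpha>. \<Sum>i\<in>A. b i \<alpha>"] by simp
qed (simp_all add: SI_zero)

lemma SI_subset: "SI \<subseteq> series_combinations g"
proof -
  interpret R: cring "CSR :: 'n cseries ring" by (rule convergent_series_ring_is_cring)
  have "Poly_Mapping.lookup (g i) \<in> series_combinations g" for i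
  proof -
    let ?u = "\<lambda>j. const_series (if j = i then 1 else 0) :: 'n cseries"
    have "Poly_Mapping.lookup (g i) = (\<lambda>\<gamma>. \<Sum>j\<in>UNIV. series_mult (?u j) (Poly_Mapping.lookup (g j)) \<gamma>)"
      by (simp add: series_mult_const if_distrib[of "\<lambda>x. x * _"] cong: if_cong)
    then show ?thesis using series_combinationsI[of ?u g] by (simp add: convergent_series_const)
  qed
  then show ?thesis unfolding SI_def
    by (intro R.genideal_minimal ideal_series_combinations) auto
qed

lemma lookup_in_SI_iff: "Poly_Mapping.lookup p \<in> SI \<longleftrightarrow> p \<in> J"
proof
  assume "p \<in> J"
  then obtain u where u: "p = (\<Sum>i\<in>UNIV. u i * g i)" by (auto simp: gideal_def)
  have "Poly_Mapping.lookup p = (\<lambda>\<gamma>. \<Sum>i\<in>UNIV. series_mult (Poly_Mapping.lookup (u i)) (Poly_Mapping.lookup (g i)) \<gamma>)"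
    by (simp add: u fun_eq_iff lookup_sum lookup_mult_series)
  also have "\<dots> \<in> SI" by (intro SI_sum SI_mult convergent_series_lookup SI_gen)
  finally show "Poly_Mapping.lookup p \<in> SI" .
next
  assume "Poly_Mapping.lookup p \<in> SI"
  then have "Poly_Mapping.lookup p \<in> series_combinations g" using SI_subset by blast
  then obtain u where u: "Poly_Mapping.lookup p = (\<lambda>\<gamma>. \<Sum>i\<in>UNIV. series_mult (u i) (Poly_Mapping.lookup (g i)) \<gamma>)"
    unfolding series_combinations_def by blast
  have part: "hpart w k p \<in> J" for k
  proof -
    \<comment> \<open>Truncating each series \<open>u i\<close> to weight \<open>k - e i\<close>
      leaves a polynomial combination of the \<open>g i\<close> with the same component of weight
      \<open>k\<close>. Since \<open>p\<close> has finitely many components, they can be added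
      up.\<close>
    let ?q = "\<Sum>i\<in>UNIV. spart w (k - e i) (u i) * g i"
    have q: "whomog w k ?q"
    proof (rule whomog_sum)
      fix i
      have "whomog w (k - e i + e i) (spart w (k - e i) (u i) * g i)"
        by (intro whomog_mult whomog_spart whomog_g w_pos)
      then show "whomog w k (spart w (k - e i) (u i) * g i)" by simp
    qed
    have "hpart w k p = ?q"
    proof (rule poly_mapping_eqI)
      fix \<gamma>
      show "Poly_Mapping.lookup (hpart w k p) \<gamma> = Poly_Mapping.lookup ?q \<gamma>"
      proof (cases "int (weight w \<gamma>) = k")
        case True
        have "Poly_Mapping.lookup p \<gamma> = (\<Sum>i\<in>UNIV. series_mult (u i) (Poly_Mapping.lookup (g i)) \<gamma>)"
          by (simp add: u)
        also have "\<dots> = (\<Sum>i\<in>UNIV. Poly_Mapping.lookup (spart w (k - e i) (u i) * g i) \<gamma>)"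
          by (intro sum.cong refl series_mult_component[OF w_pos whomog_g True])
        finally show ?thesis using True by (simp add: lookup_hpart lookup_sum)
      next
        case False
        then have "Poly_Mapping.lookup ?q \<gamma> = 0" using q by (auto simp: whomog_def in_keys_iff)
        then show ?thesis using False by (simp add: lookup_hpart)
      qed
    qed
    moreover have "?q \<in> J" unfolding gideal_def by (intro CollectI exI) (rule refl)
    ultimately show ?thesis by simp
  qed
  have "(\<Sum>k\<in>(\<lambda>\<alpha>. int (weight w \<alpha>)) ` Poly_Mapping.keys p. hpart w k p) = p"
    by (rule sum_hpart) simp_all
  moreover have "(\<Sum>k\<in>(\<lambda>\<alpha>. int (weight w \<alpha>)) ` Poly_Mapping.keys p. hpart w k p) \<in> J"
    by (intro gideal_sum part)
  ultimately show "p \<in> J" by simp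
qed

text \<open>All but the finitely many exponents in \<open>Q\<close> are divisible by some
  \<open>var i ^ M i\<close>. The quotients \<open>s i\<close> are shifted restrictions of
  \<open>a\<close>, hence convergent.\<close>

lemma polynomial_remainder:
  assumes a: "convergent_series a"
  shows "\<exists>p. (\<lambda>\<alpha>. a \<alpha> - Poly_Mapping.lookup p \<alpha>) \<in> SI"
proof -
  have "\<forall>i. \<exists>N. var i ^ N \<in> J" by (rule allI) (rule nilpotent)
  from choice[OF this] obtain M where M: "\<forall>i. var i ^ M i \<in> J" by (rule exE)
  define Q where "Q = {\<alpha> :: 'n expo. \<forall>i. Poly_Mapping.lookup \<alpha> i < M i}"
  have "Q \<subseteq> {\<alpha>. \<forall>i. Poly_Mapping.lookup \<alpha> i \<le> (\<Sum>i\<in>UNIV. M i)}"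
  proof (clarify, unfold Q_def mem_Collect_eq)
    fix \<alpha> :: "'n expo" and i assume "\<forall>i. Poly_Mapping.lookup \<alpha> i < M i"
    then have "Poly_Mapping.lookup \<alpha> i \<le> M i" by (simp add: less_imp_le)
    also have "\<dots> \<le> (\<Sum>i\<in>UNIV. M i)" by (rule member_le_sum) auto
    finally show "Poly_Mapping.lookup \<alpha> i \<le> (\<Sum>i\<in>UNIV. M i)" .
  qed
  then have finQ: "finite Q" using finite_expo_bounded by (rule finite_subset)
  \<comment> \<open>Each monomial outside \<open>Q\<close> is assigned to a single variable, so the
    \<open>b i\<close> add up to \<open>a\<close> there without overlap.\<close>
  define \<iota> where "\<iota> \<alpha> = (SOME i. M i \<le> Poly_Mapping.lookup \<alpha> i)" for \<alpha> :: "'n expo"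
  have \<iota>: "M (\<iota> \<alpha>) \<le> Poly_Mapping.lookup \<alpha> (\<iota> \<alpha>)" if "\<alpha> \<notin> Q" for \<alpha>
    unfolding \<iota>_def by (rule someI_ex) (use that in \<open>auto simp: Q_def not_less\<close>)
  define E where "E i = Poly_Mapping.single i (M i)" for i
  define b where "b i \<alpha> = (if \<alpha> \<notin> Q \<and> \<iota> \<alpha> = i then a \<alpha> else 0)" for i \<alpha>
  define s where "s i \<beta> = b i (\<beta> + E i)" for i \<beta>
  have conv: "convergent_series (s i)" for i
    unfolding s_def b_def by (intro convergent_series_shift convergent_series_restrict a)
  define p where "p = (\<Sum>\<alpha>\<in>Q. Poly_Mapping.single \<alpha> (a \<alpha>))"
  have "series_mult (s i) (Poly_Mapping.lookup (var i ^ M i)) \<gamma> = b i \<gamma>" for i \<gamma>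
  proof (cases "\<exists>\<beta>. \<gamma> = \<beta> + E i")
    case True
    then show ?thesis by (auto simp: var_power series_mult_single s_def simp flip: E_def)
  next
    case False
    have "\<not> M i \<le> Poly_Mapping.lookup \<gamma> i"
    proof
      assume "M i \<le> Poly_Mapping.lookup \<gamma> i"
      then have "\<gamma> = (\<gamma> - E i) + E i"
        by (intro poly_mapping_eqI) (auto simp: E_def lookup_add lookup_minus lookup_single when_def)
      then show False using False by blast
    qed
    then have "b i \<gamma> = 0" using \<iota>[of \<gamma>] by (auto simp: b_def)
    then show ?thesis using False by (simp add: var_power series_mult_single flip: E_def)
  qed
  then have "(\<lambda>\<gamma>. \<Sum>i\<in>UNIV. series_mult (s i) (Poly_Mapping.lookup (var i ^ M i)) \<gamma>) = (\<lambda>\<gamma>. \<Sum>i\<in>UNIV. b i \<gamma>)"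
    by simp
  also have "\<dots> = (\<lambda>\<gamma>. a \<gamma> - Poly_Mapping.lookup p \<gamma>)"
  proof
    fix \<gamma>
    show "(\<Sum>i\<in>UNIV. b i \<gamma>) = a \<gamma> - Poly_Mapping.lookup p \<gamma>"
      unfolding p_def lookup_sum_single[OF finQ] by (cases "\<gamma> \<in> Q") (simp_all add: b_def)
  qed
  finally have "(\<lambda>\<gamma>. \<Sum>i\<in>UNIV. series_mult (s i) (Poly_Mapping.lookup (var i ^ M i)) \<gamma>) = (\<lambda>\<gamma>. a \<gamma> - Poly_Mapping.lookup p \<gamma>)" .
  moreover have "(\<lambda>\<gamma>. \<Sum>i\<in>UNIV. series_mult (s i) (Poly_Mapping.lookup (var i ^ M i)) \<gamma>) \<in> SI"
    using M by (intro SI_sum SI_mult conv) (simp add: lookup_in_SI_iff)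
  ultimately have "(\<lambda>\<gamma>. a \<gamma> - Poly_Mapping.lookup p \<gamma>) \<in> SI" by simp
  then show ?thesis by blast
qed

subsection \<open>Dimension of the quotient\<close>

abbreviation MA :: "'n cseries set ring" where "MA \<equiv> CSR Quot SI"

abbreviation coset :: "'n cseries \<Rightarrow> 'n cseries set" where "coset a \<equiv> SI +>\<^bsub>CSR\<^esub> a"

definition pcoset :: "'n cmpoly \<Rightarrow> 'n cseries set" where
  "pcoset p = coset (Poly_Mapping.lookup p)"

definition scalars :: "'n cseries set set" where
  "scalars = {coset (const_series c) | c. True}"

lemma coset_hom: "coset \<in> ring_hom CSR MA"
  by (rule ideal.rcos_ring_hom[OF ideal_SI])

lemma ring_MA: "ring MA"
  by (rule ideal.quotient_is_ring[OF ideal_SI])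

lemma coset_SI: "a \<in> SI \<Longrightarrow> coset a = \<zero>\<^bsub>MA\<^esub>"
proof -
  interpret R: cring "CSR :: 'n cseries ring" by (rule convergent_series_ring_is_cring)
  interpret I: ideal SI CSR by (rule ideal_SI)
  assume "a \<in> SI"
  then show ?thesis using I.a_rcos_const by (simp add: FactRing_def)
qed

lemma coset_self: "convergent_series a \<Longrightarrow> a \<in> coset a"
proof -
  interpret I: ideal SI CSR by (rule ideal_SI)
  assume "convergent_series a"
  then show ?thesis using I.a_rcos_self by (simp add: CSR_simps)
qed

lemma pcoset_carrier: "pcoset p \<in> carrier MA"
  using ring_hom_closed[OF coset_hom] by (simp add: pcoset_def CSR_simps convergent_series_lookup)

lemma pcoset_add: "pcoset (p + q) = pcoset p \<oplus>\<^bsub>MA\<^esub> pcoset q"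
proof -
  have "Poly_Mapping.lookup (p + q) = Poly_Mapping.lookup p \<oplus>\<^bsub>CSR\<^esub> Poly_Mapping.lookup q"
    by (simp add: CSR_simps fun_eq_iff lookup_add)
  then show ?thesis unfolding pcoset_def
    using ring_hom_add[OF coset_hom, of "Poly_Mapping.lookup p" "Poly_Mapping.lookup q"]
    by (simp add: CSR_simps(1) convergent_series_lookup)
qed

lemma pcoset_cscale: "pcoset (cscale c p) = pcoset (cst c) \<otimes>\<^bsub>MA\<^esub> pcoset p"
proof -
  have "Poly_Mapping.lookup (cscale c p) = Poly_Mapping.lookup (cst c) \<otimes>\<^bsub>CSR\<^esub> Poly_Mapping.lookup p"
    by (simp add: CSR_simps cscale_def lookup_mult_series)
  then show ?thesis unfolding pcoset_def
    using ring_hom_mult[OF coset_hom, of "Poly_Mapping.lookup (cst c)" "Poly_Mapping.lookup p"]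
    by (simp add: CSR_simps(1) convergent_series_lookup)
qed

lemma pcoset_J: "p \<in> J \<Longrightarrow> pcoset p = \<zero>\<^bsub>MA\<^esub>"
  unfolding pcoset_def by (rule coset_SI) (simp add: lookup_in_SI_iff)

lemma pcoset_eqD:
  assumes "pcoset p = pcoset q"
  shows "p - q \<in> J"
proof -
  have "Poly_Mapping.lookup p \<in> coset (Poly_Mapping.lookup q)"
    using coset_self[OF convergent_series_lookup, of p] assms by (simp add: pcoset_def)
  then obtain h where h: "h \<in> SI" "Poly_Mapping.lookup p = h \<oplus>\<^bsub>CSR\<^esub> Poly_Mapping.lookup q"
    unfolding a_r_coset_def' by blast
  have "Poly_Mapping.lookup (p - q) = h"
    using h(2) by (simp add: CSR_simps fun_eq_iff lookup_minus)
  then show ?thesis using h(1) lookup_in_SI_iff by blast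
qed

lemma pcoset_eqI:
  assumes "p - q \<in> J"
  shows "pcoset p = pcoset q"
proof -
  interpret Q: ring MA by (rule ring_MA)
  have "pcoset p = pcoset ((p - q) + q)" by simp
  also have "\<dots> = pcoset q" unfolding pcoset_add pcoset_J[OF assms] by (rule Q.l_zero[OF pcoset_carrier])
  finally show ?thesis .
qed

lemma carrier_MA: "carrier MA = range pcoset"
proof
  show "range pcoset \<subseteq> carrier MA" using pcoset_carrier by blast
  interpret Q: ring MA by (rule ring_MA)
  show "carrier MA \<subseteq> range pcoset"
  proof
    fix x assume "x \<in> carrier MA"
    then obtain a where a: "convergent_series a" "x = coset a"
      unfolding FactRing_def A_RCOSETS_def' by (auto simp: CSR_simps(1))
    obtain p where p: "(\<lambda>\<alpha>. a \<alpha> - Poly_Mapping.lookup p \<alpha>) \<in> SI" using polynomial_remainder[OF a(1)] by blast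
    let ?h = "\<lambda>\<alpha>. a \<alpha> - Poly_Mapping.lookup p \<alpha>"
    have h: "?h \<in> carrier CSR" using p ideal.Icarr[OF ideal_SI] by blast
    have "a = ?h \<oplus>\<^bsub>CSR\<^esub> Poly_Mapping.lookup p" by (simp add: CSR_simps)
    then have "coset a = coset ?h \<oplus>\<^bsub>MA\<^esub> pcoset p"
      unfolding pcoset_def using ring_hom_add[OF coset_hom h, of "Poly_Mapping.lookup p"]
      by (simp add: CSR_simps(1) convergent_series_lookup)
    also have "\<dots> = pcoset p" unfolding coset_SI[OF p] by (rule Q.l_zero[OF pcoset_carrier])
    finally show "x \<in> range pcoset" using a(2) by simp
  qed
qed

lemma scalars_eq: "scalars = range (\<lambda>c. pcoset (cst c))"
  by (auto simp: scalars_def pcoset_def const_series_eq_lookup)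

text \<open>Elements of \<open>J\<close> vanish at the origin. So the quotient is not the zero ring,
  and the constants embed into it.\<close>

lemma one_notin_J: "1 \<notin> J"
proof
  assume "1 \<in> J"
  then obtain u where "1 = (\<Sum>i\<in>UNIV. u i * g i)" by (auto simp: gideal_def)
  then have "eval_poly 1 (0 :: complex ^ 'n) = eval_poly (\<Sum>i\<in>UNIV. u i * g i) 0" by simp
  then show False by (simp add: eval_poly_sum eval_poly_mult g_at_0)
qed

lemma pcoset_one: "pcoset 1 = \<one>\<^bsub>MA\<^esub>"
proof -
  have "Poly_Mapping.lookup (1 :: 'n cmpoly) = \<one>\<^bsub>CSR\<^esub>"
    using const_series_eq_lookup[of 1, symmetric] by (simp add: CSR_simps(4))
  then show ?thesis unfolding pcoset_def using ring_hom_one[OF coset_hom] by simp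
qed

lemma pcoset_zero: "pcoset 0 = \<zero>\<^bsub>MA\<^esub>"
  by (rule pcoset_J) simp

lemma pcoset_cst_mult: "pcoset (cst a) \<otimes>\<^bsub>MA\<^esub> pcoset (cst b) = pcoset (cst (a * b))"
  unfolding pcoset_cscale[symmetric] by (simp add: cscale_def mult_single)

lemma pcoset_cst_eq_0: "pcoset (cst c) = \<zero>\<^bsub>MA\<^esub> \<longleftrightarrow> c = 0"
proof
  assume "pcoset (cst c) = \<zero>\<^bsub>MA\<^esub>"
  then have "cst c \<in> J" using pcoset_eqD[of "cst c" 0] pcoset_zero by simp
  then have "cst (1 / c) * cst c \<in> J" by (rule gideal_mult)
  then show "c = 0" using one_notin_J by (cases "c = 0") (simp_all add: mult_single)
qed (simp add: pcoset_zero)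

text \<open>Lets \<open>ring.dim\<close> be read off from \<open>ring.dimension\<close>. The
  constants map homomorphically with kernel 0, so inverses carry over.\<close>

lemma subfield_scalars: "subfield scalars MA"
proof -
  interpret R: cring "CSR :: 'n cseries ring" by (rule convergent_series_ring_is_cring)
  interpret Q: cring MA by (rule ideal.quotient_is_cring[OF ideal_SI R.cring_axioms])
  have sub: "subring scalars MA"
  proof (rule Q.subringI)
    show "scalars \<subseteq> carrier MA" using pcoset_carrier by (auto simp: scalars_eq)
    show "\<one>\<^bsub>MA\<^esub> \<in> scalars" unfolding scalars_eq pcoset_one[symmetric] by (rule range_eqI[of _ _ 1]) simp
    fix x y assume xy: "x \<in> scalars" "y \<in> scalars"
    then obtain a b where ab: "x = pcoset (cst a)" "y = pcoset (cst b)" by (auto simp: scalars_eq)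
    show "x \<otimes>\<^bsub>MA\<^esub> y \<in> scalars" unfolding ab pcoset_cst_mult scalars_eq by blast
    show "x \<oplus>\<^bsub>MA\<^esub> y \<in> scalars" unfolding ab pcoset_add[symmetric] single_add[symmetric] scalars_eq by blast
  next
    fix x assume "x \<in> scalars"
    then obtain a where a: "x = pcoset (cst a)" by (auto simp: scalars_eq)
    have "pcoset (cst (- a)) \<oplus>\<^bsub>MA\<^esub> x = \<zero>\<^bsub>MA\<^esub>"
      unfolding a pcoset_add[symmetric] single_add[symmetric] by (simp add: pcoset_zero)
    then have "\<ominus>\<^bsub>MA\<^esub> x = pcoset (cst (- a))"
      using a pcoset_carrier by (intro Q.minus_equality) simp_all
    then show "\<ominus>\<^bsub>MA\<^esub> x \<in> scalars" by (simp add: scalars_eq)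
  qed
  show ?thesis
  proof (rule Q.subfieldI)
    show "subcring scalars MA"
      using Q.subcringI[OF sub] Q.m_comm pcoset_carrier by (auto simp: scalars_eq)
    show "Units (MA\<lparr>carrier := scalars\<rparr>) = scalars - {\<zero>\<^bsub>MA\<^esub>}"
    proof (intro Set.set_eqI iffI)
      fix x assume "x \<in> Units (MA\<lparr>carrier := scalars\<rparr>)"
      then obtain y where x: "x \<in> scalars" "y \<in> scalars" "x \<otimes>\<^bsub>MA\<^esub> y = \<one>\<^bsub>MA\<^esub>"
        by (auto simp: Units_def)
      have "x \<noteq> \<zero>\<^bsub>MA\<^esub>"
      proof
        assume 0: "x = \<zero>\<^bsub>MA\<^esub>"
        have "y \<in> carrier MA" using x(2) pcoset_carrier by (auto simp: scalars_eq)
        then have "\<one>\<^bsub>MA\<^esub> = \<zero>\<^bsub>MA\<^esub>" using x(3) 0 by simp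
        then have "pcoset (cst 1) = \<zero>\<^bsub>MA\<^esub>" using pcoset_one by simp
        then show False unfolding pcoset_cst_eq_0 by simp
      qed
      then show "x \<in> scalars - {\<zero>\<^bsub>MA\<^esub>}" using x(1) by simp
    next
      fix x assume x: "x \<in> scalars - {\<zero>\<^bsub>MA\<^esub>}"
      then obtain a where a: "x = pcoset (cst a)" by (auto simp: scalars_eq)
      then have "a \<noteq> 0" using x pcoset_cst_eq_0 by simp
      then have "pcoset (cst (1 / a)) \<otimes>\<^bsub>MA\<^esub> x = \<one>\<^bsub>MA\<^esub>" "x \<otimes>\<^bsub>MA\<^esub> pcoset (cst (1 / a)) = \<one>\<^bsub>MA\<^esub>"
        unfolding a pcoset_cst_mult by (simp_all add: pcoset_one)
      moreover have "pcoset (cst (1 / a)) \<in> scalars" by (simp add: scalars_eq)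
      ultimately show "x \<in> Units (MA\<lparr>carrier := scalars\<rparr>)" using x by (auto simp: Units_def)
    qed
  qed
qed

text \<open>\<open>Span\<close> grows by one line per list entry; distinctness lets a single
  coefficient function on the set describe all entries.\<close>

lemma Span_pcoset:
  assumes "distinct bs"
  shows "ring.Span MA scalars (map pcoset bs) = {pcoset (\<Sum>b\<in>set bs. cscale (c b) b) | c. True}"
  using assms
proof (induction bs)
  case Nil
  interpret Q: ring MA by (rule ring_MA)
  show ?case by (simp add: pcoset_zero)
next
  case (Cons b bs)
  interpret Q: ring MA by (rule ring_MA)
  have Span: "Q.Span scalars (map pcoset (b # bs)) = Q.line_extension scalars (pcoset b) (Q.Span scalars (map pcoset bs))"
    by simp
  have sum_upd: "(\<Sum>x\<in>set (b # bs). cscale (c x) x) = cscale (c b) b + (\<Sum>x\<in>set bs. cscale (c x) x)" for c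
    using Cons.prems by simp
  show ?case
  proof (intro Set.set_eqI iffI)
    fix x assume "x \<in> Q.Span scalars (map pcoset (b # bs))"
    then obtain k v where kv: "k \<in> scalars" "v \<in> Q.Span scalars (map pcoset bs)" "x = k \<otimes>\<^bsub>MA\<^esub> pcoset b \<oplus>\<^bsub>MA\<^esub> v"
      unfolding Span Q.line_extension_mem_iff by blast
    obtain a c where a: "k = pcoset (cst a)" and c: "v = pcoset (\<Sum>b\<in>set bs. cscale (c b) b)"
      using kv(1,2) Cons by (auto simp: scalars_eq)
    have "(\<Sum>x\<in>set bs. cscale ((c(b := a)) x) x) = (\<Sum>x\<in>set bs. cscale (c x) x)"
      using Cons.prems by (intro sum.cong) auto
    then have "x = pcoset (\<Sum>x\<in>set (b # bs). cscale ((c(b := a)) x) x)"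
      unfolding sum_upd pcoset_add pcoset_cscale kv(3) a c by simp
    then show "x \<in> {pcoset (\<Sum>b\<in>set (b # bs). cscale (c b) b) | c. True}" by blast
  next
    fix x assume "x \<in> {pcoset (\<Sum>b\<in>set (b # bs). cscale (c b) b) | c. True}"
    then obtain c where "x = pcoset (\<Sum>x\<in>set (b # bs). cscale (c x) x)" by blast
    then have x: "x = pcoset (cst (c b)) \<otimes>\<^bsub>MA\<^esub> pcoset b \<oplus>\<^bsub>MA\<^esub> pcoset (\<Sum>x\<in>set bs. cscale (c x) x)"
      unfolding sum_upd pcoset_add pcoset_cscale .
    have "pcoset (\<Sum>x\<in>set bs. cscale (c x) x) \<in> Q.Span scalars (map pcoset bs)" using Cons by auto
    moreover have "pcoset (cst (c b)) \<in> scalars" by (simp add: scalars_eq)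
    ultimately show "x \<in> Q.Span scalars (map pcoset (b # bs))"
      unfolding Span Q.line_extension_mem_iff using x by blast
  qed
qed

text \<open>Independence of a list means that no entry lies in the span of the later ones. Such a
  membership is a relation modulo \<open>J\<close> with coefficient 1 at the head.\<close>

lemma independent_pcoset:
  assumes "distinct bs" and ind: "\<And>c b. (\<Sum>b\<in>set bs. cscale (c b) b) \<in> J \<Longrightarrow> b \<in> set bs \<Longrightarrow> c b = 0"
  shows "ring.independent MA scalars (map pcoset bs)"
  using assms
proof (induction bs)
  case Nil
  interpret Q: ring MA by (rule ring_MA)
  show ?case by simp
next
  case (Cons b bs)
  interpret Q: ring MA by (rule ring_MA)
  have "Q.independent scalars (map pcoset bs)"
  proof (rule Cons.IH)
    show "distinct bs" using Cons.prems(1) by simp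
    fix c x assume c: "(\<Sum>b\<in>set bs. cscale (c b) b) \<in> J" and x: "x \<in> set bs"
    have "(\<Sum>x\<in>set bs. cscale ((c(b := 0)) x) x) = (\<Sum>x\<in>set bs. cscale (c x) x)"
      using Cons.prems(1) by (intro sum.cong) auto
    then have "(\<Sum>x\<in>set (b # bs). cscale ((c(b := 0)) x) x) \<in> J" using c Cons.prems(1) by simp
    then have "(c(b := 0)) x = 0" by (rule Cons.prems(2)) (use x in simp)
    then show "c x = 0" using x Cons.prems(1) by (auto split: if_splits)
  qed
  moreover have "pcoset b \<notin> Q.Span scalars (map pcoset bs)"
  proof
    assume "pcoset b \<in> Q.Span scalars (map pcoset bs)"
    then obtain c where "pcoset b = pcoset (\<Sum>x\<in>set bs. cscale (c x) x)"
      unfolding Span_pcoset[OF distinct.simps(2)[THEN iffD1, OF Cons.prems(1), THEN conjunct2]] by blast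
    then have bJ: "b - (\<Sum>x\<in>set bs. cscale (c x) x) \<in> J" by (rule pcoset_eqD)
    let ?d = "\<lambda>x. if x = b then 1 else - c x"
    have "(\<Sum>x\<in>set bs. cscale (?d x) x) = (\<Sum>x\<in>set bs. - cscale (c x) x)"
      using Cons.prems(1) by (intro sum.cong) auto
    then have "(\<Sum>x\<in>set (b # bs). cscale (?d x) x) = b - (\<Sum>x\<in>set bs. cscale (c x) x)"
      using Cons.prems(1) by (simp add: sum_negf)
    then have "(\<Sum>x\<in>set (b # bs). cscale (?d x) x) \<in> J" using bJ by (simp only:)
    then have "?d b = 0" by (rule Cons.prems(2)) simp
    then show False by simp
  qed
  ultimately show ?case using pcoset_carrier by (simp add: Q.li_Cons)
qed

theorem quotient_dimension:
  "\<exists>n. ring.dimension MA n scalars (carrier MA) \<and> int n * (\<Prod>i\<in>UNIV. int (w i)) = (\<Prod>l\<in>UNIV. e l)"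
proof -
  interpret Q: ring MA by (rule ring_MA)
  obtain B where B: "finite B" "int (card B) * (\<Prod>i\<in>UNIV. int (w i)) = (\<Prod>l\<in>UNIV. e l)"
    "\<forall>p. \<exists>c. p - (\<Sum>b\<in>B. cscale (c b) b) \<in> J" "\<forall>c. (\<Sum>b\<in>B. cscale (c b) b) \<in> J \<longrightarrow> (\<forall>b\<in>B. c b = 0)"
    using quotient_basis by blast
  obtain bs where bs: "set bs = B" "distinct bs" using finite_distinct_list[OF B(1)] by blast
  have ind: "Q.independent scalars (map pcoset bs)"
    by (rule independent_pcoset[OF bs(2)]) (use B(4) bs(1) in blast)
  have Span: "Q.Span scalars (map pcoset bs) = carrier MA"
    unfolding Span_pcoset[OF bs(2)] carrier_MA bs(1)
  proof (intro Set.set_eqI iffI)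
    fix x assume "x \<in> range pcoset"
    then obtain p where p: "x = pcoset p" by blast
    obtain c where "p - (\<Sum>b\<in>B. cscale (c b) b) \<in> J" using B(3) by blast
    then have "x = pcoset (\<Sum>b\<in>B. cscale (c b) b)" unfolding p by (rule pcoset_eqI)
    then show "x \<in> {pcoset (\<Sum>b\<in>B. cscale (c b) b) | c. True}" by blast
  qed blast
  from Q.dimension_independent[OF ind] have "Q.dimension (length bs) scalars (carrier MA)"
    unfolding Span length_map .
  moreover have "length bs = card B" using bs distinct_card by metis
  ultimately show ?thesis using B(2) by auto
qed

end

lemma whomog_partial_deriv:
  assumes "weighted_homogeneous w d f"
  shows "whomog w (int d - int (w i)) (partial_deriv i f)"
  unfolding partial_deriv_def
proof (rule whomog_sum)
  fix \<alpha> assume \<alpha>: "\<alpha> \<in> Poly_Mapping.keys f"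
  show "whomog w (int d - int (w i)) (Poly_Mapping.single (\<alpha> - Poly_Mapping.single i 1)
      (of_nat (Poly_Mapping.lookup \<alpha> i) * Poly_Mapping.lookup f \<alpha>))"
  \<comment> \<open>If \<open>x_i\<close> does not occur, truncated subtraction leaves an exponent
    of the wrong weight, but its coefficient is 0 and the zero polynomial is homogeneous of every
    degree.\<close>
  proof (cases "Poly_Mapping.lookup \<alpha> i = 0")
    case False
    have "weight w ((\<alpha> - Poly_Mapping.single i 1) + Poly_Mapping.single i 1) = weight w \<alpha>"
      using False by (intro arg_cong[of _ _ "weight w"] poly_mapping_eqI)
        (auto simp: lookup_add lookup_minus lookup_single when_def)
    also have "\<dots> = d" using assms \<alpha> by (simp add: weighted_homogeneous_def weight_def)
    finally show ?thesis by (intro whomog_single) (simp add: weight_add)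
  qed simp
qed

theorem theorem1:
  fixes w :: "'n::finite \<Rightarrow> nat" and d :: nat and f :: "'n cmpoly"
  assumes "\<And>i. 0 < w i"
    and "weighted_homogeneous w d f"
    and "isolated_singularity f"
  shows "milnor_finite f \<and>
    real (milnor_number f) = (\<Prod>i\<in>UNIV. (real d - real (w i)) / real (w i))"
proof -
  let ?e = "\<lambda>i. int d - int (w i)" and ?g = "\<lambda>i. partial_deriv i f"
  obtain U where U: "open U" "0 \<in> U" "\<And>x. x \<in> U \<Longrightarrow> (\<And>i. eval_poly (?g i) x = 0) \<Longrightarrow> x = 0"
    using assms(3) unfolding isolated_singularity_def by blast
  have whomog: "whomog w (?e i) (?g i)" for i by (rule whomog_partial_deriv[OF assms(2)])
  interpret graded_zero_dimensional w ?e ?g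
  proof
    show "\<exists>N. var i ^ N \<in> gideal ?g UNIV" for i
      by (rule isolated_zero_nilpotent[OF assms(1) whomog U])
  qed (use assms whomog in \<open>simp_all add: isolated_singularity_def\<close>)
  have MA: "milnor_algebra f = MA" "milnor_scalars f = scalars"
    by (simp_all add: milnor_algebra_def milnor_scalars_def scalars_def SI_def jacobian_ideal_def)
  interpret Q: ring MA by (rule ring_MA)
  obtain n where n: "Q.dimension n scalars (carrier MA)" "int n * (\<Prod>i\<in>UNIV. int (w i)) = (\<Prod>i\<in>UNIV. ?e i)"
    using quotient_dimension by blast
  have "milnor_finite f" unfolding milnor_finite_def MA by (rule Q.finite_dimensionI[OF n(1)])
  moreover have "milnor_number f = n"
    unfolding milnor_number_def MA using Q.dimI[OF subfield_scalars n(1)] by (simp add: over_def)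
  \<comment> \<open>The degrees were kept as integers, so the differences pass to the reals without
    truncation.\<close>
  moreover have "real n * (\<Prod>i\<in>UNIV. real (w i)) = (\<Prod>i\<in>UNIV. real d - real (w i))"
    using arg_cong[OF n(2), of real_of_int] by simp
  moreover have "(\<Prod>i\<in>UNIV. real (w i)) \<noteq> 0" using assms(1) by (simp add: less_imp_neq[symmetric])
  ultimately show ?thesis by (simp add: prod_dividef field_simps)
qed

end
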